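(* Let $F$ be a free group and let $R$ be a normal subgroup of $F$. Then each of the groups $$R'/[R,R\cap F'],$$ $$\gamma_3(R)/\gamma_4(R)[R,R\cap F',R\cap F'],$$ $$\gamma_4(R)/\gamma_5(R)[R,R\cap F',R\cap F',R\cap F']\,[\,[R,R\cap F'],[R,R\cap F']\,]$$ is free abelian.
   Context: For a group $G$, $\{\gamma_n(G)\}_{n\ge 1}$ denotes the lower central series of $G$ (with $\gamma_1(G)=G$), and $G'=\gamma_2(G)=[G,G]$ is the derived group. For subgroups $A,B$ of a group, $[A,B]$ is the subgroup generated by all commutators $[a,b]$ with $a\in A$, $b\in B$; longer commutators are left-normed: $[A,B,C]=[[A,B],C]$ and $[A,B,C,D]=[[[A,B],C],D]$. In a quotient such as $\gamma_3(R)/\gamma_4(R)[R,R\cap F',R\cap F']$, the denominator is the product of the displayed subgroups. *)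

theory Defs
  imports "HOL-Algebra.Generated_Groups" "HOL-Algebra.Free_Abelian_Groups"
begin

section \<open>Free groups\<close>

text \<open>
  A letter \<open>(x, True)\<close> stands for \<open>x\<close> and \<open>(x, False)\<close> for the inverse of \<open>x\<close>; a word is reduced
  if no letter is followed by its inverse.
\<close>

definition reduced_words :: "'a set \<Rightarrow> ('a \<times> bool) list set" where
  "reduced_words X =
     {w. fst ` set w \<subseteq> X \<and> successively (\<lambda>(x, b) (y, c). x = y \<longrightarrow> b = c) w}"

fun word_value :: "('a, 'm) monoid_scheme \<Rightarrow> ('a \<times> bool) list \<Rightarrow> 'a" where
  "word_value G [] = \<one>\<^bsub>G\<^esub>"
| "word_value G ((x, b) # w) = (if b then x else inv\<^bsub>G\<^esub> x) \<otimes>\<^bsub>G\<^esub> word_value G w"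

definition free_basis :: "('a, 'm) monoid_scheme \<Rightarrow> 'a set \<Rightarrow> bool" where
  "free_basis G X \<longleftrightarrow>
     X \<subseteq> carrier G \<and> bij_betw (word_value G) (reduced_words X) (carrier G)"

definition is_free_group :: "('a, 'm) monoid_scheme \<Rightarrow> bool" where
  "is_free_group G \<longleftrightarrow> group G \<and> (\<exists>X. free_basis G X)"

text \<open>
  A basis can be chosen inside the group, so restricting the index set \<open>S\<close> to the
  element type of \<open>A\<close> loses nothing.
\<close>

definition is_free_abelian_group :: "('a, 'm) monoid_scheme \<Rightarrow> bool" where
  "is_free_abelian_group A \<longleftrightarrow> group A \<and> (\<exists>S :: 'a set. A \<cong> free_Abelian_group S)"

section \<open>Commutator subgroups and the lower central series\<close>

text \<open>
  The commutator convention is that of \<^const>\<open>derived\<close>, so that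
  \<open>commutator_subgroup G H H = derived G H\<close>.
\<close>

definition commutator_subgroup ::
  "('a, 'm) monoid_scheme \<Rightarrow> 'a set \<Rightarrow> 'a set \<Rightarrow> 'a set" where
  "commutator_subgroup G A B =
     generate G (\<Union>a \<in> A. \<Union>b \<in> B. {a \<otimes>\<^bsub>G\<^esub> b \<otimes>\<^bsub>G\<^esub> inv\<^bsub>G\<^esub> a \<otimes>\<^bsub>G\<^esub> inv\<^bsub>G\<^esub> b})"

text \<open>
  For a subgroup \<open>H\<close> of \<open>G\<close>, \<open>lower_central G H n\<close> is the \<open>n\<close>-th term of the lower central
  series of \<open>H\<close> itself, formed with the operations of \<open>G\<close>. The series starts at index 1; the
  value at 0 is a dummy.
\<close>

fun lower_central :: "('a, 'm) monoid_scheme \<Rightarrow> 'a set \<Rightarrow> nat \<Rightarrow> 'a set" where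
  "lower_central G H 0 = H"
| "lower_central G H (Suc 0) = H"
| "lower_central G H (Suc (Suc n)) = commutator_subgroup G (lower_central G H (Suc n)) H"

lemma commutator_subgroup_self: "commutator_subgroup G H H = derived G H"
  by (simp add: commutator_subgroup_def derived_def)

lemma lower_central_2: "lower_central G H 2 = derived G H"
  by (simp add: numeral_2_eq_2 commutator_subgroup_self)

end

theory Submission
  imports Defs "HOL-Library.Multiset"
begin

text \<open>
  Put \<open>S = R \<inter> F'\<close>. Since \<open>R/S\<close> embeds in the free abelian group \<open>F/F'\<close>, the free abelian group \<open>R/R'\<close>
  splits as \<open>S/R' \<oplus> R/S\<close>, and it has a basis \<open>Z\<close>, represented by elements of \<open>R\<close>, whose members in \<open>S\<close>
  are a basis of \<open>S/R'\<close>. As \<open>R\<close> is free, the Lie ring of its lower central series is the free Lie ring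
  on \<open>Z\<close>, graded by the number of letters from \<open>S\<close>. Modulo \<open>\<gamma>\<^sub>n\<^sub>+\<^sub>1(R)\<close>, the denominators are spanned
  by multihomogeneous pieces: in degrees two and three they are the parts with at least one and at
  least two letters from \<open>S\<close>; in degree four it is the part with at least three such letters, together
  with the brackets \<open>[[b, a], [b', a']]\<close> with \<open>a, a'\<close> in \<open>S\<close>. What is left is free abelian in each case.

  The proof realises this without constructing the free Lie ring. A subgroup of a free abelian group
  is free abelian, so for each quotient it suffices to find a homomorphism from \<open>\<gamma>\<^sub>n(R)\<close> into a free
  abelian group whose kernel is the denominator (\<open>free_abelian_quotient\<close>). Such a homomorphism comes
  from a Magnus representation \<open>\<mu>\<close> of \<open>R\<close> by noncommutative power series in the letters \<open>Z\<close>: on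
  \<open>\<gamma>\<^sub>n(R)\<close> the part of degree \<open>n\<close> is additive, it sends an iterated commutator of basis elements to the
  corresponding Lie polynomial, and its coefficients at suitably chosen words vanish on the
  denominator \<open>D\<close>. That nothing else is killed is shown by an explicit linear map \<open>\<psi>\<close> from words to
  formal combinations of iterated commutators, which inverts the expansion into Lie polynomials up to
  relations holding in \<open>\<gamma>\<^sub>n(R)/D\<close> (\<open>retract2\<close>, \<open>retract3\<close>, \<open>retract4\<close> and
  \<open>quotient_free_abelian_by_retraction\<close>). The relations are antisymmetry, the Jacobi identity and the
  triviality of the brackets listed above.

  Freeness of \<open>F\<close> enters through one fact: subgroups of free groups are projective
  (\<open>subgroup_of_free_group_projective\<close>). It gives the embeddings of \<open>R/R'\<close> and \<open>F/F'\<close> into free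
  abelian groups, by lifting along a presentation of the abelianization, and the Magnus representation, by
  lifting along the map that sends a power series with constant term 1 to its linear part.
\<close>

abbreviation keys :: "('b \<Rightarrow>\<^sub>0 int) \<Rightarrow> 'b set" where "keys \<equiv> Poly_Mapping.keys"

abbreviation lookup :: "('b \<Rightarrow>\<^sub>0 int) \<Rightarrow> 'b \<Rightarrow> int" where "lookup \<equiv> Poly_Mapping.lookup"

section \<open>Subgroups of free abelian groups\<close>

definition additive_on :: "('a, 'm) monoid_scheme \<Rightarrow> 'a set \<Rightarrow> ('a \<Rightarrow> 'b::ab_group_add) \<Rightarrow> bool" where
  "additive_on G H f \<longleftrightarrow> (\<forall>x\<in>H. \<forall>y\<in>H. f (x \<otimes>\<^bsub>G\<^esub> y) = f x + f y)"

context group begin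

lemma additive_on_mult: "additive_on G H f \<Longrightarrow> x \<in> H \<Longrightarrow> y \<in> H \<Longrightarrow> f (x \<otimes> y) = f x + f y"
  by (simp add: additive_on_def)

lemma additive_on_one: "additive_on G H f \<Longrightarrow> subgroup H G \<Longrightarrow> f \<one> = 0"
  using additive_on_mult[of H f \<one> \<one>] by (simp add: subgroup.one_closed)

lemma additive_on_inv:
  assumes "additive_on G H f" "subgroup H G" "x \<in> H"
  shows "f (inv x) = - f x"
proof -
  have "f (x \<otimes> inv x) = f x + f (inv x)"
    using assms by (intro additive_on_mult) (auto simp: subgroup.m_inv_closed)
  then show ?thesis
    using assms additive_on_one[OF assms(1,2)] subgroup.mem_carrier[OF assms(2,3)]
    by (simp add: add_eq_0_iff)
qed

lemma additive_on_diff: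
  assumes "additive_on G H f" "subgroup H G" "x \<in> H" "y \<in> H"
  shows "f (x \<otimes> inv y) = f x - f y"
  using assms by (simp add: additive_on_mult subgroup.m_inv_closed additive_on_inv)

end

lemma wf_order_with_initial_set:
  fixes K :: "'k set"
  obtains prec :: "'k \<Rightarrow> 'k \<Rightarrow> bool" where
    "wfP prec" "transp prec" "\<And>x y. x = y \<or> prec x y \<or> prec y x"
    "\<And>x y. prec x y \<Longrightarrow> y \<in> K \<Longrightarrow> x \<in> K"
proof -
  obtain r :: "'k rel" where r: "well_order_on UNIV r"
    using well_order_on by blast
  define s where "s = inv_image (less_than <*lex*> (r - Id)) (\<lambda>k. (if k \<in> K then 0 else 1::nat, k))"
  have "wf s"
    unfolding s_def using r by (auto simp: well_order_on_def intro!: wf_inv_image wf_lex_prod)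
  moreover have tr: "trans (r - Id)"
    using r by (simp add: well_order_on_def linear_order_on_def partial_order_on_def preorder_on_def trans_diff_Id)
  then have "trans s"
    unfolding s_def by (intro trans_inv_image trans_lex_prod) auto
  moreover have "x = y \<or> (x, y) \<in> s \<or> (y, x) \<in> s" for x y
    using r by (auto simp: s_def well_order_on_def linear_order_on_def total_on_def)
  moreover have "(x, y) \<in> s \<Longrightarrow> y \<in> K \<Longrightarrow> x \<in> K" for x y
    by (auto simp: s_def split: if_splits)
  ultimately show ?thesis
    by (intro that[of "\<lambda>x y. (x, y) \<in> s"]) (auto simp: wfp_def transp_trans trans_def transp_def)
qed

lemma finite_has_greatest:
  fixes prec :: "'k \<Rightarrow> 'k \<Rightarrow> bool"
  assumes "finite S" "S \<noteq> {}" "transp prec" "\<And>x y. x = y \<or> prec x y \<or> prec y x"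
  shows "\<exists>m\<in>S. \<forall>x\<in>S. x = m \<or> prec x m"
  using assms(1,2)
proof (induction rule: finite_ne_induct)
  case (insert x F)
  then obtain m where m: "m \<in> F" "\<forall>x\<in>F. x = m \<or> prec x m" by blast
  show ?case
    using assms(4)[of x m] m assms(3) by (metis insert_iff transpD)
qed auto

lemma lookup_frag_extend_sum:
  "lookup (frag_extend f v) k =
     (\<Sum>b\<in>keys v. lookup v b * lookup (f b) k)"
  by (simp add: frag_extend_def lookup_sum)

text \<open>
  Well-order the coordinates so that \<open>K\<close> is an initial segment. For every \<open>k\<close> that is the greatest
  coordinate of some element of \<open>A\<close>, pick such an element \<open>b k\<close> with smallest nonzero absolute
  coefficient at \<open>k\<close>. Division with remainder by \<open>b k\<close> moves the greatest coordinate of an element down, so these elements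
  span \<open>A\<close>; they are independent because their greatest coordinates differ. As \<open>K\<close> is initial, the
  reduction of an element supported in \<open>K\<close> uses only basis elements supported in \<open>K\<close>.
\<close>
lemma subgroup_of_free_abelian_basis:
  fixes A :: "('k \<Rightarrow>\<^sub>0 int) set" and K :: "'k set"
  assumes A0: "0 \<in> A" and Adiff: "\<And>u v. u \<in> A \<Longrightarrow> v \<in> A \<Longrightarrow> u - v \<in> A"
  obtains B where "B \<subseteq> A"
    and "\<And>v. keys v \<subseteq> B \<Longrightarrow> frag_extend id v = 0 \<Longrightarrow> v = 0"
    and "\<And>u. u \<in> A \<Longrightarrow> \<exists>v. keys v \<subseteq>
            {b \<in> B. keys u \<subseteq> K \<longrightarrow> keys b \<subseteq> K} \<and> frag_extend id v = u"
proof -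
  obtain prec :: "'k \<Rightarrow> 'k \<Rightarrow> bool" where wf: "wfP prec" and tr: "transp prec"
    and tot: "\<And>x y. x = y \<or> prec x y \<or> prec y x"
    and ini: "\<And>x y. prec x y \<Longrightarrow> y \<in> K \<Longrightarrow> x \<in> K"
    using wf_order_with_initial_set[of K] by blast
  have irr: "\<not> prec x x" for x
    using wfp_imp_irreflp[OF wf] by (simp add: irreflp_def)
  define L where "L u k \<longleftrightarrow> k \<in> keys u \<and> (\<forall>j\<in>keys u. j = k \<or> prec j k)"
    for u :: "'k \<Rightarrow>\<^sub>0 int" and k
  have exL: "\<exists>k. L u k" if "u \<noteq> 0" for u
    using finite_has_greatest[OF finite_keys[of u] _ tr tot] that by (auto simp: L_def)
  have asym: "\<not> prec y x" if "prec x y" for x y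
    using transpD[OF tr that, of x] irr by blast
  have Lu: "k = l" if "L u k" "L u l" for u k l
  proof -
    have "l = k \<or> prec l k" "k = l \<or> prec k l" using that by (auto simp: L_def)
    then show ?thesis using asym[of k l] by auto
  qed
  have Acmul: "frag_cmul n u \<in> A" if "u \<in> A" for n u
    using that A0 Adiff by (intro frag_closure_minus_cmul[of "\<lambda>u. u \<in> A"]) auto
  define S where "S = {k. \<exists>u\<in>A. L u k}"
  define b where "b k = (ARG_MIN (\<lambda>u. nat \<bar>lookup u k\<bar>) u. u \<in> A \<and> L u k)" for k
  have bprop: "b k \<in> A \<and> L (b k) k" if "k \<in> S" for k
    using that arg_min_natI[of "\<lambda>u. u \<in> A \<and> L u k"] unfolding S_def b_def by blast
  have bmin: "\<bar>lookup (b k) k\<bar> \<le> \<bar>lookup u k\<bar>" if "u \<in> A" "L u k" for u k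
    using arg_min_nat_le[of "\<lambda>u. u \<in> A \<and> L u k" u "\<lambda>u. nat \<bar>lookup u k\<bar>"] that
    unfolding b_def by auto
  define B where "B = b ` S"
  show ?thesis
  proof
    show "B \<subseteq> A" using bprop by (auto simp: B_def)
  next
    fix v :: "('k \<Rightarrow>\<^sub>0 int) \<Rightarrow>\<^sub>0 int" assume v: "keys v \<subseteq> B" and 0: "frag_extend id v = 0"
    show "v = 0"
    proof (rule ccontr)
      assume "v \<noteq> 0"
      define T where "T = {k\<in>S. b k \<in> keys v}"
      have inj: "inj_on b S"
      proof (rule inj_onI)
        fix k j assume kj: "k \<in> S" "j \<in> S" "b k = b j"
        show "k = j" by (rule Lu[of "b k"]) (use bprop[OF kj(1)] bprop[OF kj(2)] kj(3) in auto)
      qed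
      have "finite T"
      proof (rule finite_imageD)
        show "finite (b ` T)" by (rule finite_subset[of _ "keys v"]) (auto simp: T_def)
        show "inj_on b T" by (rule inj_on_subset[OF inj]) (auto simp: T_def)
      qed
      moreover have "T \<noteq> {}"
      proof -
        obtain c where c: "c \<in> keys v" using \<open>v \<noteq> 0\<close> keys_eq_empty by blast
        then obtain k where "k \<in> S" "c = b k" using v by (auto simp: B_def)
        then show ?thesis using c by (auto simp: T_def)
      qed
      ultimately obtain k where k: "k \<in> T" "\<forall>j\<in>T. j = k \<or> prec j k"
        using finite_has_greatest[OF _ _ tr tot, of T] by blast
      have "lookup (frag_extend id v) k =
          (\<Sum>c\<in>keys v. lookup v c * lookup c k)"
        by (simp add: lookup_frag_extend_sum)
      also have "\<dots> = (\<Sum>c\<in>{b k}. lookup v c * lookup c k)"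
      proof (rule sum.mono_neutral_right)
        show "{b k} \<subseteq> keys v" using k by (auto simp: T_def)
        show "\<forall>c\<in>keys v - {b k}. lookup v c * lookup c k = 0"
        proof
          fix c assume c: "c \<in> keys v - {b k}"
          then obtain j where j: "j \<in> S" "c = b j" using v by (auto simp: B_def)
          with c k have "j \<in> T" "j \<noteq> k" by (auto simp: T_def)
          with k have "prec j k" by blast
          moreover have "L c j" using bprop j by blast
          ultimately have "k \<notin> keys c"
            using asym[of j k] irr[of k] by (auto simp: L_def)
          then show "lookup v c * lookup c k = 0"
            by (simp add: in_keys_iff)
        qed
      qed auto
      finally have "lookup v (b k) * lookup (b k) k = 0"
        using 0 by simp
      moreover have "k \<in> S" "b k \<in> keys v" using k by (auto simp: T_def)
      moreover have "k \<in> keys (b k)" using bprop[OF \<open>k \<in> S\<close>] by (simp add: L_def)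
      ultimately show False by (simp add: in_keys_iff)
    qed
  next
    have main: "\<forall>u\<in>A. L u k \<longrightarrow> (\<exists>v. keys v \<subseteq>
        {b \<in> B. keys u \<subseteq> K \<longrightarrow> keys b \<subseteq> K} \<and> frag_extend id v = u)" for k
      using wf
    proof (induction k rule: wfp_induct_rule)
      case (less k)
      show ?case
      proof (intro ballI impI)
        fix u assume u: "u \<in> A" "L u k"
        then have kS: "k \<in> S" by (auto simp: S_def)
        have bk: "b k \<in> A" "L (b k) k" using bprop[OF kS] by auto
        define c where "c = lookup (b k) k"
        have c0: "c \<noteq> 0" using bk by (auto simp: c_def L_def in_keys_iff)
        \<comment> \<open>By minimality of \<open>c\<close> the remainder of the coefficient at \<open>k\<close> must vanish.\<close>
        define q where "q = lookup u k div c"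
        define u' where "u' = u - frag_cmul q (b k)"
        have u'A: "u' \<in> A" unfolding u'_def by (intro Adiff Acmul u bk)
        have lk: "lookup u' k = lookup u k mod c"
          by (simp add: u'_def lookup_minus q_def c_def[symmetric] minus_div_mult_eq_mod)
        have ku': "keys u' \<subseteq> keys u \<union> keys (b k)"
          unfolding u'_def using keys_diff[of u "frag_cmul q (b k)"] keys_cmul[of q "b k"] by blast
        have le: "j = k \<or> prec j k" if "j \<in> keys u'" for j
          using that ku' u(2) bk(2) unfolding L_def by blast
        have "k \<notin> keys u'"
        proof
          assume "k \<in> keys u'"
          then have "L u' k" using le by (auto simp: L_def)
          then have "\<bar>c\<bar> \<le> \<bar>lookup u k mod c\<bar>" using bmin[OF u'A, of k] lk by (simp add: c_def)
          then show False using c0 by (meson abs_mod_less linorder_not_le)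
        qed
        then have lt: "prec j k" if "j \<in> keys u'" for j
          using that le by blast
        have bK: "keys (b k) \<subseteq> K" if "keys u \<subseteq> K"
        proof
          fix j assume "j \<in> keys (b k)"
          then have "j = k \<or> prec j k" using bk(2) by (simp add: L_def)
          moreover have "k \<in> K" using that u(2) by (auto simp: L_def)
          ultimately show "j \<in> K" using ini by blast
        qed
        obtain v where v: "keys v \<subseteq>
            {b \<in> B. keys u' \<subseteq> K \<longrightarrow> keys b \<subseteq> K}" "frag_extend id v = u'"
        proof (cases "u' = 0")
          case True
          then show ?thesis using that[of 0] by simp
        next
          case False
          then obtain j where j: "L u' j" using exL by blast
          then have "prec j k" using lt by (auto simp: L_def)
          then show ?thesis using less.IH[of j] u'A j that by blast
        qed
        define w where "w = v + frag_cmul q (frag_of (b k))"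
        have "frag_extend id w = u"
          by (simp add: w_def frag_extend_add frag_extend_cmul v u'_def)
        moreover have "keys w \<subseteq> keys v \<union> {b k}"
          unfolding w_def using keys_add[of v "frag_cmul q (frag_of (b k))"]
            keys_cmul[of q "frag_of (b k)"] by (auto simp: keys_frag_of)
        moreover have "b k \<in> B" using kS by (simp add: B_def)
        ultimately show "\<exists>v. keys v \<subseteq>
            {b \<in> B. keys u \<subseteq> K \<longrightarrow> keys b \<subseteq> K} \<and> frag_extend id v = u"
          using v(1) bK ku' by (intro exI[of _ w]) blast
      qed
    qed
    fix u assume "u \<in> A"
    then show "\<exists>v. keys v \<subseteq>
        {b \<in> B. keys u \<subseteq> K \<longrightarrow> keys b \<subseteq> K} \<and> frag_extend id v = u"
    proof (cases "u = 0")
      case True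
      then show ?thesis by (intro exI[of _ 0]) simp
    next
      case False
      then obtain k where "L u k" using exL by blast
      then show ?thesis using main[of k] \<open>u \<in> A\<close> by blast
    qed
  qed
qed

lemma frag_extend_relabel_inverse:
  assumes "\<And>x. x \<in> keys v \<Longrightarrow> g (f x) = x"
  shows "frag_extend (frag_of \<circ> g) (frag_extend (frag_of \<circ> f) v) = v"
proof -
  have "frag_extend (frag_of \<circ> g) (frag_extend (frag_of \<circ> f) v) = frag_extend (frag_of \<circ> g \<circ> f) v"
    by (simp add: frag_extend_compose)
  also have "\<dots> = frag_extend frag_of v"
    by (rule frag_extend_eq) (simp add: assms)
  finally show ?thesis by (simp flip: frag_expansion)
qed

text \<open>
  The basis of the image of \<open>d\<close> is pulled back to elements \<open>Z\<close> of the possibly nonabelian group \<open>H\<close>;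
  \<open>l\<close> gives the coordinates of \<open>d x\<close> with respect to it. The set \<open>K\<close> makes the basis compatible with
  one further subgroup, the elements mapped by \<open>d\<close> into the span of \<open>K\<close>.
\<close>
lemma (in group) adapted_basis:
  fixes d :: "'a \<Rightarrow> 'k \<Rightarrow>\<^sub>0 int"
  assumes H: "subgroup H G" and d: "additive_on G H d"
  obtains Z l where "Z \<subseteq> H" "additive_on G H l"
    "\<And>x. x \<in> H \<Longrightarrow> keys (l x) \<subseteq> Z"
    "\<And>z. z \<in> Z \<Longrightarrow> l z = frag_of z"
    "\<And>x. x \<in> H \<Longrightarrow> l x = 0 \<longleftrightarrow> d x = 0"
    "\<And>x. x \<in> H \<Longrightarrow> keys (d x) \<subseteq> K \<Longrightarrow>
       keys (l x) \<subseteq> {z \<in> Z. keys (d z) \<subseteq> K}"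
proof -
  have 0: "0 \<in> d ` H"
    using additive_on_one[OF d H] subgroup.one_closed[OF H] by force
  have diff: "u - v \<in> d ` H" if "u \<in> d ` H" "v \<in> d ` H" for u v
    using that additive_on_diff[OF d H] H
    by (auto simp: image_iff) (metis subgroup.m_closed subgroup.m_inv_closed)
  obtain B where B: "B \<subseteq> d ` H"
    and ind: "\<And>v. keys v \<subseteq> B \<Longrightarrow> frag_extend id v = 0 \<Longrightarrow> v = 0"
    and span: "\<And>u. u \<in> d ` H \<Longrightarrow> \<exists>v. keys v \<subseteq>
            {b \<in> B. keys u \<subseteq> K \<longrightarrow> keys b \<subseteq> K} \<and> frag_extend id v = u"
    using subgroup_of_free_abelian_basis[OF 0 diff, of K] by blast
  define t where "t = inv_into H d"
  have t: "t b \<in> H" "d (t b) = b" if "b \<in> B" for b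
    using that B by (auto simp: t_def inv_into_into f_inv_into_f subset_iff)
  define c where "c u = (SOME v. keys v \<subseteq>
      {b \<in> B. keys u \<subseteq> K \<longrightarrow> keys b \<subseteq> K} \<and> frag_extend id v = u)" for u
  have c: "keys (c u) \<subseteq> {b \<in> B. keys u \<subseteq> K \<longrightarrow> keys b \<subseteq> K}"
    "frag_extend id (c u) = u" if "u \<in> d ` H" for u
    using someI_ex[OF span[OF that]] unfolding c_def by blast+
  have cB: "keys (c u) \<subseteq> B" if "u \<in> d ` H" for u using c(1)[OF that] by blast
  have uniq: "v = w" if "keys v \<subseteq> B" "keys w \<subseteq> B"
    "frag_extend id v = frag_extend id w" for v w
  proof -
    have "v - w = 0"
      using that keys_diff[of v w] by (intro ind) (auto simp: frag_extend_diff)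
    then show ?thesis by simp
  qed
  have cadd: "c (u + v) = c u + c v" if "u \<in> d ` H" "v \<in> d ` H" for u v
  proof (rule uniq)
    have uv: "u + v \<in> d ` H" using diff[OF that(1) diff[OF 0 that(2)]] by simp
    show "keys (c (u + v)) \<subseteq> B" by (rule cB[OF uv])
    show "keys (c u + c v) \<subseteq> B"
      using cB[OF that(1)] cB[OF that(2)] keys_add[of "c u" "c v"] by blast
    show "frag_extend id (c (u + v)) = frag_extend id (c u + c v)"
      using that uv by (simp add: c frag_extend_add)
  qed
  have cof: "c b = frag_of b" if "b \<in> B" for b
    using that B by (intro uniq cB) (auto simp: keys_frag_of c subset_iff)
  define l where "l x = frag_extend (frag_of \<circ> t) (c (d x))" for x
  have linv: "frag_extend (frag_of \<circ> d) (l x) = c (d x)" if "x \<in> H" for x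
    unfolding l_def by (rule frag_extend_relabel_inverse) (use that cB t in blast)
  have lk: "keys (l x) \<subseteq> t ` keys (c (d x))" for x
    using keys_frag_extend[of "frag_of \<circ> t" "c (d x)"] by (auto simp: l_def keys_frag_of)
  show ?thesis
  proof
    show "t ` B \<subseteq> H" using t by blast
    show "additive_on G H l"
      using cadd by (simp add: additive_on_def l_def additive_on_mult[OF d] frag_extend_add)
    show "keys (l x) \<subseteq> t ` B" if "x \<in> H" for x
      using lk[of x] cB that by blast
    show "l z = frag_of z" if "z \<in> t ` B" for z
      using that t by (auto simp: l_def cof)
    show "l x = 0 \<longleftrightarrow> d x = 0" if "x \<in> H" for x
    proof
      assume "l x = 0"
      then have "c (d x) = 0" using linv[OF that] by simp
      then show "d x = 0" using c(2)[of "d x"] that by simp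
    next
      assume "d x = 0"
      moreover have "c 0 = 0" using cadd[OF 0 0] by simp
      ultimately show "l x = 0" by (simp add: l_def)
    qed
    show "keys (l x) \<subseteq> {z \<in> t ` B. keys (d z) \<subseteq> K}"
      if "x \<in> H" "keys (d x) \<subseteq> K" for x
    proof
      fix z assume "z \<in> keys (l x)"
      then obtain b where b: "b \<in> keys (c (d x))" "z = t b" using lk[of x] by blast
      then have "b \<in> B" "keys b \<subseteq> K"
        using c(1)[of "d x"] that by auto
      then show "z \<in> {z \<in> t ` B. keys (d z) \<subseteq> K}"
        using b t by auto
    qed
  qed
qed

lemma (in group) free_abelian_quotient:
  fixes d :: "'a \<Rightarrow> 'k \<Rightarrow>\<^sub>0 int"
  assumes H: "subgroup H G" and d: "additive_on G H d" and D: "D = {x \<in> H. d x = 0}"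
  shows "is_free_abelian_group (G\<lparr>carrier := H\<rparr> Mod D)"
proof (rule adapted_basis[OF H d, of UNIV])
  fix Z l
  assume Z: "Z \<subseteq> H" and l: "additive_on G H l"
    and lk: "\<And>x. x \<in> H \<Longrightarrow> keys (l x) \<subseteq> Z"
    and lz: "\<And>z. z \<in> Z \<Longrightarrow> l z = frag_of z"
    and l0: "\<And>x. x \<in> H \<Longrightarrow> l x = 0 \<longleftrightarrow> d x = 0"
  interpret h: group_hom "G\<lparr>carrier := H\<rparr>" "free_Abelian_group Z" l
  proof -
    have "group (G\<lparr>carrier := H\<rparr>)" by (rule subgroup_imp_group[OF H])
    moreover have "l \<in> hom (G\<lparr>carrier := H\<rparr>) (free_Abelian_group Z)"
      by (rule homI) (simp_all add: lk additive_on_mult[OF l])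
    ultimately show "group_hom (G\<lparr>carrier := H\<rparr>) (free_Abelian_group Z) l"
      by (simp add: group_hom_def group_hom_axioms_def)
  qed
  have ker: "kernel (G\<lparr>carrier := H\<rparr>) (free_Abelian_group Z) l = D"
    using l0 by (auto simp: kernel_def D)
  have surj: "l ` carrier (G\<lparr>carrier := H\<rparr>) = carrier (free_Abelian_group Z)"
  proof (intro equalityI subsetI)
    fix u assume "u \<in> carrier (free_Abelian_group Z)"
    then have "keys u \<subseteq> Z" by simp
    then show "u \<in> l ` carrier (G\<lparr>carrier := H\<rparr>)"
    proof (induction u rule: frag_induction)
      case zero
      then show ?case using additive_on_one[OF l H] subgroup.one_closed[OF H] by force
    next
      case (one x)
      then have "x \<in> H" using Z by blast
      then show ?case using lz[OF one] by (auto intro!: image_eqI[of _ l x])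
    next
      case (diff a b)
      then obtain x y where "x \<in> H" "y \<in> H" "a = l x" "b = l y" by auto
      then show ?case using additive_on_diff[OF l H, of x y] H
        by (auto intro!: image_eqI[of _ l "x \<otimes> inv y"] simp: subgroup.m_closed subgroup.m_inv_closed)
    qed
  qed (use lk in auto)
  have iso: "G\<lparr>carrier := H\<rparr> Mod D \<cong> free_Abelian_group Z"
    using h.FactGroup_iso[OF surj] by (simp add: ker)
  \<comment> \<open>The definition of a free abelian group asks for a basis set over the element type of the quotient, whose elements are cosets.\<close>
  have "Z \<approx> (\<lambda>z. {z}) ` Z"
    by (rule eqpoll_sym[OF inj_on_image_eqpoll_self]) simp
  then have "free_Abelian_group Z \<cong> free_Abelian_group ((\<lambda>z. {z}) ` Z)"
    by (simp add: isomorphic_free_Abelian_groups)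
  with iso have "G\<lparr>carrier := H\<rparr> Mod D \<cong> free_Abelian_group ((\<lambda>z. {z}) ` Z)"
    using iso_trans by blast
  moreover have "group (G\<lparr>carrier := H\<rparr> Mod D)"
    using normal.factorgroup_is_group[OF h.normal_kernel] by (simp add: ker)
  ultimately show ?thesis
    unfolding is_free_abelian_group_def by blast
qed

section \<open>Projectivity of subgroups of free groups\<close>

text \<open>
  Extends letter values \<open>k g l\<close> to words by the cocycle rule: the base point \<open>g\<close> moves along the word
  while the values are multiplied.
\<close>
primrec cocycle_along ::
  "('a, 'm) monoid_scheme \<Rightarrow> ('b, 'n) monoid_scheme \<Rightarrow> ('a \<Rightarrow> 'a \<times> bool \<Rightarrow> 'b) \<Rightarrow>
     ('a \<times> bool) list \<Rightarrow> 'a \<Rightarrow> 'b" where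
  "cocycle_along F G k [] g = \<one>\<^bsub>G\<^esub>"
| "cocycle_along F G k (l # w) g = k g l \<otimes>\<^bsub>G\<^esub> cocycle_along F G k w (g \<otimes>\<^bsub>F\<^esub> word_value F [l])"

context group begin

lemma word_value_closed: "fst ` set w \<subseteq> carrier G \<Longrightarrow> word_value G w \<in> carrier G"
proof (induction w)
  case (Cons l w)
  then show ?case by (cases l) auto
qed simp

lemma word_value_Cons:
  "fst ` set (l # w) \<subseteq> carrier G \<Longrightarrow> word_value G (l # w) = word_value G [l] \<otimes> word_value G w"
  by (cases l) (auto simp: word_value_closed)

end

lemma reduced_words_Cons_cases:
  assumes "x \<in> X" "w \<in> reduced_words X"
  shows "(x, b) # w \<in> reduced_words X \<or> (\<exists>w'\<in>reduced_words X. w = (x, \<not> b) # w')"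
proof (cases w)
  case Nil
  then show ?thesis using assms by (auto simp: reduced_words_def)
next
  case (Cons l w')
  then show ?thesis using assms
    by (cases l) (auto simp: reduced_words_def successively_Cons split: if_splits)
qed

text \<open>
  This is the embedding of \<open>F\<close> into the wreath product of \<open>R\<close> with the permutations of the right cosets
  of \<open>R\<close>, written out. With representatives \<open>t g\<close> of the cosets, the elements
  \<open>\<rho> g h = t g \<otimes> h \<otimes> inv (t (g \<otimes> h))\<close> of \<open>R\<close> form a cocycle that depends only on the coset of \<open>g\<close>, and
  \<open>\<rho> \<one> r = r\<close> for \<open>r\<close> in \<open>R\<close>. The values \<open>f (\<rho> g x)\<close> at basis elements \<open>x\<close> can be lifted to \<open>G\<close>
  arbitrarily; since \<open>F\<close> is free, the lifts extend to a cocycle on all of \<open>F\<close>, and its values at the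
  base point restrict to a homomorphism on \<open>R\<close>.
\<close>
proposition subgroup_of_free_group_projective:
  fixes F :: "('a, 'm) monoid_scheme" (structure) and G :: "('b, 'n) monoid_scheme" and Q :: "('c, 'o) monoid_scheme"
  assumes F: "is_free_group F" and R: "subgroup R F" and G: "group G" and Q: "group Q"
    and p: "p \<in> hom G Q" and surj: "carrier Q \<subseteq> p ` carrier G"
    and f: "f \<in> hom (F\<lparr>carrier := R\<rparr>) Q"
  obtains h where "h \<in> hom (F\<lparr>carrier := R\<rparr>) G" "\<And>r. r \<in> R \<Longrightarrow> p (h r) = f r"
proof -
  interpret F: group F using F by (simp add: is_free_group_def)
  interpret G: group G by (rule G)
  interpret Q: group Q by (rule Q)
  interpret p: group_hom G Q p using p by (simp add: group_hom_def group_hom_axioms_def G Q)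
  interpret R: subgroup R F by (rule R)
  interpret f: group_hom "F\<lparr>carrier := R\<rparr>" Q f
    using f Q F.subgroup_imp_group[OF R] by (simp add: group_hom_def group_hom_axioms_def)
  obtain X where X: "X \<subseteq> carrier F" and bij: "bij_betw (word_value F) (reduced_words X) (carrier F)"
    using F by (auto simp: is_free_group_def free_basis_def)
  define nf where "nf = inv_into (reduced_words X) (word_value F)"
  have nf: "nf g \<in> reduced_words X" "word_value F (nf g) = g" if "g \<in> carrier F" for g
    using that bij by (auto simp: nf_def bij_betw_def inv_into_into f_inv_into_f)
  have nf_eq: "nf (word_value F w) = w" if "w \<in> reduced_words X" for w
    using that bij by (simp add: nf_def bij_betw_def)
  have redX: "fst ` set w \<subseteq> carrier F" if "w \<in> reduced_words X" for w
    using that X by (auto simp: reduced_words_def)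
  \<comment> \<open>The representative of \<open>R\<close> itself has to be the unit, so that \<open>\<rho>\<close> is the identity on \<open>R\<close> at the base point.\<close>
  define t where "t g = (if R #> g = R then \<one> else (SOME x. x \<in> R #> g))" for g
  have t_in: "t g \<in> R #> g" if "g \<in> carrier F" for g
    using F.rcos_self[OF that R] someI[of "\<lambda>x. x \<in> R #> g" g] by (auto simp: t_def)
  have tF: "t g \<in> carrier F" if "g \<in> carrier F" for g
    using t_in[OF that] F.r_coset_subset_G[OF R.subset that] by blast
  have t_inv: "t (r \<otimes> g) = t g" if "r \<in> R" "g \<in> carrier F" for r g
  proof -
    have "R #> (r \<otimes> g) = R #> g"
      using that by (metis F.coset_join2 F.coset_mult_assoc R R.mem_carrier R.subset)
    then show ?thesis by (simp add: t_def)
  qed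
  have tR: "t r = \<one>" if "r \<in> R" for r
    using F.coset_join2[OF R.mem_carrier[OF that] R that] by (simp add: t_def)
  have t_quot: "g \<otimes> inv t g \<in> R" if g: "g \<in> carrier F" for g
  proof -
    obtain r where r: "r \<in> R" "t g = r \<otimes> g" using t_in[OF g] by (auto simp: r_coset_def)
    then have "g \<otimes> inv t g = inv r"
      using g R.mem_carrier[OF r(1)] by (simp add: F.inv_mult_group flip: F.m_assoc)
    then show ?thesis using r by simp
  qed
  define \<rho> where "\<rho> g h = t g \<otimes> h \<otimes> inv t (g \<otimes> h)" for g h
  have \<rho>R: "\<rho> g h \<in> R" if gh: "g \<in> carrier F" "h \<in> carrier F" for g h
  proof -
    have "\<rho> g h = inv (g \<otimes> inv t g) \<otimes> (g \<otimes> h \<otimes> inv t (g \<otimes> h))"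
      using gh tF[of g] tF[of "g \<otimes> h"]
      by (simp add: \<rho>_def F.inv_mult_group F.m_assoc F.inv_solve_left)
    also have "\<dots> \<in> R" using gh t_quot by simp
    finally show ?thesis .
  qed
  have \<rho>_mult: "\<rho> g (h \<otimes> k) = \<rho> g h \<otimes> \<rho> (g \<otimes> h) k"
    if "g \<in> carrier F" "h \<in> carrier F" "k \<in> carrier F" for g h k
    using that tF by (simp add: \<rho>_def F.m_assoc F.inv_solve_left)
  have \<rho>_one: "\<rho> g \<one> = \<one>" if "g \<in> carrier F" for g
    using that tF by (simp add: \<rho>_def)
  have \<rho>_inv: "\<rho> (r \<otimes> g) h = \<rho> g h" if "r \<in> R" "g \<in> carrier F" "h \<in> carrier F" for r g h
    using that t_inv[of r g] t_inv[of r "g \<otimes> h"] by (simp add: \<rho>_def F.m_assoc)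
  define s where "s q = (SOME y. y \<in> carrier G \<and> p y = q)" for q
  have s: "s q \<in> carrier G" "p (s q) = q" if "q \<in> carrier Q" for q
    using someI_ex[of "\<lambda>y. y \<in> carrier G \<and> p y = q"] surj that unfolding s_def by auto
  have f\<rho>: "f (\<rho> g h) \<in> carrier Q" if "g \<in> carrier F" "h \<in> carrier F" for g h
    using f.hom_closed \<rho>R[OF that] by simp
  \<comment> \<open>An inverse letter gets the inverse of the lift at the other end of its edge; cancelling pairs then have trivial value.\<close>
  define k where "k g l = (case l of (x, b) \<Rightarrow>
      if b then s (f (\<rho> g x)) else inv\<^bsub>G\<^esub> s (f (\<rho> (g \<otimes> inv x) x)))" for g l
  let ?v = "\<lambda>l. word_value F [l]"
  have vF: "?v (x, b) \<in> carrier F" if "x \<in> carrier F" for x b using that by simp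
  have kG: "k g (x, b) \<in> carrier G" if "g \<in> carrier F" "x \<in> carrier F" for g x b
    using that s f\<rho> by (simp add: k_def)
  have pk: "p (k g (x, b)) = f (\<rho> g (?v (x, b)))" if gx: "g \<in> carrier F" "x \<in> carrier F" for g x b
  proof (cases b)
    case True
    then show ?thesis using gx s f\<rho> by (simp add: k_def)
  next
    case False
    have "\<rho> (g \<otimes> inv x) x \<otimes> \<rho> g (inv x) = \<one>"
      using \<rho>_mult[of "g \<otimes> inv x" x "inv x"] gx by (simp add: F.m_assoc \<rho>_one)
    then have "f (\<rho> (g \<otimes> inv x) x) \<otimes>\<^bsub>Q\<^esub> f (\<rho> g (inv x)) = \<one>\<^bsub>Q\<^esub>"
      using f.hom_mult[of "\<rho> (g \<otimes> inv x) x" "\<rho> g (inv x)"] \<rho>R gx f.hom_one by simp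
    then have "inv\<^bsub>Q\<^esub> f (\<rho> (g \<otimes> inv x) x) = f (\<rho> g (inv x))"
      using f\<rho> gx by (metis F.inv_closed F.m_closed Q.inv_equality Q.inv_inv)
    then show ?thesis using False gx s f\<rho> by (simp add: k_def)
  qed
  have kk: "k g (x, b) \<otimes>\<^bsub>G\<^esub> k (g \<otimes> ?v (x, b)) (x, \<not> b) = \<one>\<^bsub>G\<^esub>"
    if gx: "g \<in> carrier F" "x \<in> carrier F" for g x b
    using gx s f\<rho> by (cases b) (simp_all add: k_def F.m_assoc)
  have k_inv: "k (r \<otimes> g) (x, b) = k g (x, b)" if "r \<in> R" "g \<in> carrier F" "x \<in> carrier F" for r g x b
    using that by (simp add: k_def \<rho>_inv F.m_assoc)
  let ?c = "cocycle_along F G k"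
  have cG: "?c w g \<in> carrier G" if "fst ` set w \<subseteq> carrier F" "g \<in> carrier F" for w g
    using that by (induction w arbitrary: g) (auto simp: kG)
  have pc: "p (?c w g) = f (\<rho> g (word_value F w))" if "fst ` set w \<subseteq> carrier F" "g \<in> carrier F" for w g
    using that
  proof (induction w arbitrary: g)
    case Nil
    then show ?case using \<rho>_one f.hom_one by simp
  next
    case (Cons l w)
    obtain x b where l: "l = (x, b)" by (cases l)
    have x: "x \<in> carrier F" and w: "fst ` set w \<subseteq> carrier F" using Cons.prems l by auto
    have gv: "g \<otimes> ?v l \<in> carrier F" using Cons.prems x l by auto
    have "p (?c (l # w) g) = f (\<rho> g (?v l)) \<otimes>\<^bsub>Q\<^esub> f (\<rho> (g \<otimes> ?v l) (word_value F w))"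
      using Cons.IH[OF w gv] pk[OF Cons.prems(2) x] kG[OF Cons.prems(2) x] cG[OF w gv]
      by (simp add: l del: word_value.simps)
    also have "\<dots> = f (\<rho> g (?v l) \<otimes> \<rho> (g \<otimes> ?v l) (word_value F w))"
      using f.hom_mult[of "\<rho> g (?v l)" "\<rho> (g \<otimes> ?v l) (word_value F w)"]
        \<rho>R[OF Cons.prems(2) vF[OF x]] \<rho>R[OF gv F.word_value_closed[OF w]]
      by (simp add: l del: word_value.simps)
    also have "\<dots> = f (\<rho> g (word_value F (l # w)))"
      using \<rho>_mult[OF Cons.prems(2) vF[OF x] F.word_value_closed[OF w]]
        F.word_value_Cons[OF Cons.prems(1)] by (simp add: l del: word_value.simps)
    finally show ?case .
  qed
  have c_inv: "?c w (r \<otimes> g) = ?c w g" if "fst ` set w \<subseteq> carrier F" "r \<in> R" "g \<in> carrier F" for w r g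
    using that by (induction w arbitrary: g) (auto simp: k_inv F.m_assoc)
  have step: "?c (nf (?v (x, b) \<otimes> h)) g = k g (x, b) \<otimes>\<^bsub>G\<^esub> ?c (nf h) (g \<otimes> ?v (x, b))"
    if x: "x \<in> X" and g: "g \<in> carrier F" and h: "h \<in> carrier F" for x b g h
  proof -
    have xF: "x \<in> carrier F" using x X by blast
    consider "(x, b) # nf h \<in> reduced_words X"
      | w' where "w' \<in> reduced_words X" "nf h = (x, \<not> b) # w'"
      using reduced_words_Cons_cases[OF x nf(1)[OF h]] by blast
    then show ?thesis
    proof cases
      case 1
      have "nf (?v (x, b) \<otimes> h) = (x, b) # nf h"
        using nf_eq[OF 1] F.word_value_Cons[OF redX[OF 1]] nf(2)[OF h] by simp
      then show ?thesis by simp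
    next
      case 2
      have w'F: "fst ` set w' \<subseteq> carrier F" using 2 redX by blast
      have "h = ?v (x, \<not> b) \<otimes> word_value F w'"
        using nf(2)[OF h] F.word_value_Cons[of "(x, \<not> b)" w'] redX[OF nf(1)[OF h]]
        unfolding 2(2) by (simp del: word_value.simps)
      then have "?v (x, b) \<otimes> h = word_value F w'"
        using xF F.word_value_closed[OF w'F] by (cases b) (simp_all flip: F.m_assoc)
      then have "nf (?v (x, b) \<otimes> h) = w'" using nf_eq 2 by simp
      moreover have "g \<otimes> ?v (x, b) \<otimes> ?v (x, \<not> b) = g"
        using xF g by (cases b) (simp_all add: F.m_assoc)
      ultimately show ?thesis
        using kk[OF g xF, of b] kG[OF g xF, of b] kG[of "g \<otimes> ?v (x, b)" x "\<not> b"] cG[OF w'F g] g xF vF[OF xF, of b]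
        by (simp add: 2 del: word_value.simps flip: G.m_assoc)
    qed
  qed
  have steps: "?c (nf (word_value F u \<otimes> h)) g = ?c u g \<otimes>\<^bsub>G\<^esub> ?c (nf h) (g \<otimes> word_value F u)"
    if "fst ` set u \<subseteq> X" "g \<in> carrier F" "h \<in> carrier F" for u g h
    using that
  proof (induction u arbitrary: g)
    case Nil
    then show ?case using cG[OF redX[OF nf(1)]] by simp
  next
    case (Cons l u)
    obtain x b where l: "l = (x, b)" by (cases l)
    have x: "x \<in> X" "x \<in> carrier F" and u: "fst ` set u \<subseteq> X" "fst ` set u \<subseteq> carrier F"
      using Cons.prems l X by auto
    have vl: "?v l \<in> carrier F" using vF[OF x(2)] l by simp
    have vu: "word_value F u \<in> carrier F" by (rule F.word_value_closed[OF u(2)])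
    have lu: "word_value F (l # u) = ?v l \<otimes> word_value F u"
      by (rule F.word_value_Cons) (use x u l in auto)
    have gl: "g \<otimes> ?v l \<in> carrier F" using Cons.prems vl by simp
    have "?c (nf (word_value F (l # u) \<otimes> h)) g = ?c (nf (?v l \<otimes> (word_value F u \<otimes> h))) g"
      using vl vu Cons.prems by (simp only: lu F.m_assoc)
    also have "\<dots> = k g l \<otimes>\<^bsub>G\<^esub> ?c (nf (word_value F u \<otimes> h)) (g \<otimes> ?v l)"
      using step[OF x(1) Cons.prems(2)] vu Cons.prems(3) unfolding l by simp
    also have "\<dots> = k g l \<otimes>\<^bsub>G\<^esub> (?c u (g \<otimes> ?v l) \<otimes>\<^bsub>G\<^esub> ?c (nf h) (g \<otimes> ?v l \<otimes> word_value F u))"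
      using Cons.IH[OF u(1) gl Cons.prems(3)] by simp
    also have "\<dots> = ?c (l # u) g \<otimes>\<^bsub>G\<^esub> ?c (nf h) (g \<otimes> word_value F (l # u))"
      using kG[OF Cons.prems(2) x(2), of b] cG[OF u(2) gl] cG[OF redX[OF nf(1)[OF Cons.prems(3)]], of "g \<otimes> ?v l \<otimes> word_value F u"]
        gl vl vu Cons.prems(2)
      by (simp add: lu[unfolded l] l F.m_assoc G.m_assoc del: word_value.simps)
    finally show ?case .
  qed
  have cocycle: "?c (nf (a \<otimes> h)) g = ?c (nf a) g \<otimes>\<^bsub>G\<^esub> ?c (nf h) (g \<otimes> a)"
    if "a \<in> carrier F" "g \<in> carrier F" "h \<in> carrier F" for a g h
    using steps[of "nf a" g h] nf[OF that(1)] that by (auto simp: reduced_words_def)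
  define h where "h r = ?c (nf r) \<one>" for r
  have hG: "h r \<in> carrier G" if "r \<in> carrier F" for r
    unfolding h_def by (rule cG[OF redX[OF nf(1)[OF that]]]) simp
  show ?thesis
  proof
    show "h \<in> hom (F\<lparr>carrier := R\<rparr>) G"
    proof (rule homI)
      fix r r' assume "r \<in> carrier (F\<lparr>carrier := R\<rparr>)" "r' \<in> carrier (F\<lparr>carrier := R\<rparr>)"
      then have r: "r \<in> R" "r \<in> carrier F" "r' \<in> R" "r' \<in> carrier F" by auto
      have "?c (nf r') r = ?c (nf r') \<one>"
        using c_inv[OF redX[OF nf(1)[OF r(4)]] r(1), of "\<one>"] r by simp
      then show "h (r \<otimes>\<^bsub>F\<lparr>carrier := R\<rparr>\<^esub> r') = h r \<otimes>\<^bsub>G\<^esub> h r'"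
        using cocycle[OF r(2) _ r(4), of "\<one>"] r by (simp add: h_def)
    qed (use hG in auto)
    show "p (h r) = f r" if "r \<in> R" for r
    proof -
      have rF: "r \<in> carrier F" using that by simp
      have "p (h r) = f (\<rho> \<one> r)"
        using pc[OF redX[OF nf(1)[OF rF]], of "\<one>"] nf(2)[OF rF] by (simp add: h_def)
      also have "\<rho> \<one> r = r" using rF tR that by (simp add: \<rho>_def)
      finally show ?thesis .
    qed
  qed
qed

section \<open>Unit power series and lifts along the linear part\<close>

text \<open>
  A function on words is read as the noncommutative power series with these coefficients at the
  monomials; the convolution is the product of power series.
\<close>
fun convolution :: "('z list \<Rightarrow> int) \<Rightarrow> ('z list \<Rightarrow> int) \<Rightarrow> 'z list \<Rightarrow> int" where
  "convolution f g [] = f [] * g []"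
| "convolution f g (x # w) = f [] * g (x # w) + convolution (\<lambda>u. f (x # u)) g w"

lemma convolution_eq_sum:
  "convolution f g w = (\<Sum>i\<le>length w. f (take i w) * g (drop i w))"
proof (induction w arbitrary: f)
  case (Cons x w)
  show ?case by (simp add: Cons.IH sum.atMost_Suc_shift del: sum.atMost_Suc)
qed simp

lemma convolution_linear_left:
  "convolution (\<lambda>u. a * f u + h u) g w = a * convolution f g w + convolution h g w"
  by (simp add: convolution_eq_sum sum.distrib sum_distrib_left algebra_simps)

lemma convolution_assoc: "convolution (convolution f g) h w = convolution f (convolution g h) w"
proof (induction w arbitrary: f)
  case (Cons x w)
  show ?case
    by (simp add: convolution_linear_left Cons.IH algebra_simps)
qed simp

text \<open>
  The recursion solves \<open>convolution g f = 1\<close> for \<open>g\<close> degree by degree.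
\<close>
function left_inverse_series :: "('z list \<Rightarrow> int) \<Rightarrow> 'z list \<Rightarrow> int" where
  "left_inverse_series f w =
     (if w = [] then 1 else - (\<Sum>i<length w. left_inverse_series f (take i w) * f (drop i w)))"
  by auto
termination by (relation "measure (length \<circ> snd)") auto

declare left_inverse_series.simps [simp del]

definition unit_series_group :: "('z list \<Rightarrow> int) monoid" where
  "unit_series_group = \<lparr>carrier = {f. f [] = 1}, monoid.mult = convolution, one = (\<lambda>w. if w = [] then 1 else 0)\<rparr>"

lemma convolution_one_left: "convolution (\<lambda>w. if w = [] then 1 else 0) f w = f w"
proof (cases w)
  case (Cons x u)
  have "convolution (\<lambda>u. 0) f u = 0" by (simp add: convolution_eq_sum)
  then show ?thesis using Cons by simp
qed simp

lemma group_unit_series_group: "group (unit_series_group :: ('z list \<Rightarrow> int) monoid)"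
proof (rule groupI)
  fix f :: "'z list \<Rightarrow> int" assume "f \<in> carrier unit_series_group"
  then have f: "f [] = 1" by (simp add: unit_series_group_def)
  have "convolution (left_inverse_series f) f w = (if w = [] then 1 else 0)" for w
  proof (cases "w = []")
    case True
    then show ?thesis using f by (simp add: left_inverse_series.simps)
  next
    case False
    have "convolution (left_inverse_series f) f w =
        (\<Sum>i<length w. left_inverse_series f (take i w) * f (drop i w)) + left_inverse_series f w"
      using f by (simp add: convolution_eq_sum flip: lessThan_Suc_atMost)
    then show ?thesis using False using left_inverse_series.simps[of f w] by simp
  qed
  then show "\<exists>g\<in>carrier unit_series_group. g \<otimes>\<^bsub>unit_series_group\<^esub> f = \<one>\<^bsub>unit_series_group\<^esub>"
    by (intro bexI[of _ "left_inverse_series f"])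
      (auto simp: unit_series_group_def left_inverse_series.simps fun_eq_iff)
qed (auto simp: unit_series_group_def fun_eq_iff convolution_assoc convolution_one_left)

text \<open>
  The map sending a power series with constant term 1 to its linear part is a surjective homomorphism
  onto an additive group; projectivity of \<open>R\<close> lifts \<open>l\<close> along it.
\<close>
lemma exists_magnus_representation:
  fixes F :: "('a, 'm) monoid_scheme" (structure) and l :: "'a \<Rightarrow> 'z \<Rightarrow>\<^sub>0 int"
  assumes F: "is_free_group F" and R: "subgroup R F" and l: "additive_on F R l"
  obtains \<mu> where "\<And>r s. r \<in> R \<Longrightarrow> s \<in> R \<Longrightarrow> \<mu> (r \<otimes> s) = convolution (\<mu> r) (\<mu> s)"
    "\<And>r. r \<in> R \<Longrightarrow> \<mu> r [] = 1"
    "\<And>r z. r \<in> R \<Longrightarrow> \<mu> r [z] = lookup (l r) z"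
proof -
  let ?Q = "\<lparr>carrier = UNIV, monoid.mult = (\<lambda>f g x. f x + g x), one = (\<lambda>x. 0)\<rparr> :: ('z \<Rightarrow> int) monoid"
  have Q: "group ?Q"
  proof (rule groupI)
    fix f assume "f \<in> carrier ?Q"
    show "\<exists>g\<in>carrier ?Q. g \<otimes>\<^bsub>?Q\<^esub> f = \<one>\<^bsub>?Q\<^esub>"
      by (rule bexI[of _ "\<lambda>x. - f x"]) auto
  qed (auto simp: fun_eq_iff)
  let ?p = "\<lambda>f z. f [z]"
  have p: "?p \<in> hom unit_series_group ?Q"
    by (rule homI) (auto simp: unit_series_group_def fun_eq_iff)
  have surj: "carrier ?Q \<subseteq> ?p ` carrier unit_series_group"
  proof
    fix q :: "'z \<Rightarrow> int"
    show "q \<in> ?p ` carrier unit_series_group"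
      by (rule image_eqI[of _ _ "\<lambda>w. if w = [] then 1 else q (hd w)"]) (auto simp: unit_series_group_def)
  qed
  have f: "(\<lambda>r. lookup (l r)) \<in> hom (F\<lparr>carrier := R\<rparr>) ?Q"
    using l by (intro homI) (auto simp: additive_on_def lookup_add fun_eq_iff)
  obtain h where h: "h \<in> hom (F\<lparr>carrier := R\<rparr>) unit_series_group"
    and ph: "\<And>r. r \<in> R \<Longrightarrow> ?p (h r) = lookup (l r)"
    using subgroup_of_free_group_projective[OF F R group_unit_series_group Q p surj f] by blast
  show ?thesis
  proof
    show "h (r \<otimes> s) = convolution (h r) (h s)" if "r \<in> R" "s \<in> R" for r s
      using hom_mult[OF h, of r s] that by (simp add: unit_series_group_def)
    show "h r [] = 1" if "r \<in> R" for r
      using hom_in_carrier[OF h, of r] that by (simp add: unit_series_group_def)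
    show "h r [z] = lookup (l r) z" if "r \<in> R" for r z
      using ph[OF that] by (simp add: fun_eq_iff)
  qed
qed

text \<open>
  The free abelian group on the set \<open>R\<close> maps onto \<open>R/R'\<close>. A lift \<open>c\<close> of the projection \<open>R \<rightarrow> R/R'\<close> kills
  \<open>R'\<close> because its target is abelian, and nothing else because it is a lift.
\<close>
lemma abelianization_embeds_in_free_abelian:
  fixes F :: "('a, 'm) monoid_scheme" (structure)
  assumes F: "is_free_group F" and R: "subgroup R F"
  obtains c :: "'a \<Rightarrow> 'a \<Rightarrow>\<^sub>0 int" where "additive_on F R c"
    "\<And>r. r \<in> R \<Longrightarrow> c r = 0 \<longleftrightarrow> r \<in> derived F R"
proof -
  interpret F: group F using F by (simp add: is_free_group_def)
  let ?FR = "F\<lparr>carrier := R\<rparr>"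
  let ?Q = "?FR Mod derived F R"
  have FR: "group ?FR" by (rule F.subgroup_imp_group[OF R])
  have RF: "R \<subseteq> carrier F" by (rule subgroup.subset[OF R])
  have Q: "comm_group ?Q" by (rule F.derived_quot_of_subgroup_is_comm_group[OF R])
  have derR: "derived F R \<subseteq> R" by (rule F.derived_incl[OF subset_refl R])
  have derS: "subgroup (derived F R) ?FR"
    using derR F.derived_is_subgroup[OF RF] R by (simp add: F.subgroup_incl)
  let ?f = "\<lambda>r. derived F R #> r"
  have fQ: "?f r \<in> carrier ?Q" if "r \<in> R" for r
    using that by (auto simp: carrier_FactGroup)
  have nrm: "derived F R \<lhd> ?FR"
    using F.derived_subgroup_is_normal[OF R] .
  have f: "?f \<in> hom ?FR ?Q"
    using normal.r_coset_hom_Mod[OF nrm] by simp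
  obtain p where p: "p \<in> hom (free_Abelian_group R) ?Q" and pr: "\<And>r. r \<in> R \<Longrightarrow> p (frag_of r) = ?f r"
    using comm_group.free_Abelian_group_universal[OF Q, of ?f R] fQ by blast
  have surj: "carrier ?Q \<subseteq> p ` carrier (free_Abelian_group R)"
  proof
    fix q assume "q \<in> carrier ?Q"
    then obtain r where "r \<in> R" "q = ?f r" by (auto simp: carrier_FactGroup)
    then show "q \<in> p ` carrier (free_Abelian_group R)"
      using pr by (intro image_eqI[of _ _ "frag_of r"]) auto
  qed
  obtain c where c: "c \<in> hom ?FR (free_Abelian_group R)" and pc: "\<And>r. r \<in> R \<Longrightarrow> p (c r) = ?f r"
    using subgroup_of_free_group_projective[OF F R group_free_Abelian_group
        comm_group.axioms(2)[OF Q] p surj f] by blast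
  show ?thesis
  proof
    show add: "additive_on F R c"
      using hom_mult[OF c] by (simp add: additive_on_def)
    fix r assume r: "r \<in> R"
    show "c r = 0 \<longleftrightarrow> r \<in> derived F R"
    proof
      assume "c r = 0"
      then have "?f r = p 0" using pc[OF r] by simp
      also have "p 0 = \<one>\<^bsub>?Q\<^esub>"
        using hom_one[OF p group_free_Abelian_group comm_group.axioms(2)[OF Q]] by simp
      finally have "?f r = derived F R" by simp
      then show "r \<in> derived F R"
        using F.rcos_self[of r "derived F R"] r RF F.derived_is_subgroup[OF RF] by auto
    next
      have S: "subgroup {x \<in> R. c x = 0} F"
        using add R RF F.additive_on_mult[OF add] F.additive_on_inv[OF add R] F.additive_on_one[OF add R]
        by (intro F.subgroupI) (auto simp: subgroup.m_closed subgroup.m_inv_closed intro: subgroup.one_closed)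
      have "derived F R \<subseteq> {x \<in> R. c x = 0}"
        unfolding derived_def
      proof (rule F.generate_subgroup_incl[OF _ S], clarify)
        fix x y assume xy: "x \<in> R" "y \<in> R"
        then show "x \<otimes> y \<otimes> inv x \<otimes> inv y \<in> R \<and>
            c (x \<otimes> y \<otimes> inv x \<otimes> inv y) = 0"
          using R by (simp add: F.additive_on_mult[OF add] F.additive_on_inv[OF add R]
              subgroup.m_closed subgroup.m_inv_closed)
      qed
      then show "r \<in> derived F R \<Longrightarrow> c r = 0" by blast
    qed
  qed
qed

section \<open>Commutators and the lower central series\<close>

definition comm :: "('a, 'm) monoid_scheme \<Rightarrow> 'a \<Rightarrow> 'a \<Rightarrow> 'a" where
  "comm G x y = x \<otimes>\<^bsub>G\<^esub> y \<otimes>\<^bsub>G\<^esub> inv\<^bsub>G\<^esub> x \<otimes>\<^bsub>G\<^esub> inv\<^bsub>G\<^esub> y"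

definition iterated_comm :: "('a, 'm) monoid_scheme \<Rightarrow> 'a list \<Rightarrow> 'a" where
  "iterated_comm G w = foldl (comm G) (hd w) (tl w)"

context group begin

lemma comm_closed [simp]: "x \<in> carrier G \<Longrightarrow> y \<in> carrier G \<Longrightarrow> comm G x y \<in> carrier G"
  by (simp add: comm_def)

lemma cancel_left:
  assumes "x \<in> carrier G" "y \<in> carrier G"
  shows "x \<otimes> (inv x \<otimes> y) = y" "inv x \<otimes> (x \<otimes> y) = y"
  using assms by (simp_all flip: m_assoc)

lemmas expand_comm = comm_def m_assoc inv_mult_group cancel_left

lemma comm_mult_left_expand:
  assumes "x \<in> carrier G" "y \<in> carrier G" "z \<in> carrier G"
  shows "comm G (x \<otimes> y) z = comm G x (comm G y z) \<otimes> comm G y z \<otimes> comm G x z"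
  using assms by (simp add: expand_comm)

lemma comm_mult_right_expand:
  assumes "x \<in> carrier G" "y \<in> carrier G" "z \<in> carrier G"
  shows "comm G z (x \<otimes> y) = comm G z x \<otimes> comm G x (comm G z y) \<otimes> comm G z y"
  using assms by (simp add: expand_comm)

lemma inv_comm: "x \<in> carrier G \<Longrightarrow> y \<in> carrier G \<Longrightarrow> inv (comm G x y) = comm G y x"
  by (simp add: expand_comm)

lemma comm_self [simp]: "x \<in> carrier G \<Longrightarrow> comm G x x = \<one>"
  by (simp add: expand_comm)

lemma comm_one [simp]: "x \<in> carrier G \<Longrightarrow> comm G \<one> x = \<one>" "x \<in> carrier G \<Longrightarrow> comm G x \<one> = \<one>"
  by (simp_all add: expand_comm)

lemma conj_eq_comm_mult:
  "x \<in> carrier G \<Longrightarrow> y \<in> carrier G \<Longrightarrow> x \<otimes> y \<otimes> inv x = comm G x y \<otimes> y"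
  by (simp add: expand_comm)

text \<open>
  The form of the Hall-Witt identity that fits the convention \<open>[x, y] = x y x\<^sup>-\<^sup>1 y\<^sup>-\<^sup>1\<close>.
\<close>
lemma hall_witt:
  assumes "x \<in> carrier G" "y \<in> carrier G" "z \<in> carrier G"
  shows "comm G (comm G x y) (y \<otimes> z \<otimes> inv y) \<otimes> comm G (comm G y z) (z \<otimes> x \<otimes> inv z)
    \<otimes> comm G (comm G z x) (x \<otimes> y \<otimes> inv x) = \<one>"
  using assms by (simp add: expand_comm)

lemma normal_in_carrier: "N \<lhd> G \<Longrightarrow> x \<in> N \<Longrightarrow> x \<in> carrier G"
  by (rule subgroup.mem_carrier[OF normal_imp_subgroup])

lemma comm_in_normal:
  assumes N: "N \<lhd> G" and x: "x \<in> N" and y: "y \<in> carrier G"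
  shows "comm G x y \<in> N" "comm G y x \<in> N"
proof -
  interpret N: normal N G by (rule N)
  have xG: "x \<in> carrier G" using x by simp
  have "comm G x y = x \<otimes> (y \<otimes> inv x \<otimes> inv y)" using xG y by (simp add: expand_comm)
  then show 1: "comm G x y \<in> N" using x y by (simp add: N.inv_op_closed2)
  show "comm G y x \<in> N" using N.m_inv_closed[OF 1] inv_comm[OF xG y] by simp
qed

lemma commutator_subgroup_eq: "commutator_subgroup G A B = generate G (\<Union>a\<in>A. \<Union>b\<in>B. {comm G a b})"
  by (simp add: commutator_subgroup_def comm_def)

lemma comm_in_commutator_subgroup: "a \<in> A \<Longrightarrow> b \<in> B \<Longrightarrow> comm G a b \<in> commutator_subgroup G A B"
  unfolding commutator_subgroup_eq by (rule generate.incl) auto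

lemma commutator_subgroup_least:
  assumes "subgroup H G" "\<And>a b. a \<in> A \<Longrightarrow> b \<in> B \<Longrightarrow> comm G a b \<in> H"
  shows "commutator_subgroup G A B \<subseteq> H"
  unfolding commutator_subgroup_eq by (rule generate_subgroup_incl) (use assms in auto)

lemma commutator_subgroup_normal:
  assumes "A \<lhd> G" "B \<lhd> G"
  shows "commutator_subgroup G A B \<lhd> G"
  unfolding commutator_subgroup_eq
proof (rule normal_generateI)
  show "(\<Union>a\<in>A. \<Union>b\<in>B. {comm G a b}) \<subseteq> carrier G"
    using assms by (auto simp: normal_in_carrier)
  fix h g assume h: "h \<in> (\<Union>a\<in>A. \<Union>b\<in>B. {comm G a b})" and g: "g \<in> carrier G"
  then obtain a b where ab: "a \<in> A" "b \<in> B" "h = comm G a b" by auto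
  have abG: "a \<in> carrier G" "b \<in> carrier G"
    using ab assms by (auto simp: normal_in_carrier)
  have "g \<otimes> h \<otimes> inv g = comm G (g \<otimes> a \<otimes> inv g) (g \<otimes> b \<otimes> inv g)"
    using abG g by (simp add: ab expand_comm)
  moreover have "g \<otimes> a \<otimes> inv g \<in> A" "g \<otimes> b \<otimes> inv g \<in> B"
    using normal.inv_op_closed2[OF assms(1) g ab(1)] normal.inv_op_closed2[OF assms(2) g ab(2)] by auto
  ultimately show "g \<otimes> h \<otimes> inv g \<in> (\<Union>a\<in>A. \<Union>b\<in>B. {comm G a b})" by blast
qed

lemma middle_factor_in_subgroup:
  assumes H: "subgroup H G" and "p \<in> H" "r \<in> H" "q \<in> carrier G" "p \<otimes> q \<otimes> r \<in> H"
  shows "q \<in> H"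
proof -
  have "p \<in> carrier G" "r \<in> carrier G" using assms subgroup.mem_carrier[OF H] by auto
  then have "inv p \<otimes> (p \<otimes> q \<otimes> r) \<otimes> inv r = q"
    using assms(4) by (simp add: m_assoc cancel_left)
  moreover have "inv p \<otimes> (p \<otimes> q \<otimes> r) \<otimes> inv r \<in> H"
    by (rule subgroup.m_closed[OF H subgroup.m_closed[OF H subgroup.m_inv_closed[OF H assms(2)] assms(5)]
          subgroup.m_inv_closed[OF H assms(3)]])
  ultimately show ?thesis by (simp only:)
qed

text \<open>
  Replacing \<open>x\<close> by its conjugate under \<open>inv z\<close> turns the middle factor of the Hall-Witt identity into
  \<open>[[y, z], x]\<close>, while the outer factors stay in \<open>N\<close>.
\<close>
lemma three_subgroups:
  assumes A: "A \<lhd> G" and B: "B \<lhd> G" and C: "C \<lhd> G" and N: "N \<lhd> G"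
    and ab: "\<And>x y z. x \<in> A \<Longrightarrow> y \<in> B \<Longrightarrow> z \<in> C \<Longrightarrow> comm G (comm G x y) z \<in> N"
    and ca: "\<And>x y z. x \<in> A \<Longrightarrow> y \<in> B \<Longrightarrow> z \<in> C \<Longrightarrow> comm G (comm G z x) y \<in> N"
    and x: "x \<in> A" and t: "t \<in> commutator_subgroup G B C"
  shows "comm G x t \<in> N"
proof -
  interpret N: normal N G by (rule N)
  have AG: "x \<in> carrier G" if "x \<in> A" for x by (rule normal_in_carrier[OF A that])
  have BG: "x \<in> carrier G" if "x \<in> B" for x by (rule normal_in_carrier[OF B that])
  have CG: "x \<in> carrier G" if "x \<in> C" for x by (rule normal_in_carrier[OF C that])
  let ?H = "{t \<in> carrier G. comm G x t \<in> N}"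
  have gen: "comm G x (comm G y z) \<in> N" if y: "y \<in> B" and z: "z \<in> C" for y z
  proof -
    define x' where "x' = inv z \<otimes> x \<otimes> inv (inv z)"
    have x': "x' \<in> A" unfolding x'_def by (rule normal.inv_op_closed2[OF A _ x]) (use CG[OF z] in simp)
    have zx: "z \<otimes> x' \<otimes> inv z = x" using AG[OF x] CG[OF z] by (simp add: x'_def expand_comm)
    let ?p = "comm G (comm G x' y) (y \<otimes> z \<otimes> inv y)" and ?q = "comm G (comm G y z) x"
      and ?r = "comm G (comm G z x') (x' \<otimes> y \<otimes> inv x')"
    have p: "?p \<in> N" by (rule ab[OF x' y normal.inv_op_closed2[OF C BG[OF y] z]])
    have r: "?r \<in> N" by (rule ca[OF x' normal.inv_op_closed2[OF B AG[OF x'] y] z])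
    have G: "?q \<in> carrier G" using AG[OF x] BG[OF y] CG[OF z] by simp
    have "?p \<otimes> ?q \<otimes> ?r = \<one>"
      using hall_witt[OF AG[OF x'] BG[OF y] CG[OF z]] zx by simp
    then have pqr: "?p \<otimes> ?q \<otimes> ?r \<in> N" using N.one_closed by (simp only:)
    have q: "?q \<in> N"
      by (rule middle_factor_in_subgroup[OF normal_imp_subgroup[OF N] p r G pqr])
    have "inv ?q = comm G x (comm G y z)"
      by (rule inv_comm) (use AG[OF x] BG[OF y] CG[OF z] in simp_all)
    then show ?thesis using N.m_inv_closed[OF q] by (simp only:)
  qed
  have "subgroup ?H G"
  proof (rule subgroupI)
    show "?H \<noteq> {}" using AG[OF x] by (auto intro: exI[of _ \<one>])
    fix s assume s: "s \<in> ?H"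
    have "comm G x (inv s) = inv s \<otimes> inv (comm G x s) \<otimes> inv (inv s)"
      using s AG[OF x] by (simp add: expand_comm)
    then show "inv s \<in> ?H" using s N.inv_op_closed2[of "inv s" "inv (comm G x s)"] by simp
  next
    fix s s' assume s: "s \<in> ?H" "s' \<in> ?H"
    then show "s \<otimes> s' \<in> ?H"
      using AG[OF x] comm_mult_right_expand[of s s' x] comm_in_normal(2)[OF N, of "comm G x s'" s] by simp
  qed auto
  then have "commutator_subgroup G B C \<subseteq> ?H"
    using gen BG CG by (intro commutator_subgroup_least) auto
  then show ?thesis using t by blast
qed

end

locale lower_central_series = group F for F :: "('a, 'm) monoid_scheme" (structure) +
  fixes R :: "'a set"
  assumes R_normal: "R \<lhd> F"
begin

abbreviation \<Gamma> where "\<Gamma> \<equiv> lower_central F R"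

lemma \<Gamma>_Suc: "0 < i \<Longrightarrow> \<Gamma> (Suc i) = commutator_subgroup F (\<Gamma> i) R"
  by (cases i) auto

lemma \<Gamma>_normal: "\<Gamma> i \<lhd> F"
proof (induction i)
  case (Suc i)
  then show ?case using R_normal by (cases i) (auto intro: commutator_subgroup_normal)
qed (use R_normal in simp)

lemma \<Gamma>_subgroup: "subgroup (\<Gamma> i) F"
  by (rule normal_imp_subgroup[OF \<Gamma>_normal])

lemma \<Gamma>_carrier: "x \<in> \<Gamma> i \<Longrightarrow> x \<in> carrier F"
  by (rule normal_in_carrier[OF \<Gamma>_normal])

lemma R_carrier: "r \<in> R \<Longrightarrow> r \<in> carrier F"
  by (rule normal_in_carrier[OF R_normal])

lemma \<Gamma>_Suc_subset: "\<Gamma> (Suc i) \<subseteq> \<Gamma> i"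
proof (cases i)
  case (Suc j)
  have "comm F a b \<in> \<Gamma> i" if "a \<in> \<Gamma> i" "b \<in> R" for a b
    using comm_in_normal(1)[OF \<Gamma>_normal that(1)] R_carrier that by simp
  then show ?thesis using Suc \<Gamma>_subgroup by (simp add: commutator_subgroup_least)
qed simp

lemma \<Gamma>_antimono: "i \<le> j \<Longrightarrow> \<Gamma> j \<subseteq> \<Gamma> i"
  by (induction j rule: dec_induct) (use \<Gamma>_Suc_subset in blast)+

lemma comm_\<Gamma>_R: "x \<in> \<Gamma> i \<Longrightarrow> r \<in> R \<Longrightarrow> comm F x r \<in> \<Gamma> (Suc i)"
proof (cases i)
  case 0
  assume "x \<in> \<Gamma> i" "r \<in> R"
  then show ?thesis using 0 comm_in_normal(1)[OF \<Gamma>_normal[of 1], of x r] R_carrier by simp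
qed (auto intro: comm_in_commutator_subgroup)

text \<open>
  By induction on \<open>j\<close>, applying the three subgroups lemma to \<open>\<gamma>\<^sub>j\<^sub>+\<^sub>1 = [\<gamma>\<^sub>j, R]\<close>. The dummy value at
  index 0 is harmless, as commutators with elements of \<open>R\<close> stay inside each term.
\<close>
lemma comm_\<Gamma>: "x \<in> \<Gamma> i \<Longrightarrow> y \<in> \<Gamma> j \<Longrightarrow> comm F x y \<in> \<Gamma> (i + j)"
proof (induction j arbitrary: i x y)
  case 0
  then show ?case using comm_in_normal(1)[OF \<Gamma>_normal, of x i y] R_carrier by simp
next
  case (Suc j)
  show ?case
  proof (cases j)
    case 0
    then show ?thesis using Suc.prems comm_\<Gamma>_R by simp
  next
    case (Suc m)
    show ?thesis
    proof (rule three_subgroups[where A = "\<Gamma> i" and B = "\<Gamma> j" and C = R])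
      show "comm F (comm F a b) c \<in> \<Gamma> (i + Suc j)" if "a \<in> \<Gamma> i" "b \<in> \<Gamma> j" "c \<in> R" for a b c
        using comm_\<Gamma>_R[OF Suc.IH[OF that(1,2)] that(3)] by simp
      show "comm F (comm F c a) b \<in> \<Gamma> (i + Suc j)" if "a \<in> \<Gamma> i" "b \<in> \<Gamma> j" "c \<in> R" for a b c
      proof -
        have "comm F c a = inv (comm F a c)"
          using that by (simp add: inv_comm \<Gamma>_carrier R_carrier)
        then have "comm F c a \<in> \<Gamma> (Suc i)"
          using comm_\<Gamma>_R[OF that(1,3)] subgroup.m_inv_closed[OF \<Gamma>_subgroup] by simp
        then show ?thesis using Suc.IH[of "comm F c a" "Suc i" b] that by simp
      qed
      show "y \<in> commutator_subgroup F (\<Gamma> j) R" using Suc.prems \<Gamma>_Suc[of j] Suc by simp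
    qed (use \<Gamma>_normal R_normal Suc.prems in auto)
  qed
qed

end

section \<open>Relations between iterated commutators\<close>

context group begin

lemma coset_mult_cong:
  assumes N: "N \<lhd> G" and "a \<in> carrier G" "a' \<in> carrier G" "b \<in> carrier G" "b' \<in> carrier G"
    and "N #> a = N #> a'" "N #> b = N #> b'"
  shows "N #> (a \<otimes> b) = N #> (a' \<otimes> b')"
  using assms by (simp flip: normal.rcos_sum[OF N])

lemma coset_absorb:
  assumes N: "N \<lhd> G" and "c \<in> N" "x \<in> carrier G"
  shows "N #> (c \<otimes> x) = N #> x"
proof -
  have c: "c \<in> carrier G" using assms by (simp add: normal_in_carrier)
  then have "N #> c = N #> \<one>"
    using coset_join2[OF c normal_imp_subgroup[OF N]] assms
    by (simp add: normal_imp_subgroup subgroup.subset)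
  from coset_mult_cong[OF N c _ assms(3,3) this refl] show ?thesis using assms(3) by simp
qed

lemma coset_eq_self_iff:
  assumes N: "N \<lhd> G" and x: "x \<in> carrier G"
  shows "N #> x = N \<longleftrightarrow> x \<in> N"
  using coset_join2[OF x normal_imp_subgroup[OF N]] rcos_self[OF x normal_imp_subgroup[OF N]] by auto

lemma coset_eq_iff:
  assumes N: "N \<lhd> G" and "x \<in> carrier G" "y \<in> carrier G"
  shows "N #> x = N #> y \<longleftrightarrow> x \<otimes> inv y \<in> N"
proof -
  have "x \<otimes> inv y \<in> N \<longleftrightarrow> x \<in> N #> y"
    by (rule subgroup.rcos_module[OF normal_imp_subgroup[OF N] is_group assms(3,2), symmetric])
  also have "\<dots> \<longleftrightarrow> N #> x = N #> y"
    using rcos_self[OF assms(2) normal_imp_subgroup[OF N]]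
      repr_independence[OF _ assms(3) normal_imp_subgroup[OF N], of x] by metis
  finally show ?thesis by simp
qed

end

lemma iterated_comm_snoc: "w \<noteq> [] \<Longrightarrow> iterated_comm G (w @ [y]) = comm G (iterated_comm G w) y"
  by (cases w) (simp_all add: iterated_comm_def)

context lower_central_series begin

declare lower_central.simps(3) [simp del]

lemma iterated_comm_in_\<Gamma>:
  assumes "set w \<subseteq> R" "w \<noteq> []"
  shows "iterated_comm F w \<in> \<Gamma> (length w)"
  using assms
proof (induction w rule: rev_induct)
  case (snoc y w)
  show ?case
  proof (cases "w = []")
    case True
    then show ?thesis using snoc.prems by (simp add: iterated_comm_def)
  next
    case False
    then show ?thesis using snoc comm_\<Gamma>_R by (simp add: iterated_comm_snoc)
  qed
qed simp

lemma \<Gamma>_le: "x \<in> \<Gamma> i \<Longrightarrow> n \<le> i \<Longrightarrow> x \<in> \<Gamma> n"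
  using \<Gamma>_antimono by blast

lemma coset_commute:
  assumes "x \<in> \<Gamma> i" "y \<in> \<Gamma> j" "n \<le> i + j"
  shows "\<Gamma> n #> (x \<otimes> y) = \<Gamma> n #> (y \<otimes> x)"
proof -
  have G: "x \<in> carrier F" "y \<in> carrier F" using assms \<Gamma>_carrier by auto
  have "x \<otimes> y = comm F x y \<otimes> (y \<otimes> x)" using G by (simp add: expand_comm)
  moreover have "comm F x y \<in> \<Gamma> n" using comm_\<Gamma> \<Gamma>_le assms by blast
  ultimately show ?thesis using coset_absorb[OF \<Gamma>_normal, of _ n "y \<otimes> x"] G by simp
qed

text \<open>
  The error term \<open>[x, [x', y]]\<close> lies in \<open>\<gamma>\<^sub>2\<^sub>i\<^sub>+\<^sub>j\<close>, so commutators are additive in the left argument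
  modulo the next term of the series.
\<close>
lemma comm_mult_left_mod:
  assumes "x \<in> \<Gamma> i" "x' \<in> \<Gamma> i" "y \<in> \<Gamma> j" "0 < i"
  shows "\<Gamma> (Suc (i + j)) #> comm F (x \<otimes> x') y = \<Gamma> (Suc (i + j)) #> (comm F x y \<otimes> comm F x' y)"
proof -
  let ?n = "Suc (i + j)"
  have G: "x \<in> carrier F" "x' \<in> carrier F" "y \<in> carrier F" using assms \<Gamma>_carrier by auto
  have "comm F x (comm F x' y) \<in> \<Gamma> ?n"
    using \<Gamma>_le[OF comm_\<Gamma>[OF assms(1) comm_\<Gamma>[OF assms(2,3)]], of ?n] assms(4) by simp
  then have "\<Gamma> ?n #> comm F (x \<otimes> x') y = \<Gamma> ?n #> (comm F x' y \<otimes> comm F x y)"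
    using coset_absorb[OF \<Gamma>_normal, of "comm F x (comm F x' y)" ?n "comm F x' y \<otimes> comm F x y"] G
    by (simp add: comm_mult_left_expand m_assoc)
  also have "\<dots> = \<Gamma> ?n #> (comm F x y \<otimes> comm F x' y)"
    by (rule coset_commute[OF comm_\<Gamma>[OF assms(2,3)] comm_\<Gamma>[OF assms(1,3)]]) (use assms in simp)
  finally show ?thesis .
qed

lemma comm_inv_left:
  assumes "x \<in> carrier F" "y \<in> carrier F"
  shows "comm F (inv x) y = comm F (inv x) (inv (comm F x y)) \<otimes> inv (comm F x y)"
  using assms by (simp add: expand_comm)

lemma comm_inv_left_mod:
  assumes "x \<in> \<Gamma> i" "y \<in> \<Gamma> j" "0 < i"
  shows "\<Gamma> (Suc (i + j)) #> comm F (inv x) y = \<Gamma> (Suc (i + j)) #> inv (comm F x y)"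
proof -
  let ?n = "Suc (i + j)"
  have G: "x \<in> carrier F" "y \<in> carrier F" using assms \<Gamma>_carrier by auto
  have "comm F (inv x) (inv (comm F x y)) \<in> \<Gamma> (i + (i + j))"
    by (intro comm_\<Gamma> subgroup.m_inv_closed[OF \<Gamma>_subgroup] assms)
  then have c: "comm F (inv x) (inv (comm F x y)) \<in> \<Gamma> ?n" using \<Gamma>_le[of _ _ ?n] assms(3) by simp
  show ?thesis
    using coset_absorb[OF \<Gamma>_normal c, of "inv (comm F x y)"] comm_inv_left[OF G] G by simp
qed

text \<open>
  In the Hall-Witt identity the conjugations can be dropped modulo \<open>\<gamma>\<^sub>i\<^sub>+\<^sub>j\<^sub>+\<^sub>k\<^sub>+\<^sub>1\<close>.
\<close>
lemma jacobi_mod: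
  assumes "x \<in> \<Gamma> i" "y \<in> \<Gamma> j" "z \<in> \<Gamma> k" "0 < i" "0 < j" "0 < k"
  shows "comm F (comm F x y) z \<otimes> comm F (comm F y z) x \<otimes> comm F (comm F z x) y \<in> \<Gamma> (Suc (i + j + k))"
proof -
  let ?n = "Suc (i + j + k)"
  have conj: "comm F (comm F a b) (b \<otimes> c \<otimes> inv b) \<in> carrier F \<and>
      \<Gamma> ?n #> comm F (comm F a b) (b \<otimes> c \<otimes> inv b) = \<Gamma> ?n #> comm F (comm F a b) c"
    if abc: "a \<in> \<Gamma> p" "b \<in> \<Gamma> q" "c \<in> \<Gamma> r" "p + q + r = i + j + k" "0 < q" for a b c p q r
  proof -
    let ?u = "comm F a b" and ?v = "comm F b c"
    have G: "a \<in> carrier F" "b \<in> carrier F" "c \<in> carrier F" using abc \<Gamma>_carrier by auto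
    have u: "?u \<in> \<Gamma> (p + q)" and v: "?v \<in> \<Gamma> (q + r)" using comm_\<Gamma> abc by auto
    have 1: "comm F ?u ?v \<in> \<Gamma> ?n" using \<Gamma>_le[OF comm_\<Gamma>[OF u v], of ?n] abc by simp
    have 2: "comm F ?v (comm F ?u c) \<in> \<Gamma> ?n"
      using \<Gamma>_le[OF comm_\<Gamma>[OF v comm_\<Gamma>[OF u abc(3)]], of ?n] abc by simp
    have 12: "comm F ?u ?v \<otimes> comm F ?v (comm F ?u c) \<in> \<Gamma> ?n"
      by (rule subgroup.m_closed[OF \<Gamma>_subgroup 1 2])
    have "comm F ?u (b \<otimes> c \<otimes> inv b) = comm F ?u ?v \<otimes> comm F ?v (comm F ?u c) \<otimes> comm F ?u c"
      using G by (simp add: conj_eq_comm_mult comm_mult_right_expand)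
    then show ?thesis using coset_absorb[OF \<Gamma>_normal 12, of "comm F ?u c"] G by simp
  qed
  have G: "x \<in> carrier F" "y \<in> carrier F" "z \<in> carrier F" using assms \<Gamma>_carrier by auto
  note c1 = conj[OF assms(1,2,3) refl assms(5)]
  have c2: "comm F (comm F y z) (z \<otimes> x \<otimes> inv z) \<in> carrier F \<and>
      \<Gamma> ?n #> comm F (comm F y z) (z \<otimes> x \<otimes> inv z) = \<Gamma> ?n #> comm F (comm F y z) x"
    by (rule conj[OF assms(2,3,1)]) (use assms in simp_all)
  have c3: "comm F (comm F z x) (x \<otimes> y \<otimes> inv x) \<in> carrier F \<and>
      \<Gamma> ?n #> comm F (comm F z x) (x \<otimes> y \<otimes> inv x) = \<Gamma> ?n #> comm F (comm F z x) y"
    by (rule conj[OF assms(3,1,2)]) (use assms in simp_all)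
  have "\<Gamma> ?n #> (comm F (comm F x y) z \<otimes> comm F (comm F y z) x \<otimes> comm F (comm F z x) y) = \<Gamma> ?n #> \<one>"
    unfolding hall_witt[OF G, symmetric]
    by (intro coset_mult_cong[OF \<Gamma>_normal]) (use c1 c2 c3 G in simp_all)
  then show ?thesis
    using coset_eq_iff[OF \<Gamma>_normal, of _ "\<one>" ?n] G by simp
qed

text \<open>
  Since \<open>[_, w]\<close> is additive modulo \<open>\<gamma>\<^sub>k\<^sub>+\<^sub>2\<close>, a relation between elements of degree \<open>k\<close> persists when
  \<open>w\<close> is appended.
\<close>
lemma comm_of_trivial_product:
  assumes "a \<in> \<Gamma> k" "b \<in> \<Gamma> k" "a \<otimes> b \<in> \<Gamma> (Suc k)" "w \<in> R" "0 < k"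
  shows "comm F a w \<otimes> comm F b w \<in> \<Gamma> (Suc (Suc k))"
proof -
  have G: "a \<in> carrier F" "b \<in> carrier F" "w \<in> carrier F" using assms \<Gamma>_carrier R_carrier by auto
  have "\<Gamma> (Suc (Suc k)) #> (comm F a w \<otimes> comm F b w) = \<Gamma> (Suc (Suc k)) #> comm F (a \<otimes> b) w"
    using comm_mult_left_mod[of a k b w 1] assms by simp
  also have "\<dots> = \<Gamma> (Suc (Suc k))"
    using coset_eq_self_iff[OF \<Gamma>_normal] comm_\<Gamma>_R[OF assms(3,4)] \<Gamma>_carrier by blast
  finally show ?thesis using coset_eq_self_iff[OF \<Gamma>_normal] G by simp
qed

lemma comm_of_trivial_product3:
  assumes "a \<in> \<Gamma> k" "b \<in> \<Gamma> k" "c \<in> \<Gamma> k" "a \<otimes> b \<otimes> c \<in> \<Gamma> (Suc k)" "w \<in> R" "0 < k"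
  shows "comm F a w \<otimes> comm F b w \<otimes> comm F c w \<in> \<Gamma> (Suc (Suc k))"
proof -
  let ?n = "Suc (Suc k)"
  have G: "a \<in> carrier F" "b \<in> carrier F" "c \<in> carrier F" "w \<in> carrier F"
    using assms \<Gamma>_carrier R_carrier by auto
  have ab: "a \<otimes> b \<in> \<Gamma> k" by (rule subgroup.m_closed[OF \<Gamma>_subgroup assms(1,2)])
  have "\<Gamma> ?n #> (comm F a w \<otimes> comm F b w \<otimes> comm F c w) = \<Gamma> ?n #> (comm F (a \<otimes> b) w \<otimes> comm F c w)"
    by (intro coset_mult_cong[OF \<Gamma>_normal])
      (use comm_mult_left_mod[of a k b w 1] assms G in simp_all)
  then have "\<Gamma> ?n #> (comm F a w \<otimes> comm F b w \<otimes> comm F c w) = \<Gamma> ?n"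
    using comm_of_trivial_product[OF ab assms(3,4,5,6)] coset_eq_self_iff[OF \<Gamma>_normal] \<Gamma>_carrier by simp
  then show ?thesis using coset_eq_self_iff[OF \<Gamma>_normal] G by simp
qed

abbreviation L where "L \<equiv> iterated_comm F"

lemma L3_swap: "x \<in> R \<Longrightarrow> y \<in> R \<Longrightarrow> z \<in> R \<Longrightarrow> L [x, y, z] \<otimes> L [y, x, z] \<in> \<Gamma> 4"
proof -
  assume R: "x \<in> R" "y \<in> R" "z \<in> R"
  then have "comm F x y \<otimes> comm F y x = \<one>" by (simp add: R_carrier flip: inv_comm[of x y])
  then have "comm F x y \<otimes> comm F y x \<in> \<Gamma> (Suc 2)"
    using subgroup.one_closed[OF \<Gamma>_subgroup, of "Suc 2"] by (simp only:)
  then show ?thesis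
    using comm_of_trivial_product[of "comm F x y" 2 "comm F y x" z] comm_\<Gamma>[of x 1 y 1] comm_\<Gamma>[of y 1 x 1] R
    by (simp add: iterated_comm_def eval_nat_numeral)
qed

lemma L3_jacobi:
  "x \<in> R \<Longrightarrow> y \<in> R \<Longrightarrow> z \<in> R \<Longrightarrow> L [x, y, z] \<otimes> L [y, z, x] \<otimes> L [z, x, y] \<in> \<Gamma> 4"
  using jacobi_mod[of x 1 y 1 z 1] by (simp add: iterated_comm_def eval_nat_numeral)

lemma L_in_\<Gamma>: "w \<noteq> [] \<Longrightarrow> set w \<subseteq> R \<Longrightarrow> n = length w \<Longrightarrow> L w \<in> \<Gamma> n"
  using iterated_comm_in_\<Gamma> by simp

lemma L4_swap:
  assumes "x \<in> R" "y \<in> R" "z \<in> R" "w \<in> R"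
  shows "L [x, y, z, w] \<otimes> L [y, x, z, w] \<in> \<Gamma> 5"
  using comm_of_trivial_product[OF L_in_\<Gamma> L_in_\<Gamma> _ assms(4), of "[x, y, z]" 3 "[y, x, z]"] L3_swap assms
  by (simp add: iterated_comm_def)

lemma L4_jacobi:
  assumes "x \<in> R" "y \<in> R" "z \<in> R" "w \<in> R"
  shows "L [x, y, z, w] \<otimes> L [y, z, x, w] \<otimes> L [z, x, y, w] \<in> \<Gamma> 5"
  using comm_of_trivial_product3[OF L_in_\<Gamma> L_in_\<Gamma> L_in_\<Gamma> _ assms(4), of "[x, y, z]" 3 "[y, z, x]" "[z, x, y]"]
    L3_jacobi assms by (simp add: iterated_comm_def)

text \<open>
  The Jacobi identity for the elements \<open>[x, y]\<close>, \<open>z\<close>, \<open>w\<close>: exchanging the last two entries changes an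
  iterated commutator by \<open>[[x, y], [z, w]]\<close>.
\<close>
lemma L4_last_two:
  assumes "x \<in> R" "y \<in> R" "z \<in> R" "w \<in> R"
  shows "L [x, y, z, w] \<otimes> inv L [x, y, w, z] \<otimes> inv comm F (comm F x y) (comm F z w) \<in> \<Gamma> 5"
proof -
  let ?u = "comm F x y" and ?v = "comm F z w"
  let ?A = "comm F (comm F ?u z) w" and ?B = "comm F (comm F ?u w) z" and ?t = "comm F ?v ?u"
  have G: "x \<in> carrier F" "y \<in> carrier F" "z \<in> carrier F" "w \<in> carrier F"
    using assms R_carrier by auto
  have u: "?u \<in> \<Gamma> 2" and v: "?v \<in> \<Gamma> 2"
    using comm_\<Gamma>[of x 1 y 1] comm_\<Gamma>[of z 1 w 1] assms by (simp_all add: eval_nat_numeral)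
  have w: "w \<in> \<Gamma> 1" "z \<in> \<Gamma> 1" using assms by auto
  have uw: "comm F ?u w \<in> \<Gamma> 3" using comm_\<Gamma>_R[OF u assms(4)] by (simp add: eval_nat_numeral)
  have B: "?B \<in> \<Gamma> 4" using comm_\<Gamma>_R[OF uw assms(3)] by (simp add: eval_nat_numeral)
  have t: "?t \<in> \<Gamma> 4" using comm_\<Gamma>[OF v u] by simp
  have "\<Gamma> 5 #> (?A \<otimes> (inv ?B \<otimes> ?t)) = \<Gamma> 5 #> (?A \<otimes> (?t \<otimes> inv ?B))"
    by (intro coset_mult_cong[OF \<Gamma>_normal] refl
        coset_commute[OF subgroup.m_inv_closed[OF \<Gamma>_subgroup B] t]) (use G in simp_all)
  then have "\<Gamma> 5 #> (?A \<otimes> inv ?B \<otimes> ?t) = \<Gamma> 5 #> (?A \<otimes> (?t \<otimes> inv ?B))"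
    using G by (simp add: m_assoc)
  also have "\<dots> = \<Gamma> 5 #> (?A \<otimes> ?t \<otimes> inv ?B)" using G by (simp add: m_assoc)
  also have "\<dots> = \<Gamma> 5 #> (?A \<otimes> ?t \<otimes> comm F (comm F w ?u) z)"
  proof (intro coset_mult_cong[OF \<Gamma>_normal] refl)
    have "\<Gamma> (Suc (3 + 1)) #> comm F (inv comm F ?u w) z = \<Gamma> (Suc (3 + 1)) #> inv ?B"
      by (rule comm_inv_left_mod[OF uw w(2)]) simp
    then show "\<Gamma> 5 #> inv ?B = \<Gamma> 5 #> comm F (comm F w ?u) z"
      using G by (simp add: inv_comm)
  qed (use G in simp_all)
  also have "\<dots> = \<Gamma> 5"
    using jacobi_mod[OF u w(2) w(1)] G by (subst coset_eq_self_iff[OF \<Gamma>_normal]) (simp_all add: eval_nat_numeral)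
  finally have "?A \<otimes> inv ?B \<otimes> ?t \<in> \<Gamma> 5"
    using coset_eq_self_iff[OF \<Gamma>_normal, of "?A \<otimes> inv ?B \<otimes> ?t" 5] G by simp
  then show ?thesis using G by (simp add: iterated_comm_def inv_comm)
qed

text \<open>
  Generators of \<open>R\<close> modulo \<open>R'\<close> yield generators of \<open>\<gamma>\<^sub>k\<close> modulo \<open>\<gamma>\<^sub>k\<^sub>+\<^sub>1\<close>. In the step both slots of
  \<open>[u, r]\<close> are treated in turn: for an iterated commutator \<open>u\<close> the elements \<open>r\<close> with \<open>[u, r] \<in> M\<close> form a
  subgroup containing \<open>Z\<close> and \<open>R'\<close>, hence all of \<open>R\<close>; then the elements \<open>u\<close> with \<open>[u, r] \<in> M\<close> for all
  \<open>r\<close> form a subgroup to which the induction hypothesis applies.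
\<close>
lemma \<Gamma>_generated_by_iterated_comms:
  assumes Z: "Z \<subseteq> R" and gen: "\<And>M. subgroup M F \<Longrightarrow> Z \<subseteq> M \<Longrightarrow> derived F R \<subseteq> M \<Longrightarrow> R \<subseteq> M"
    and M: "subgroup M F" "\<Gamma> (Suc k) \<subseteq> M"
    and base: "\<And>w. set w \<subseteq> Z \<Longrightarrow> length w = k \<Longrightarrow> L w \<in> M" and k: "0 < k"
  shows "\<Gamma> k \<subseteq> M"
  using k M base
proof (induction k arbitrary: M rule: nat_induct_non_zero)
  case 1
  have "z \<in> M" if "z \<in> Z" for z using "1.prems"(3)[of "[z]"] that by (simp add: iterated_comm_def)
  moreover have "derived F R \<subseteq> M" using "1.prems"(2) lower_central_2[of F R] by (simp add: numeral_2_eq_2)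
  ultimately show ?case using gen[OF "1.prems"(1)] by auto
next
  case (Suc k M)
  have Mmult: "a \<in> M \<Longrightarrow> b \<in> M \<Longrightarrow> a \<otimes> b \<in> M" and Minv: "a \<in> M \<Longrightarrow> inv a \<in> M" for a b
    using Suc.prems(1) by (auto simp: subgroup.m_closed subgroup.m_inv_closed)
  have deep: "a \<in> M" if "a \<in> \<Gamma> j" "Suc (Suc k) \<le> j" for a j
    using \<Gamma>_le[OF that] Suc.prems(2) by blast
  have Rmult: "a \<in> R \<Longrightarrow> b \<in> R \<Longrightarrow> a \<otimes> b \<in> R" and Rinv: "a \<in> R \<Longrightarrow> inv a \<in> R" for a b
    using normal_imp_subgroup[OF R_normal] by (auto simp: subgroup.m_closed subgroup.m_inv_closed)
  have first: "comm F (L w) r \<in> M" if w: "set w \<subseteq> Z" "length w = k" and r: "r \<in> R" for w r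
  proof -
    let ?u = "L w"
    have u: "?u \<in> \<Gamma> k" using L_in_\<Gamma>[of w k] w Z Suc.hyps by auto
    have uG: "?u \<in> carrier F" by (rule \<Gamma>_carrier[OF u])
    let ?H = "{r \<in> R. comm F ?u r \<in> M}"
    have mid: "comm F a (comm F ?u b) \<in> M" if "a \<in> R" "b \<in> R" for a b
      using deep[OF comm_\<Gamma>[of a 1 "comm F ?u b" "Suc k"]] comm_\<Gamma>_R[OF u] that by simp
    have "subgroup ?H F"
    proof (rule subgroupI)
      have "\<one> \<in> R" by (rule subgroup.one_closed[OF normal_imp_subgroup[OF R_normal]])
      moreover have "\<one> \<in> M" by (rule subgroup.one_closed[OF Suc.prems(1)])
      ultimately show "?H \<noteq> {}" using uG by auto
      fix a assume a: "a \<in> ?H"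
      have "comm F ?u (inv a) = inv (comm F ?u a) \<otimes> inv (comm F (inv a) (comm F ?u a))"
        using a uG R_carrier[of a] by (simp add: expand_comm)
      then show "inv a \<in> ?H"
        using a mid[of "inv a" a] by (auto intro!: Mmult Minv Rinv)
    next
      fix a b assume ab: "a \<in> ?H" "b \<in> ?H"
      then show "a \<otimes> b \<in> ?H"
        using mid[of a b] comm_mult_right_expand[of a b ?u] uG by (simp add: R_carrier Mmult Rmult)
    qed (use R_carrier in auto)
    moreover have "Z \<subseteq> ?H"
    proof
      fix z assume "z \<in> Z"
      moreover have "w \<noteq> []" using w Suc.hyps by auto
      ultimately show "z \<in> ?H"
        using Suc.prems(3)[of "w @ [z]"] w Z by (auto simp: iterated_comm_snoc)
    qed
    moreover have "derived F R \<subseteq> ?H"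
    proof
      fix d assume d: "d \<in> derived F R"
      then have d2: "d \<in> \<Gamma> 2" by (simp add: lower_central_2)
      then have "d \<in> R" using \<Gamma>_le[OF d2, of 1] by simp
      then show "d \<in> ?H" using deep[OF comm_\<Gamma>[OF u d2]] by simp
    qed
    ultimately have "R \<subseteq> ?H" by (rule gen)
    then show ?thesis using r by blast
  qed
  let ?U = "{u \<in> \<Gamma> k. \<forall>r\<in>R. comm F u r \<in> M}"
  have "subgroup ?U F"
  proof (rule subgroupI)
    have "\<one> \<in> M" by (rule subgroup.one_closed[OF Suc.prems(1)])
    then show "?U \<noteq> {}" using subgroup.one_closed[OF \<Gamma>_subgroup] by (auto simp: R_carrier intro!: exI[of _ \<one>])
    fix a assume a: "a \<in> ?U"
    have "comm F (inv a) r \<in> M" if r: "r \<in> R" for r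
    proof -
      have "comm F (inv a) (inv (comm F a r)) \<in> \<Gamma> (k + Suc k)"
        using a r by (intro comm_\<Gamma> subgroup.m_inv_closed[OF \<Gamma>_subgroup] comm_\<Gamma>_R) auto
      then have "comm F (inv a) (inv (comm F a r)) \<in> M" by (rule deep) (use Suc.hyps in simp)
      then show ?thesis
        using comm_inv_left[of a r] a r \<Gamma>_carrier[of a k] by (simp add: R_carrier Mmult Minv)
    qed
    then show "inv a \<in> ?U" using a by (simp add: subgroup.m_inv_closed[OF \<Gamma>_subgroup])
  next
    fix a b assume ab: "a \<in> ?U" "b \<in> ?U"
    have "comm F (a \<otimes> b) r \<in> M" if r: "r \<in> R" for r
    proof -
      have "comm F a (comm F b r) \<in> \<Gamma> (k + Suc k)"
        using ab r by (intro comm_\<Gamma> comm_\<Gamma>_R) auto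
      then have "comm F a (comm F b r) \<in> M" by (rule deep) (use Suc.hyps in simp)
      then show ?thesis
        using comm_mult_left_expand[of a b r] ab r \<Gamma>_carrier[of a k] \<Gamma>_carrier[of b k]
        by (simp add: R_carrier Mmult)
    qed
    then show "a \<otimes> b \<in> ?U" using ab by (simp add: subgroup.m_closed[OF \<Gamma>_subgroup])
  qed (use \<Gamma>_carrier in auto)
  moreover have "\<Gamma> (Suc k) \<subseteq> ?U"
    using \<Gamma>_Suc_subset deep[OF comm_\<Gamma>_R] by auto
  moreover have "L w \<in> ?U" if "set w \<subseteq> Z" "length w = k" for w
    using first[OF that] L_in_\<Gamma>[of w k] that Z Suc.hyps by auto
  ultimately have "\<Gamma> k \<subseteq> ?U" by (rule Suc.IH)
  then show ?case
    using Suc.hyps Suc.prems(1) by (auto simp: \<Gamma>_Suc dest!: subsetD[OF commutator_subgroup_least, rotated 2])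
qed

end

section \<open>Inverting the expansion into Lie polynomials\<close>

text \<open>
  The expansion of the left-normed Lie bracket of the letters of \<open>w\<close> in the free associative ring.
\<close>
definition lie_polynomial :: "'z list \<Rightarrow> 'z list \<Rightarrow>\<^sub>0 int" where
  "lie_polynomial w =
     foldl (\<lambda>v y. frag_extend (\<lambda>u. frag_of (u @ [y])) v - frag_extend (\<lambda>u. frag_of (y # u)) v)
       (frag_of [hd w]) (tl w)"

lemmas lie_expand = lie_polynomial_def frag_extend_diff frag_extend_add frag_extend_minus

locale relation_module =
  fixes N :: "'b::ab_group_add set"
  assumes zero_mem: "0 \<in> N" and diff_mem: "u \<in> N \<Longrightarrow> v \<in> N \<Longrightarrow> u - v \<in> N"
begin

lemma minus_mem: "u \<in> N \<Longrightarrow> - u \<in> N"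
  using diff_mem[OF zero_mem] by simp

lemma add_mem: "u \<in> N \<Longrightarrow> v \<in> N \<Longrightarrow> u + v \<in> N"
  using diff_mem[OF _ minus_mem] by force

lemmas mem_intros = zero_mem diff_mem add_mem minus_mem

end

text \<open>
  A letter \<open>x\<close> of multiplicity one makes a multihomogeneous Lie polynomial easy to read: such a
  polynomial is a combination of left-normed brackets beginning with \<open>x\<close>, and each of these contains exactly one
  word beginning with \<open>x\<close>, namely its letters in their given order. The predicate \<open>A\<close> singles out the letters from
  \<open>S\<close>; a letter of \<open>A\<close> is preferred, because the words that matter have their letters from \<open>A\<close> in front.
\<close>
definition distinguished :: "('z \<Rightarrow> bool) \<Rightarrow> 'z multiset \<Rightarrow> 'z \<Rightarrow> bool" where
  "distinguished A M x \<longleftrightarrow> count M x = 1 \<and> (A x \<or> (\<forall>y\<in>#M. \<not> A y))"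

definition chosen :: "('z \<Rightarrow> bool) \<Rightarrow> 'z multiset \<Rightarrow> 'z" where
  "chosen A M = (SOME x. distinguished A M x)"

lemma distinguished_chosen: "distinguished A M x \<Longrightarrow> distinguished A M (chosen A M)"
  unfolding chosen_def by (rule someI)

definition retract2 :: "('z \<Rightarrow> bool) \<Rightarrow> 'z set \<Rightarrow> 'z list \<Rightarrow> 'z list \<Rightarrow>\<^sub>0 int" where
  "retract2 A Z w =
     (if length w = 2 \<and> set w \<subseteq> Z \<and> (\<forall>x\<in>set w. \<not> A x) \<and> hd w = chosen A (mset w) then frag_of w else 0)"

text \<open>
  In the degrees two and three every multiset of letters that supports a nonzero Lie polynomial and is
  not annihilated by the relations for letters of \<open>A\<close> has a distinguished letter.
\<close>
definition retract3 :: "('z \<Rightarrow> bool) \<Rightarrow> 'z set \<Rightarrow> 'z list \<Rightarrow> 'z list \<Rightarrow>\<^sub>0 int" where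
  "retract3 A Z w =
     (if length w = 3 \<and> set w \<subseteq> Z \<and> distinguished A (mset w) (hd w) \<and> (\<forall>x\<in>set (tl w). \<not> A x) \<and>
        hd w = chosen A (mset w) then frag_of w else 0)"

text \<open>
  A multiset with three or more letters in \<open>A\<close> contributes nothing. With two letters \<open>a, a'\<close> in \<open>A\<close>, the words of the shape
  \<open>a a' b b'\<close> are the coordinates: the bracket \<open>[b, a', a, b']\<close> contains \<open>a a' b b'\<close> with coefficient 1
  and no other word of this shape, and the brackets \<open>[[b, a], [b', a']]\<close> contain none. With at most one
  letter in \<open>A\<close> a distinguished letter is used if there is one. Otherwise the multiset consists of two
  letters outside \<open>A\<close>, each taken twice, or of a single letter; the Lie polynomials in \<open>x, x, y, y\<close> are the multiples of
  \<open>[y, x, x, y]\<close>, in which \<open>x x y y\<close> has coefficient 1.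
\<close>
definition retract4 :: "('z \<Rightarrow> bool) \<Rightarrow> 'z set \<Rightarrow> 'z list \<Rightarrow> 'z list \<Rightarrow>\<^sub>0 int" where
  "retract4 A Z w =
     (if length w = 4 \<and> set w \<subseteq> Z then
        (let p = w ! 0; q = w ! 1; r = w ! 2; s = w ! 3 in
         if A r \<or> A s then 0
         else if A q then (if A p then frag_of [r, q, p, s] else 0)
         else if \<exists>x. distinguished A (mset w) x then (if p = chosen A (mset w) then frag_of w else 0)
         else if p = q \<and> r = s \<and> p \<noteq> r \<and> p = (SOME x. x \<in># mset w) then frag_of [r, p, p, r] else 0)
      else 0)"

lemma retract4_eq:
  assumes "p \<in> Z" "q \<in> Z" "r \<in> Z" "s \<in> Z" and M: "mset [p, q, r, s] = M"
  shows "retract4 A Z [p, q, r, s] =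
    (if A r \<or> A s then 0
     else if A q then (if A p then frag_of [r, q, p, s] else 0)
     else if \<exists>x. distinguished A M x then (if p = chosen A M then frag_of [p, q, r, s] else 0)
     else if p = q \<and> r = s \<and> p \<noteq> r \<and> p = (SOME x. x \<in># M) then frag_of [r, p, p, r] else 0)"
  unfolding M[symmetric] using assms(1-4) by (simp add: retract4_def Let_def del: mset.simps)

text \<open>
  In this locale and its analogues for degrees three and four, a word stands for the iterated
  commutator of its letters, and \<open>N\<close> contains the combinations that are trivial in the quotient under
  consideration. The retraction lemmas express that \<open>retract2\<close>, \<open>retract3\<close> and \<open>retract4\<close> invert
  \<open>lie_polynomial\<close> modulo \<open>N\<close>.
\<close>
locale lie_relations2 = relation_module N for N :: "('z list \<Rightarrow>\<^sub>0 int) set" +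
  fixes Z :: "'z set" and A :: "'z \<Rightarrow> bool"
  assumes diag: "x \<in> Z \<Longrightarrow> frag_of [x, x] \<in> N"
    and swap: "x \<in> Z \<Longrightarrow> y \<in> Z \<Longrightarrow> frag_of [x, y] + frag_of [y, x] \<in> N"
    and one_A: "x \<in> Z \<Longrightarrow> a \<in> Z \<Longrightarrow> A a \<Longrightarrow> frag_of [x, a] \<in> N"
begin

lemma retract2:
  assumes Z: "x \<in> Z" "y \<in> Z"
  shows "frag_extend (retract2 A Z) (lie_polynomial [x, y]) - frag_of [x, y] \<in> N"
proof -
  let ?E = "frag_extend (retract2 A Z) (lie_polynomial [x, y]) - frag_of [x, y]"
  have E: "?E = retract2 A Z [x, y] - retract2 A Z [y, x] - frag_of [x, y]"
    by (simp add: lie_expand)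
  consider "x = y" | "x \<noteq> y" "A y" | "x \<noteq> y" "A x" | "x \<noteq> y" "\<not> A x" "\<not> A y" by blast
  then show ?thesis
  proof cases
    case 1
    then show ?thesis using E minus_mem[OF diag[OF Z(1)]] by simp
  next
    case 2
    then show ?thesis using E minus_mem[OF one_A[OF Z 2(2)]] by (simp add: retract2_def)
  next
    case 3
    have "?E = frag_of [y, x] - (frag_of [x, y] + frag_of [y, x])"
      using E 3 by (simp add: retract2_def)
    then show ?thesis using diff_mem[OF one_A[OF Z(2,1) 3(2)] swap[OF Z]] by simp
  next
    case 4
    have "distinguished A {#x, y#} x" using 4 by (simp add: distinguished_def)
    then have "distinguished A {#x, y#} (chosen A {#x, y#})" by (rule distinguished_chosen)
    then have "count {#x, y#} (chosen A {#x, y#}) = 1" by (simp only: distinguished_def)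
    then have c: "chosen A {#x, y#} = x \<or> chosen A {#x, y#} = y"
      by (auto split: if_splits)
    have ev: "retract2 A Z [x, y] = (if x = chosen A {#x, y#} then frag_of [x, y] else 0)"
      "retract2 A Z [y, x] = (if y = chosen A {#x, y#} then frag_of [y, x] else 0)"
      using 4 Z by (simp_all add: retract2_def add_mset_commute[of y x])
    from c show ?thesis
    proof
      assume "chosen A {#x, y#} = x"
      then show ?thesis using E ev 4 zero_mem by simp
    next
      assume "chosen A {#x, y#} = y"
      then have "?E = - (frag_of [x, y] + frag_of [y, x])" using E ev 4 by simp
      also have "\<dots> \<in> N" by (rule minus_mem[OF swap[OF Z]])
      finally show ?thesis .
    qed
  qed
qed

end

locale lie_relations3 = relation_module N for N :: "('z list \<Rightarrow>\<^sub>0 int) set" +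
  fixes Z :: "'z set" and A :: "'z \<Rightarrow> bool"
  assumes diag: "x \<in> Z \<Longrightarrow> y \<in> Z \<Longrightarrow> frag_of [x, x, y] \<in> N"
    and swap: "x \<in> Z \<Longrightarrow> y \<in> Z \<Longrightarrow> z \<in> Z \<Longrightarrow> frag_of [x, y, z] + frag_of [y, x, z] \<in> N"
    and jacobi: "x \<in> Z \<Longrightarrow> y \<in> Z \<Longrightarrow> z \<in> Z \<Longrightarrow>
      frag_of [x, y, z] + frag_of [y, z, x] + frag_of [z, x, y] \<in> N"
    and two_A: "x \<in> Z \<Longrightarrow> a \<in> Z \<Longrightarrow> b \<in> Z \<Longrightarrow> A a \<Longrightarrow> A b \<Longrightarrow> frag_of [x, a, b] \<in> N"
begin

text \<open>
  Antisymmetry and the Jacobi identity move the letter outside \<open>A\<close> to the front.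
\<close>
lemma two_A_any:
  assumes Z: "x \<in> Z" "y \<in> Z" "z \<in> Z" and A: "A x \<and> A y \<or> A x \<and> A z \<or> A y \<and> A z"
  shows "frag_of [x, y, z] \<in> N"
proof -
  have xz: "frag_of [u, v, t] \<in> N" if "u \<in> Z" "v \<in> Z" "t \<in> Z" "A u" "A t" for u v t
  proof -
    have "frag_of [u, v, t] = frag_of [u, v, t] + frag_of [v, u, t] - frag_of [v, u, t]" by simp
    also have "\<dots> \<in> N" using that by (intro mem_intros swap two_A)
    finally show ?thesis .
  qed
  have xy: "frag_of [u, v, t] \<in> N" if "u \<in> Z" "v \<in> Z" "t \<in> Z" "A u" "A v" for u v t
  proof -
    have "frag_of [u, v, t] =
        frag_of [u, v, t] + frag_of [v, t, u] + frag_of [t, u, v] - frag_of [v, t, u] - frag_of [t, u, v]"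
      by simp
    also have "\<dots> \<in> N" using that by (intro diff_mem jacobi xz two_A)
    finally show ?thesis .
  qed
  show ?thesis using A xz xy two_A Z by blast
qed

lemma retract3:
  assumes Z: "x \<in> Z" "y \<in> Z" "z \<in> Z"
  shows "frag_extend (retract3 A Z) (lie_polynomial [x, y, z]) - frag_of [x, y, z] \<in> N"
proof -
  let ?\<psi> = "retract3 A Z"
  let ?E = "frag_extend ?\<psi> (lie_polynomial [x, y, z]) - frag_of [x, y, z]"
  let ?M = "{#x, y, z#}"
  have E: "?E = ?\<psi> [x, y, z] - ?\<psi> [y, x, z] - ?\<psi> [z, x, y] + ?\<psi> [z, y, x] - frag_of [x, y, z]"
    by (simp add: lie_expand)
  consider "x = y" | "A x \<and> A y \<or> A x \<and> A z \<or> A y \<and> A z"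
    | "x \<noteq> y" "\<not> (A x \<and> A y \<or> A x \<and> A z \<or> A y \<and> A z)" by blast
  then show ?thesis
  proof cases
    case 1
    then have "?E = - frag_of [x, x, z]" by (simp add: lie_expand)
    then show ?thesis using minus_mem[OF diag[OF Z(1,3)]] by simp
  next
    case 2
    then have "?E = - frag_of [x, y, z]"
      unfolding E by (auto simp: retract3_def distinguished_def)
    then show ?thesis using minus_mem[OF two_A_any[OF Z 2]] by simp
  next
    case 3
    have "\<exists>c. distinguished A ?M c"
    proof -
      have "distinguished A ?M x \<or> distinguished A ?M y \<or> distinguished A ?M z"
        using 3 by (auto simp: distinguished_def)
      then show ?thesis by blast
    qed
    then have d: "distinguished A ?M (chosen A ?M)" by (elim exE) (rule distinguished_chosen)
    define c where "c = chosen A ?M"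
    have cnt: "count ?M c = 1" and cA: "A c \<or> \<not> A x \<and> \<not> A y \<and> \<not> A z"
      using d by (auto simp: distinguished_def c_def)
    have ev: "?\<psi> [p, q, r] = (if p = c then frag_of [p, q, r] else 0)" if "{#p, q, r#} = ?M" for p q r
    proof -
      have s: "{p, q, r} = {x, y, z}" using arg_cong[OF that, of set_mset] by simp
      then have "set [p, q, r] \<subseteq> Z" using Z by auto
      moreover have "\<not> A q \<and> \<not> A r" if "p = c"
      proof (cases "A c")
        case True
        have "size (filter_mset A {#p, q, r#}) \<le> 1"
          unfolding \<open>{#p, q, r#} = ?M\<close> using 3 by auto
        then show ?thesis using True that by (auto split: if_splits)
      next
        case False
        then show ?thesis using cA s by auto
      qed
      ultimately show ?thesis using d \<open>{#p, q, r#} = ?M\<close> by (auto simp: retract3_def c_def)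
    qed
    have evs: "?\<psi> [x, y, z] = (if x = c then frag_of [x, y, z] else 0)"
      "?\<psi> [y, x, z] = (if y = c then frag_of [y, x, z] else 0)"
      "?\<psi> [z, x, y] = (if z = c then frag_of [z, x, y] else 0)"
      "?\<psi> [z, y, x] = (if z = c then frag_of [z, y, x] else 0)"
      by (rule ev; simp add: add_mset_commute)+
    have "c = x \<or> c = y \<or> c = z" using cnt by (auto split: if_splits)
    then consider "c = x" "y \<noteq> c" "z \<noteq> c" | "c = y" "x \<noteq> c" "z \<noteq> c" | "c = z" "x \<noteq> c" "y \<noteq> c"
      using cnt by (auto split: if_splits)
    then show ?thesis
    proof cases
      case 1
      then have "?E = 0" unfolding E evs by auto
      then show ?thesis using zero_mem by simp
    next
      case 2
      then have "?E = - (frag_of [x, y, z] + frag_of [y, x, z])" unfolding E evs by auto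
      also have "\<dots> \<in> N" by (intro mem_intros swap Z)
      finally show ?thesis .
    next
      case 3
      then have "?E = (frag_of [y, z, x] + frag_of [z, y, x])
          - (frag_of [x, y, z] + frag_of [y, z, x] + frag_of [z, x, y])" unfolding E evs by auto
      also have "\<dots> \<in> N" by (intro diff_mem swap jacobi Z)
      finally show ?thesis .
    qed
  qed
qed

end

locale lie_relations4 = relation_module N for N :: "('z list \<Rightarrow>\<^sub>0 int) set" +
  fixes Z :: "'z set" and A :: "'z \<Rightarrow> bool"
  assumes diag: "x \<in> Z \<Longrightarrow> z \<in> Z \<Longrightarrow> w \<in> Z \<Longrightarrow> frag_of [x, x, z, w] \<in> N"
    and swap: "x \<in> Z \<Longrightarrow> y \<in> Z \<Longrightarrow> z \<in> Z \<Longrightarrow> w \<in> Z \<Longrightarrow>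
      frag_of [x, y, z, w] + frag_of [y, x, z, w] \<in> N"
    and jacobi: "x \<in> Z \<Longrightarrow> y \<in> Z \<Longrightarrow> z \<in> Z \<Longrightarrow> w \<in> Z \<Longrightarrow>
      frag_of [x, y, z, w] + frag_of [y, z, x, w] + frag_of [z, x, y, w] \<in> N"
    and last_two: "x \<in> Z \<Longrightarrow> y \<in> Z \<Longrightarrow> z \<in> Z \<Longrightarrow> w \<in> Z \<Longrightarrow>
      frag_of [x, y, z, w] - frag_of [x, y, w, z] + frag_of [z, w, x, y] - frag_of [z, w, y, x] \<in> N"
    and last_two_diag: "x \<in> Z \<Longrightarrow> y \<in> Z \<Longrightarrow> frag_of [x, y, x, y] - frag_of [x, y, y, x] \<in> N"
    and three_A: "x \<in> Z \<Longrightarrow> a \<in> Z \<Longrightarrow> b \<in> Z \<Longrightarrow> c \<in> Z \<Longrightarrow> A a \<Longrightarrow> A b \<Longrightarrow> A c \<Longrightarrow>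
      frag_of [x, a, b, c] \<in> N"
    and two_A: "x \<in> Z \<Longrightarrow> a \<in> Z \<Longrightarrow> y \<in> Z \<Longrightarrow> b \<in> Z \<Longrightarrow> A a \<Longrightarrow> A b \<Longrightarrow>
      frag_of [x, a, y, b] - frag_of [x, a, b, y] \<in> N"
begin

lemma three_A_any:
  assumes Z: "x \<in> Z" "y \<in> Z" "z \<in> Z" "w \<in> Z"
    and A: "A y \<and> A z \<and> A w \<or> A x \<and> A z \<and> A w \<or> A x \<and> A y \<and> A w \<or> A x \<and> A y \<and> A z"
  shows "frag_of [x, y, z, w] \<in> N"
proof -
  have 2: "frag_of [a, u, b, c] \<in> N"
    if "u \<in> Z" "a \<in> Z" "b \<in> Z" "c \<in> Z" "A a" "A b" "A c" for u a b c
  proof -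
    have "frag_of [a, u, b, c] = frag_of [a, u, b, c] + frag_of [u, a, b, c] - frag_of [u, a, b, c]"
      by simp
    also have "\<dots> \<in> N" using that by (intro diff_mem swap three_A)
    finally show ?thesis .
  qed
  have 3: "frag_of [a, b, u, c] \<in> N"
    if "u \<in> Z" "a \<in> Z" "b \<in> Z" "c \<in> Z" "A a" "A b" "A c" for u a b c
  proof -
    have "frag_of [a, b, u, c] = frag_of [a, b, u, c] + frag_of [b, u, a, c] + frag_of [u, a, b, c]
        - frag_of [b, u, a, c] - frag_of [u, a, b, c]" by simp
    also have "\<dots> \<in> N" using that by (intro diff_mem jacobi three_A 2)
    finally show ?thesis .
  qed
  have 4: "frag_of [a, b, c, u] \<in> N"
    if "u \<in> Z" "a \<in> Z" "b \<in> Z" "c \<in> Z" "A a" "A b" "A c" for u a b c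
  proof -
    have "frag_of [a, b, c, u] =
        (frag_of [a, b, c, u] - frag_of [a, b, u, c] + frag_of [c, u, a, b] - frag_of [c, u, b, a])
        + frag_of [a, b, u, c] - frag_of [c, u, a, b] + frag_of [c, u, b, a]" by simp
    also have "\<dots> \<in> N"
      using that by (intro add_mem[OF diff_mem[OF add_mem[OF last_two]]] 2 3)
    finally show ?thesis .
  qed
  from A show ?thesis
    by (elim disjE conjE) (use Z in \<open>simp_all add: 2 3 4 three_A\<close>)
qed

text \<open>
  Each of the six positions of the two letters of \<open>A\<close> leads to an explicit combination of relations.
\<close>
lemma retract4_two_A:
  assumes Z: "x \<in> Z" "y \<in> Z" "z \<in> Z" "w \<in> Z"
    and two: "length (filter A [x, y, z, w]) = 2"
  shows "frag_extend (retract4 A Z) (lie_polynomial [x, y, z, w]) - frag_of [x, y, z, w] \<in> N"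
proof -
  let ?\<psi> = "retract4 A Z"
  let ?E = "frag_extend ?\<psi> (lie_polynomial [x, y, z, w]) - frag_of [x, y, z, w]"
  have E: "?E = ?\<psi> [x, y, z, w] - ?\<psi> [y, x, z, w] - ?\<psi> [z, x, y, w] + ?\<psi> [z, y, x, w]
      - ?\<psi> [w, x, y, z] + ?\<psi> [w, y, x, z] + ?\<psi> [w, z, x, y] - ?\<psi> [w, z, y, x] - frag_of [x, y, z, w]"
    by (simp add: lie_expand)
  have ev: "?\<psi> [p, q, r, s] = (if A p \<and> A q \<and> \<not> A r \<and> \<not> A s then frag_of [r, q, p, s] else 0)"
    if "p \<in> Z" "q \<in> Z" "r \<in> Z" "s \<in> Z" "length (filter A [p, q, r, s]) = 2" for p q r s
    using that by (auto simp: retract4_def split: if_splits)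
  have evs: "?\<psi> [x, y, z, w] = (if A x \<and> A y \<and> \<not> A z \<and> \<not> A w then frag_of [z, y, x, w] else 0)"
    "?\<psi> [y, x, z, w] = (if A y \<and> A x \<and> \<not> A z \<and> \<not> A w then frag_of [z, x, y, w] else 0)"
    "?\<psi> [z, x, y, w] = (if A z \<and> A x \<and> \<not> A y \<and> \<not> A w then frag_of [y, x, z, w] else 0)"
    "?\<psi> [z, y, x, w] = (if A z \<and> A y \<and> \<not> A x \<and> \<not> A w then frag_of [x, y, z, w] else 0)"
    "?\<psi> [w, x, y, z] = (if A w \<and> A x \<and> \<not> A y \<and> \<not> A z then frag_of [y, x, w, z] else 0)"
    "?\<psi> [w, y, x, z] = (if A w \<and> A y \<and> \<not> A x \<and> \<not> A z then frag_of [x, y, w, z] else 0)"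
    "?\<psi> [w, z, x, y] = (if A w \<and> A z \<and> \<not> A x \<and> \<not> A y then frag_of [x, z, w, y] else 0)"
    "?\<psi> [w, z, y, x] = (if A w \<and> A z \<and> \<not> A y \<and> \<not> A x then frag_of [y, z, w, x] else 0)"
    by (rule ev; use Z two in \<open>simp split: if_splits\<close>)+
  consider "A x" "\<not> A y" "A z" "\<not> A w" | "A x" "\<not> A y" "\<not> A z" "A w" | "\<not> A x" "A y" "A z" "\<not> A w"
    | "\<not> A x" "A y" "\<not> A z" "A w" | "A x" "A y" "\<not> A z" "\<not> A w" | "\<not> A x" "\<not> A y" "A z" "A w"
    using two by (auto split: if_splits)
  then show ?thesis
  proof cases
    case 1
    then have "?E = - (frag_of [x, y, z, w] + frag_of [y, x, z, w])" unfolding E evs by simp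
    also have "\<dots> \<in> N" by (intro minus_mem swap Z)
    finally show ?thesis .
  next
    case 2
    then have "?E = (frag_of [y, x, z, w] - frag_of [y, x, w, z])
        - (frag_of [x, y, z, w] + frag_of [y, x, z, w])"
      unfolding E evs by simp
    also have "\<dots> \<in> N" by (intro diff_mem two_A swap Z 2)
    finally show ?thesis .
  next
    case 3
    then have "?E = 0" unfolding E evs by simp
    then show ?thesis using zero_mem by simp
  next
    case 4
    then have "?E = - (frag_of [x, y, z, w] - frag_of [x, y, w, z])" unfolding E evs by simp
    also have "\<dots> \<in> N" by (intro minus_mem two_A Z 4)
    finally show ?thesis .
  next
    case 5
    then have "?E = (frag_of [y, z, x, w] + frag_of [z, y, x, w])
        - (frag_of [x, y, z, w] + frag_of [y, z, x, w] + frag_of [z, x, y, w])" unfolding E evs by simp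
    also have "\<dots> \<in> N" by (intro diff_mem swap jacobi Z)
    finally show ?thesis .
  next
    case 6
    then have "?E = (frag_of [z, x, y, w] + frag_of [x, z, y, w])
        - (frag_of [x, z, y, w] - frag_of [x, z, w, y]) + (frag_of [y, z, x, w] - frag_of [y, z, w, x])
        - (frag_of [x, y, z, w] + frag_of [y, z, x, w] + frag_of [z, x, y, w])" unfolding E evs by simp
    also have "\<dots> \<in> N" by (intro diff_mem[OF add_mem[OF diff_mem]] swap two_A jacobi Z 6)
    finally show ?thesis .
  qed
qed

text \<open>
  Only the words of the Lie polynomial that begin with the distinguished letter \<open>c\<close> contribute. If \<open>c\<close>
  is the first, second, third or last letter of the bracket, there are 1, 1, 2 or 4 of them, and they
  rewrite the bracket as a combination of brackets beginning with \<open>c\<close>.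
\<close>
lemma retract4_distinguished:
  assumes Z: "x \<in> Z" "y \<in> Z" "z \<in> Z" "w \<in> Z"
    and one: "length (filter A [x, y, z, w]) \<le> 1"
    and ex: "distinguished A {#x, y, z, w#} c0"
  shows "frag_extend (retract4 A Z) (lie_polynomial [x, y, z, w]) - frag_of [x, y, z, w] \<in> N"
proof -
  let ?\<psi> = "retract4 A Z" and ?M = "{#x, y, z, w#}"
  let ?E = "frag_extend ?\<psi> (lie_polynomial [x, y, z, w]) - frag_of [x, y, z, w]"
  have E: "?E = ?\<psi> [x, y, z, w] - ?\<psi> [y, x, z, w] - ?\<psi> [z, x, y, w] + ?\<psi> [z, y, x, w]
      - ?\<psi> [w, x, y, z] + ?\<psi> [w, y, x, z] + ?\<psi> [w, z, x, y] - ?\<psi> [w, z, y, x] - frag_of [x, y, z, w]"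
    by (simp add: lie_expand)
  define c where "c = chosen A ?M"
  have d: "distinguished A ?M c" unfolding c_def by (rule distinguished_chosen[OF ex])
  have cnt: "count ?M c = 1" and cA: "A c \<or> \<not> A x \<and> \<not> A y \<and> \<not> A z \<and> \<not> A w"
    using d by (auto simp: distinguished_def)
  have ev: "?\<psi> [p, q, r, s] = (if p = c then frag_of [p, q, r, s] else 0)"
    if M: "{#p, q, r, s#} = ?M" for p q r s
  proof -
    have st: "{p, q, r, s} = {x, y, z, w}" using arg_cong[OF M, of set_mset] by simp
    then have Z': "p \<in> Z" "q \<in> Z" "r \<in> Z" "s \<in> Z" using Z by auto
    have "size (filter_mset A {#p, q, r, s#}) \<le> 1"
      unfolding M using one by (auto split: if_splits)
    then have le: "\<not> (A p \<and> A q)" "\<not> (A p \<and> A r)" "\<not> (A p \<and> A s)"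
      by (auto split: if_splits)
    have ms: "mset [p, q, r, s] = ?M" using M by simp
    have unf: "?\<psi> [p, q, r, s] = (if A r \<or> A s then 0 else if A q then (if A p then frag_of [r, q, p, s] else 0)
        else if p = c then frag_of [p, q, r, s] else 0)"
      unfolding retract4_eq[OF Z' ms] c_def[symmetric] using d by auto
    show ?thesis
    proof (cases "A c")
      case True
      then have "p = c \<Longrightarrow> \<not> A q \<and> \<not> A r \<and> \<not> A s" using le by blast
      then show ?thesis using le unfolding unf by auto
    next
      case False
      then have "\<not> A q \<and> \<not> A r \<and> \<not> A s" using cA st by auto
      then show ?thesis unfolding unf by simp
    qed
  qed
  have evs: "?\<psi> [x, y, z, w] = (if x = c then frag_of [x, y, z, w] else 0)"
    "?\<psi> [y, x, z, w] = (if y = c then frag_of [y, x, z, w] else 0)"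
    "?\<psi> [z, x, y, w] = (if z = c then frag_of [z, x, y, w] else 0)"
    "?\<psi> [z, y, x, w] = (if z = c then frag_of [z, y, x, w] else 0)"
    "?\<psi> [w, x, y, z] = (if w = c then frag_of [w, x, y, z] else 0)"
    "?\<psi> [w, y, x, z] = (if w = c then frag_of [w, y, x, z] else 0)"
    "?\<psi> [w, z, x, y] = (if w = c then frag_of [w, z, x, y] else 0)"
    "?\<psi> [w, z, y, x] = (if w = c then frag_of [w, z, y, x] else 0)"
    by (rule ev; simp add: add_mset_commute)+
  have "c = x \<or> c = y \<or> c = z \<or> c = w" using cnt by (auto split: if_splits)
  then consider "x = c" "y \<noteq> c" "z \<noteq> c" "w \<noteq> c" | "x \<noteq> c" "y = c" "z \<noteq> c" "w \<noteq> c"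
    | "x \<noteq> c" "y \<noteq> c" "z = c" "w \<noteq> c" | "x \<noteq> c" "y \<noteq> c" "z \<noteq> c" "w = c"
    using cnt by (auto split: if_splits)
  then show ?thesis
  proof cases
    case 1
    have "?E = 0" unfolding E evs if_P[OF 1(1)] if_not_P[OF 1(2)] if_not_P[OF 1(3)] if_not_P[OF 1(4)] by simp
    then show ?thesis using zero_mem by simp
  next
    case 2
    have "?E = - (frag_of [x, y, z, w] + frag_of [y, x, z, w])"
      unfolding E evs if_P[OF 2(2)] if_not_P[OF 2(1)] if_not_P[OF 2(3)] if_not_P[OF 2(4)] by simp
    also have "\<dots> \<in> N" by (intro minus_mem swap Z)
    finally show ?thesis .
  next
    case 3
    have "?E = (frag_of [y, z, x, w] + frag_of [z, y, x, w])
        - (frag_of [x, y, z, w] + frag_of [y, z, x, w] + frag_of [z, x, y, w])"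
      unfolding E evs if_P[OF 3(3)] if_not_P[OF 3(1)] if_not_P[OF 3(2)] if_not_P[OF 3(4)] by simp
    also have "\<dots> \<in> N" by (intro diff_mem swap jacobi Z)
    finally show ?thesis .
  next
    case 4
    have "?E = (frag_of [w, z, x, y] + frag_of [z, w, x, y]) - (frag_of [w, z, y, x] + frag_of [z, w, y, x])
        + (frag_of [y, w, x, z] + frag_of [w, y, x, z])
        - (frag_of [x, y, w, z] + frag_of [y, w, x, z] + frag_of [w, x, y, z])
        - (frag_of [x, y, z, w] - frag_of [x, y, w, z] + frag_of [z, w, x, y] - frag_of [z, w, y, x])"
      unfolding E evs if_P[OF 4(4)] if_not_P[OF 4(1)] if_not_P[OF 4(2)] if_not_P[OF 4(3)] by simp
    also have "\<dots> \<in> N"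
      by (intro diff_mem[OF diff_mem[OF add_mem[OF diff_mem]]] swap jacobi last_two Z)
    finally show ?thesis .
  qed
qed

text \<open>
  Here \<open>[x, y, x, y] = [x, y, y, x]\<close> has to be a relation of its own: exchanging the pairs in
  \<open>[[x, y], [z, w]]\<close> only gives twice that relation.
\<close>
lemma retract4_two_squares:
  assumes Z: "x \<in> Z" "y \<in> Z" and A: "\<not> A x" "\<not> A y" and ne: "x \<noteq> y"
  shows "frag_extend (retract4 A Z) (lie_polynomial [x, y, x, y]) - frag_of [x, y, x, y] \<in> N"
    and "frag_extend (retract4 A Z) (lie_polynomial [x, y, y, x]) - frag_of [x, y, y, x] \<in> N"
proof -
  let ?\<psi> = "retract4 A Z" and ?M = "{#x, x, y, y#}"
  define c where "c = (SOME u. u \<in># ?M)"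
  have "c \<in># ?M" unfolding c_def by (rule someI[of _ x]) simp
  then have c: "c = x \<or> c = y" by auto
  have nd: "\<not> distinguished A ?M u" for u by (auto simp: distinguished_def)
  have ev: "?\<psi> [p, q, r, s] = (if p = q \<and> r = s \<and> p \<noteq> r \<and> p = c then frag_of [r, p, p, r] else 0)"
    if M: "{#p, q, r, s#} = ?M" for p q r s
  proof -
    have st: "{p, q, r, s} = {x, y}" using arg_cong[OF M, of set_mset] by auto
    then have Z': "p \<in> Z" "q \<in> Z" "r \<in> Z" "s \<in> Z" and A': "\<not> A q" "\<not> A r" "\<not> A s" using Z A by auto
    have ms: "mset [p, q, r, s] = ?M" using M by simp
    show ?thesis unfolding retract4_eq[OF Z' ms] c_def[symmetric] using A' nd by auto
  qed
  have evs: "?\<psi> [x, y, x, y] = 0" "?\<psi> [y, x, x, y] = 0" "?\<psi> [x, x, y, y] = (if x = c then frag_of [y, x, x, y] else 0)"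
    "?\<psi> [x, y, y, x] = 0" "?\<psi> [y, x, y, x] = 0" "?\<psi> [y, y, x, x] = (if y = c then frag_of [x, y, y, x] else 0)"
    using ne by (subst ev; simp add: add_mset_commute)+
  have E1: "frag_extend ?\<psi> (lie_polynomial [x, y, x, y]) - frag_of [x, y, x, y] =
      (if y = c then frag_of [x, y, y, x] else 0) - (if x = c then frag_of [y, x, x, y] else 0) - frag_of [x, y, x, y]"
    by (simp add: lie_expand evs)
  have E2: "frag_extend ?\<psi> (lie_polynomial [x, y, y, x]) - frag_of [x, y, y, x] =
      (if y = c then frag_of [x, y, y, x] else 0) - (if x = c then frag_of [y, x, x, y] else 0) - frag_of [x, y, y, x]"
    by (simp add: lie_expand evs)
  have b: "frag_of [x, y, x, y] - frag_of [x, y, y, x] \<in> N" by (rule last_two_diag[OF Z])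
  have "- frag_of [y, x, x, y] - frag_of [x, y, x, y] = - (frag_of [x, y, x, y] + frag_of [y, x, x, y])"
    by simp
  also have "\<dots> \<in> N" by (intro minus_mem swap Z)
  finally have a1: "- frag_of [y, x, x, y] - frag_of [x, y, x, y] \<in> N" .
  have "- frag_of [y, x, x, y] - frag_of [x, y, y, x] =
      (- frag_of [y, x, x, y] - frag_of [x, y, x, y]) + (frag_of [x, y, x, y] - frag_of [x, y, y, x])"
    by simp
  also have "\<dots> \<in> N" by (rule add_mem[OF a1 b])
  finally have a2: "- frag_of [y, x, x, y] - frag_of [x, y, y, x] \<in> N" .
  show "frag_extend ?\<psi> (lie_polynomial [x, y, x, y]) - frag_of [x, y, x, y] \<in> N"
    unfolding E1 using c ne a1 minus_mem[OF b] by auto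
  show "frag_extend ?\<psi> (lie_polynomial [x, y, y, x]) - frag_of [x, y, y, x] \<in> N"
    unfolding E2 using c ne a2 zero_mem by auto
qed

lemma retract4:
  assumes Z: "x \<in> Z" "y \<in> Z" "z \<in> Z" "w \<in> Z"
  shows "frag_extend (retract4 A Z) (lie_polynomial [x, y, z, w]) - frag_of [x, y, z, w] \<in> N"
proof -
  let ?\<psi> = "retract4 A Z" and ?n = "length (filter A [x, y, z, w])"
  let ?E = "frag_extend ?\<psi> (lie_polynomial [x, y, z, w]) - frag_of [x, y, z, w]"
  have "3 \<le> ?n \<or> ?n = 2 \<or> ?n \<le> 1" by linarith
  then consider "x = y" | "3 \<le> ?n" | "?n = 2" | c where "?n \<le> 1" "distinguished A {#x, y, z, w#} c"
    | "x \<noteq> y" "?n \<le> 1" "\<forall>c. \<not> distinguished A {#x, y, z, w#} c" by blast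
  then show ?thesis
  proof cases
    case 1
    then have "?E = - frag_of [x, x, z, w]" by (simp add: lie_expand)
    then show ?thesis using minus_mem[OF diag[OF Z(1,3,4)]] by simp
  next
    case 2
    then have A: "A y \<and> A z \<and> A w \<or> A x \<and> A z \<and> A w \<or> A x \<and> A y \<and> A w \<or> A x \<and> A y \<and> A z"
      by (auto split: if_splits)
    have ev: "?\<psi> [p, q, r, s] = 0" if "3 \<le> length (filter A [p, q, r, s])" for p q r s
    proof -
      have "A r \<or> A s" using that by (auto split: if_splits)
      then show ?thesis by (auto simp: retract4_def Let_def)
    qed
    have "?\<psi> [x, y, z, w] = 0" "?\<psi> [y, x, z, w] = 0" "?\<psi> [z, x, y, w] = 0" "?\<psi> [z, y, x, w] = 0"
      "?\<psi> [w, x, y, z] = 0" "?\<psi> [w, y, x, z] = 0" "?\<psi> [w, z, x, y] = 0" "?\<psi> [w, z, y, x] = 0"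
      by (rule ev; use 2 in \<open>simp split: if_splits\<close>)+
    then have "?E = - frag_of [x, y, z, w]" by (simp add: lie_expand)
    then show ?thesis using minus_mem[OF three_A_any[OF Z A]] by simp
  next
    case 3
    then show ?thesis by (rule retract4_two_A[OF Z])
  next
    case 4
    then show ?thesis by (rule retract4_distinguished[OF Z])
  next
    case 5
    have nA: "\<not> A x \<and> \<not> A y \<and> \<not> A z \<and> \<not> A w"
    proof (rule ccontr)
      assume "\<not> ?thesis"
      then have "distinguished A {#x, y, z, w#} x \<or> distinguished A {#x, y, z, w#} y \<or>
          distinguished A {#x, y, z, w#} z \<or> distinguished A {#x, y, z, w#} w"
        using 5(2) by (auto simp: distinguished_def split: if_splits)
      then show False using 5 by blast
    qed
    have "count {#x, y, z, w#} x \<noteq> 1" "count {#x, y, z, w#} y \<noteq> 1"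
      using spec[OF 5(3), of x] spec[OF 5(3), of y] nA unfolding distinguished_def by auto
    then have "z = x \<and> w = y \<or> z = y \<and> w = x" using 5(1) by (auto split: if_splits)
    then show ?thesis using retract4_two_squares[OF Z(1,2) _ _ 5(1)] nA by auto
  qed
qed

end

section \<open>Leading forms of the Magnus representation\<close>

definition vanishes_below :: "nat \<Rightarrow> ('z list \<Rightarrow> int) \<Rightarrow> bool" where
  "vanishes_below n f \<longleftrightarrow> (\<forall>w. w \<noteq> [] \<and> length w < n \<longrightarrow> f w = 0)"

lemma vanishes_belowD: "vanishes_below n f \<Longrightarrow> w \<noteq> [] \<Longrightarrow> length w < n \<Longrightarrow> f w = 0"
  by (simp add: vanishes_below_def)

text \<open>
  A product of \<open>1 + f\<^sub>m + \<dots>\<close> and \<open>1 + g\<^sub>n + \<dots>\<close> has no mixed terms below degree \<open>m + n\<close>, and the single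
  mixed term \<open>f\<^sub>m g\<^sub>n\<close> in that degree.
\<close>
lemma convolution_low_degree:
  fixes f g :: "'z list \<Rightarrow> int"
  assumes f: "f [] = 1" "vanishes_below m f" and g: "g [] = 1" "vanishes_below n g"
    and mn: "0 < m" "0 < n" and w: "w \<noteq> []" "length w \<le> m + n"
  shows "convolution f g w = f w + g w +
    (if length w = m + n then f (take m w) * g (drop m w) else 0)"
proof -
  let ?N = "length w" and ?t = "\<lambda>i. f (take i w) * g (drop i w)"
  have "{..?N} = insert 0 (insert ?N {0<..<?N})" using w(1) by auto
  then have "convolution f g w = ?t 0 + (?t ?N + sum ?t {0<..<?N})"
    using w(1) by (simp add: convolution_eq_sum)
  also have "sum ?t {0<..<?N} = (\<Sum>i\<in>{0<..<?N}. if i = m then (if ?N = m + n then ?t m else 0) else 0)"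
  proof (rule sum.cong[OF refl])
    fix i assume i: "i \<in> {0<..<?N}"
    have "f (take i w) = 0" if "i < m"
      using i that by (intro vanishes_belowD[OF f(2)]) auto
    moreover have "g (drop i w) = 0" if "?N - i < n"
      using i that by (intro vanishes_belowD[OF g(2)]) auto
    ultimately show "?t i = (if i = m then (if ?N = m + n then ?t m else 0) else 0)"
      using w(2) i by (cases "i < m"; cases "?N - i < n") auto
  qed
  also have "\<dots> = (if ?N = m + n then ?t m else 0)"
    using mn by (auto simp: sum.delta)
  finally show ?thesis using f(1) g(1) by simp
qed

lemma lookup_frag_extend_inj:
  assumes "inj f"
  shows "lookup (frag_extend (\<lambda>u. frag_of (f u)) v) (f x) = lookup v x"
proof -
  have "lookup (frag_extend (\<lambda>u. frag_of (f u)) v) (f x) =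
      (\<Sum>u\<in>keys v. if u = x then lookup v u else 0)"
    unfolding lookup_frag_extend_sum using injD[OF assms] by (intro sum.cong) auto
  also have "\<dots> = lookup v x" by (simp add: sum.delta in_keys_iff)
  finally show ?thesis .
qed

lemma lookup_frag_extend_outside:
  assumes "y \<notin> range f"
  shows "lookup (frag_extend (\<lambda>u. frag_of (f u)) v) y = 0"
  unfolding lookup_frag_extend_sum by (rule sum.neutral) (use assms in auto)

lemma lie_polynomial_snoc:
  "w \<noteq> [] \<Longrightarrow> lie_polynomial (w @ [y]) =
     frag_extend (\<lambda>u. frag_of (u @ [y])) (lie_polynomial w) - frag_extend (\<lambda>u. frag_of (y # u)) (lie_polynomial w)"
  by (cases w) (simp_all add: lie_polynomial_def)

lemma lookup_lie_polynomial_snoc: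
  assumes "w \<noteq> []" "u \<noteq> []"
  shows "lookup (lie_polynomial (w @ [y])) u =
     (if last u = y then lookup (lie_polynomial w) (butlast u) else 0)
     - (if hd u = y then lookup (lie_polynomial w) (tl u) else 0)"
proof -
  have "lookup (frag_extend (\<lambda>u. frag_of (u @ [y])) v) u =
      (if last u = y then lookup v (butlast u) else 0)" for v
  proof (cases "last u = y")
    case True
    then have "u = butlast u @ [y]" using assms(2) by (metis append_butlast_last_id)
    then show ?thesis
      using True lookup_frag_extend_inj[of "\<lambda>u. u @ [y]" v "butlast u"] by (simp add: inj_def)
  next
    case False
    then show ?thesis by (subst lookup_frag_extend_outside) auto
  qed
  moreover have "lookup (frag_extend (\<lambda>u. frag_of (y # u)) v) u =
      (if hd u = y then lookup v (tl u) else 0)" for v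
  proof (cases "hd u = y")
    case True
    then have "u = y # tl u" using assms(2) by (metis list.collapse)
    then show ?thesis
      using True lookup_frag_extend_inj[of "\<lambda>u. y # u" v "tl u"] by (simp add: inj_def)
  next
    case False
    then show ?thesis by (subst lookup_frag_extend_outside) auto
  qed
  ultimately show ?thesis
    by (simp add: lie_polynomial_snoc[OF assms(1)] lookup_minus)
qed

lemma keys_lie_polynomial: "w \<noteq> [] \<Longrightarrow> u \<in> keys (lie_polynomial w) \<Longrightarrow> length u = length w"
proof (induction w arbitrary: u rule: rev_induct)
  case (snoc y w)
  show ?case
  proof (cases "w = []")
    case True
    then show ?thesis using snoc.prems by (simp add: lie_polynomial_def keys_frag_of)
  next
    case False
    have "u \<in> keys (frag_extend (\<lambda>u. frag_of (u @ [y])) (lie_polynomial w)) \<union>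
        keys (frag_extend (\<lambda>u. frag_of (y # u)) (lie_polynomial w))"
      by (rule subsetD[OF keys_diff snoc.prems(2)[unfolded lie_polynomial_snoc[OF False]]])
    also have "\<dots> \<subseteq> (\<lambda>u. u @ [y]) ` keys (lie_polynomial w) \<union> (#) y ` keys (lie_polynomial w)"
      using keys_frag_extend[of "\<lambda>u. frag_of (u @ [y])" "lie_polynomial w"]
        keys_frag_extend[of "\<lambda>u. frag_of (y # u)" "lie_polynomial w"]
      by (intro Un_mono) (auto simp: keys_frag_of)
    finally obtain v where "v \<in> keys (lie_polynomial w)" "u = v @ [y] \<or> u = y # v"
      by blast
    then show ?thesis using snoc.IH[OF False, of v] by auto
  qed
qed simp

locale magnus_representation = lower_central_series F R for F :: "('a, 'm) monoid_scheme" (structure) and R +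
  fixes \<mu> :: "'a \<Rightarrow> 'z list \<Rightarrow> int"
  assumes \<mu>_mult: "r \<in> R \<Longrightarrow> s \<in> R \<Longrightarrow> \<mu> (r \<otimes> s) = convolution (\<mu> r) (\<mu> s)"
    and \<mu>_Nil: "r \<in> R \<Longrightarrow> \<mu> r [] = 1"
    and \<mu>_linear_finite: "r \<in> R \<Longrightarrow> finite {z. \<mu> r [z] \<noteq> 0}"
begin

lemma R_subgroup: "subgroup R F"
  by (rule normal_imp_subgroup[OF R_normal])

lemmas R_closed = subgroup.m_closed[OF R_subgroup] subgroup.m_inv_closed[OF R_subgroup]
  subgroup.one_closed[OF R_subgroup]

lemma comm_R: "x \<in> R \<Longrightarrow> y \<in> R \<Longrightarrow> comm F x y \<in> R"
  by (simp add: comm_def R_closed)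

lemma \<Gamma>_in_R: "x \<in> \<Gamma> n \<Longrightarrow> x \<in> R"
  using \<Gamma>_antimono[of 0 n] by auto

lemma \<mu>_mult_low:
  assumes "r \<in> R" "s \<in> R" "vanishes_below n (\<mu> r)" "vanishes_below n (\<mu> s)" "w \<noteq> []" "length w \<le> n"
  shows "\<mu> (r \<otimes> s) w = \<mu> r w + \<mu> s w"
proof -
  have "0 < n" using assms(5,6) by (cases w) auto
  then show ?thesis
    using convolution_low_degree[of "\<mu> r" n "\<mu> s" n w] assms \<mu>_Nil \<mu>_mult by auto
qed

lemma vanishes_below_length: "(\<And>u. u \<noteq> [] \<Longrightarrow> length u < n \<Longrightarrow> f u = 0) \<Longrightarrow> vanishes_below n f"
  by (simp add: vanishes_below_def)

lemma \<mu>_one: "w \<noteq> [] \<Longrightarrow> \<mu> \<one> w = 0"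
proof (induction w rule: length_induct)
  case (1 w)
  then have "vanishes_below (length w) (\<mu> \<one>)" by (simp add: vanishes_below_def)
  then show ?case using \<mu>_mult_low[of \<one> \<one> "length w" w] 1 R_closed by simp
qed

lemma \<mu>_inv_low:
  assumes r: "r \<in> R" "vanishes_below n (\<mu> r)" and w: "w \<noteq> []" "length w \<le> n"
  shows "\<mu> (inv r) w = - \<mu> r w"
  using w
proof (induction w rule: length_induct)
  case (1 w)
  have "vanishes_below (length w) (\<mu> (inv r))"
  proof (rule vanishes_below_length)
    fix u :: "'z list" assume u: "u \<noteq> []" "length u < length w"
    then have "\<mu> (inv r) u = - \<mu> r u" using 1 by simp
    then show "\<mu> (inv r) u = 0" using vanishes_belowD[OF r(2) u(1)] u(2) 1(3) by simp
  qed
  moreover have "vanishes_below (length w) (\<mu> r)"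
    using r(2) 1(3) by (auto simp: vanishes_below_def)
  ultimately have "\<mu> (r \<otimes> inv r) w = \<mu> r w + \<mu> (inv r) w"
    using \<mu>_mult_low[of r "inv r" "length w" w] r(1) 1(2) R_closed by simp
  then show ?case using \<mu>_one[OF 1(2)] r(1) R_carrier by simp
qed

text \<open>
  Compare coefficients of degree at most \<open>m + n\<close> in \<open>[x, y] y x = x y\<close>: the leading form of a commutator
  is the Lie bracket of the leading forms.
\<close>
lemma \<mu>_comm:
  assumes x: "x \<in> R" "vanishes_below m (\<mu> x)" and y: "y \<in> R" "vanishes_below n (\<mu> y)"
    and mn: "0 < m" "0 < n"
  shows "vanishes_below (m + n) (\<mu> (comm F x y))"
    and "length w = m + n \<Longrightarrow> \<mu> (comm F x y) w =
      \<mu> x (take m w) * \<mu> y (drop m w) - \<mu> y (take n w) * \<mu> x (drop n w)"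
proof -
  have low: "\<mu> (r \<otimes> s) w = \<mu> r w + \<mu> s w + (if length w = p + q then \<mu> r (take p w) * \<mu> s (drop p w) else 0)"
    if "r \<in> R" "s \<in> R" "vanishes_below p (\<mu> r)" "vanishes_below q (\<mu> s)" "0 < p" "0 < q"
      "w \<noteq> []" "length w \<le> p + q" for r s p q w
    using convolution_low_degree[of "\<mu> r" p "\<mu> s" q w] that \<mu>_Nil \<mu>_mult by simp
  let ?c = "comm F x y"
  have cR: "?c \<in> R" and yx: "y \<otimes> x \<in> R" using comm_R x y R_closed by auto
  have eq: "?c \<otimes> (y \<otimes> x) = x \<otimes> y" using x y R_carrier by (simp add: expand_comm)
  have main: "\<mu> ?c w = (if length w = m + n then
      \<mu> x (take m w) * \<mu> y (drop m w) - \<mu> y (take n w) * \<mu> x (drop n w) else 0)"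
    if "w \<noteq> []" "length w \<le> m + n" for w
    using that
  proof (induction w rule: length_induct)
    case (1 w)
    have v: "vanishes_below (length w) (\<mu> ?c)"
      using 1 by (intro vanishes_below_length) auto
    have v1: "vanishes_below 1 (\<mu> (y \<otimes> x))" by (auto simp: vanishes_below_def)
    have "\<mu> (x \<otimes> y) w = \<mu> ?c w + \<mu> (y \<otimes> x) w"
      using low[OF cR yx v v1, of w] 1(2) by (simp add: eq)
    then show ?case
      using low[OF x(1) y(1) x(2) y(2) mn 1(2,3)] low[OF y(1) x(1) y(2) x(2) mn(2,1) 1(2)] 1(3)
      by (auto simp: add.commute)
  qed
  show "vanishes_below (m + n) (\<mu> ?c)"
    by (rule vanishes_below_length) (simp add: main)
  show "\<mu> ?c w = \<mu> x (take m w) * \<mu> y (drop m w) - \<mu> y (take n w) * \<mu> x (drop n w)"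
    if "length w = m + n"
  proof -
    have "w \<noteq> []" using that mn by auto
    then show ?thesis using main[of w] that by simp
  qed
qed

definition leading_in :: "nat \<Rightarrow> ('z list \<Rightarrow> bool) \<Rightarrow> 'a set" where
  "leading_in n P = {x \<in> R. vanishes_below n (\<mu> x) \<and> (\<forall>w. length w = n \<and> \<mu> x w \<noteq> 0 \<longrightarrow> P w)}"

text \<open>
  On series without terms of degree strictly between 0 and \<open>n\<close> the coefficients of degree \<open>n\<close> are additive, so
  every additive condition \<open>Q\<close> on them cuts out a subgroup. It is used for conditions on the support and
  for its finiteness.
\<close>
lemma subgroup_of_leading:
  assumes n: "0 < n" and Q0: "Q (\<lambda>w. 0)"
    and Qadd: "\<And>f g. Q f \<Longrightarrow> Q g \<Longrightarrow> Q (\<lambda>w. f w + g w)" and Qneg: "\<And>f. Q f \<Longrightarrow> Q (\<lambda>w. - f w)"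
  shows "subgroup {x \<in> R. vanishes_below n (\<mu> x) \<and> Q (\<lambda>w. if length w = n then \<mu> x w else 0)} F"
    (is "subgroup ?H F")
proof (rule subgroupI)
  have "(\<lambda>w. if length w = n then \<mu> \<one> w else 0) = (\<lambda>w. 0)" using n by (auto intro!: \<mu>_one)
  then have "\<one> \<in> ?H" using \<mu>_one Q0 R_closed by (simp add: vanishes_below_def)
  then show "?H \<noteq> {}" by blast
  fix a assume a: "a \<in> ?H"
  have "(\<lambda>w. if length w = n then \<mu> (inv a) w else 0) = (\<lambda>w. - (if length w = n then \<mu> a w else 0))"
    using \<mu>_inv_low[of a n] a n by (auto simp: fun_eq_iff)
  moreover have "vanishes_below n (\<mu> (inv a))"
    using \<mu>_inv_low[of a n] a by (auto simp: vanishes_below_def)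
  ultimately show "inv a \<in> ?H" using a Qneg R_closed by simp
next
  fix a b assume ab: "a \<in> ?H" "b \<in> ?H"
  have "(\<lambda>w. if length w = n then \<mu> (a \<otimes> b) w else 0) =
      (\<lambda>w. (if length w = n then \<mu> a w else 0) + (if length w = n then \<mu> b w else 0))"
    using \<mu>_mult_low[of a b n] ab n by (auto simp: fun_eq_iff)
  moreover have "vanishes_below n (\<mu> (a \<otimes> b))"
    using \<mu>_mult_low[of a b n] ab by (auto simp: vanishes_below_def)
  ultimately show "a \<otimes> b \<in> ?H" using ab Qadd R_closed by simp
qed (use R_carrier in auto)

lemma leading_in_subgroup: "0 < n \<Longrightarrow> subgroup (leading_in n P) F"
proof -
  assume n: "0 < n"
  have "leading_in n P = {x \<in> R. vanishes_below n (\<mu> x) \<and>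
      (\<lambda>f. \<forall>w. f w \<noteq> 0 \<longrightarrow> P w) (\<lambda>w. if length w = n then \<mu> x w else 0)}"
    by (auto simp: leading_in_def)
  also have "subgroup \<dots> F"
  proof (rule subgroup_of_leading[OF n])
    fix f g :: "'z list \<Rightarrow> int"
    assume "\<forall>w. f w \<noteq> 0 \<longrightarrow> P w" "\<forall>w. g w \<noteq> 0 \<longrightarrow> P w"
    then show "\<forall>w. f w + g w \<noteq> 0 \<longrightarrow> P w" by (metis add.right_neutral)
  qed auto
  finally show ?thesis .
qed

lemma leading_in_mono: "(\<And>w. length w = n \<Longrightarrow> P w \<Longrightarrow> Q w) \<Longrightarrow> leading_in n P \<subseteq> leading_in n Q"
  by (auto simp: leading_in_def)

lemma leading_in_deeper: "vanishes_below m (\<mu> x) \<Longrightarrow> x \<in> R \<Longrightarrow> 0 < n \<Longrightarrow> n < m \<Longrightarrow> x \<in> leading_in n P"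
  unfolding leading_in_def vanishes_below_def by fastforce

lemma leading_in_commutator:
  assumes A: "A \<subseteq> leading_in m P" and B: "B \<subseteq> leading_in n Q" and mn: "0 < m" "0 < n"
  shows "commutator_subgroup F A B \<subseteq>
    leading_in (m + n) (\<lambda>w. P (take m w) \<and> Q (drop m w) \<or> Q (take n w) \<and> P (drop n w))"
proof (rule commutator_subgroup_least)
  show "subgroup (leading_in (m + n) (\<lambda>w. P (take m w) \<and> Q (drop m w) \<or> Q (take n w) \<and> P (drop n w))) F"
    using mn by (simp add: leading_in_subgroup)
  fix a b assume "a \<in> A" "b \<in> B"
  then have a: "a \<in> R" "vanishes_below m (\<mu> a)" "\<And>w. length w = m \<Longrightarrow> \<mu> a w \<noteq> 0 \<Longrightarrow> P w"
    and b: "b \<in> R" "vanishes_below n (\<mu> b)" "\<And>w. length w = n \<Longrightarrow> \<mu> b w \<noteq> 0 \<Longrightarrow> Q w"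
    using A B by (auto simp: leading_in_def)
  have "P (take m w) \<and> Q (drop m w) \<or> Q (take n w) \<and> P (drop n w)"
    if "length w = m + n" "\<mu> (comm F a b) w \<noteq> 0" for w
  proof -
    have "\<mu> a (take m w) * \<mu> b (drop m w) \<noteq> 0 \<or> \<mu> b (take n w) * \<mu> a (drop n w) \<noteq> 0"
      using \<mu>_comm(2)[OF a(1,2) b(1,2) mn that(1)] that(2) by auto
    then show ?thesis using a(3) b(3) that(1) by auto
  qed
  then show "comm F a b \<in> leading_in (m + n) (\<lambda>w. P (take m w) \<and> Q (drop m w) \<or> Q (take n w) \<and> P (drop n w))"
    using \<mu>_comm(1)[OF a(1,2) b(1,2) mn] comm_R a(1) b(1) by (simp add: leading_in_def)
qed

lemma \<Gamma>_leading: "0 < n \<Longrightarrow> \<Gamma> n \<subseteq> leading_in n (\<lambda>w. True)"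
proof (induction n rule: nat_induct_non_zero)
  case 1
  then show ?case by (auto simp: leading_in_def vanishes_below_def)
next
  case (Suc n)
  have "R \<subseteq> leading_in 1 (\<lambda>w. True)" by (auto simp: leading_in_def vanishes_below_def)
  then show ?case
    using leading_in_commutator[OF Suc.IH, of R 1 "\<lambda>w. True"] Suc.hyps by (simp add: \<Gamma>_Suc)
qed

lemma vanishes_\<Gamma>: "0 < n \<Longrightarrow> x \<in> \<Gamma> n \<Longrightarrow> vanishes_below n (\<mu> x)"
  using \<Gamma>_leading by (auto simp: leading_in_def)

text \<open>
  The power series \<open>\<mu> x\<close> may have infinitely many terms in a degree; the leading form is nevertheless a
  polynomial, because it is built from linear parts by brackets and sums.
\<close>
lemma \<Gamma>_finite_leading: "0 < n \<Longrightarrow> x \<in> \<Gamma> n \<Longrightarrow> finite {w. length w = n \<and> \<mu> x w \<noteq> 0}"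
proof (induction n arbitrary: x rule: nat_induct_non_zero)
  case 1
  have "{w. length w = 1 \<and> \<mu> x w \<noteq> 0} = (\<lambda>z. [z]) ` {z. \<mu> x [z] \<noteq> 0}"
    by (auto simp: length_Suc_conv)
  then show ?case using \<mu>_linear_finite[of x] 1 by simp
next
  case (Suc n)
  let ?Q = "\<lambda>f. finite {w. f w \<noteq> (0::int)}"
  let ?H = "{x \<in> R. vanishes_below (Suc n) (\<mu> x) \<and> ?Q (\<lambda>w. if length w = Suc n then \<mu> x w else 0)}"
  have "subgroup ?H F"
  proof (rule subgroup_of_leading)
    fix f g :: "'z list \<Rightarrow> int" assume "?Q f" "?Q g"
    then have "finite ({w. f w \<noteq> 0} \<union> {w. g w \<noteq> 0})" by simp
    then show "?Q (\<lambda>w. f w + g w)" by (rule rev_finite_subset) auto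
  qed auto
  moreover have "comm F a r \<in> ?H" if a: "a \<in> \<Gamma> n" and r: "r \<in> R" for a r
  proof -
    have aR: "a \<in> R" by (rule \<Gamma>_in_R[OF a])
    have v1: "vanishes_below 1 (\<mu> r)" by (auto simp: vanishes_below_def)
    note c = \<mu>_comm[OF aR vanishes_\<Gamma>[OF Suc.hyps a] r v1 Suc.hyps zero_less_one]
    let ?S = "{w. length w = n \<and> \<mu> a w \<noteq> 0}" and ?T = "(\<lambda>z. [z]) ` {z. \<mu> r [z] \<noteq> 0}"
    have T: "u \<in> ?T" if "length u = 1" "\<mu> r u \<noteq> 0" for u
      using that by (auto simp: length_Suc_conv)
    have "{w. (if length w = Suc n then \<mu> (comm F a r) w else 0) \<noteq> 0} \<subseteq>
        (\<lambda>(u, v). u @ v) ` (?S \<times> ?T \<union> ?T \<times> ?S)"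
    proof
      fix w assume "w \<in> {w. (if length w = Suc n then \<mu> (comm F a r) w else 0) \<noteq> 0}"
      then have w: "length w = n + 1" "\<mu> (comm F a r) w \<noteq> 0" by (auto split: if_splits)
      then consider "\<mu> a (take n w) \<noteq> 0" "\<mu> r (drop n w) \<noteq> 0" | "\<mu> r (take 1 w) \<noteq> 0" "\<mu> a (drop 1 w) \<noteq> 0"
      proof -
        have "\<mu> a (take n w) * \<mu> r (drop n w) \<noteq> 0 \<or> \<mu> r (take 1 w) * \<mu> a (drop 1 w) \<noteq> 0"
          using c(2)[OF w(1)] w(2) by linarith
        then show thesis using that by auto
      qed
      then show "w \<in> (\<lambda>(u, v). u @ v) ` (?S \<times> ?T \<union> ?T \<times> ?S)"
      proof cases
        case 1
        then have "(take n w, drop n w) \<in> ?S \<times> ?T" using w by (auto intro!: T)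
        then show ?thesis by (intro image_eqI[of _ _ "(take n w, drop n w)"]) auto
      next
        case 2
        then have "(take 1 w, drop 1 w) \<in> ?T \<times> ?S" using w by (auto intro!: T)
        then show ?thesis by (intro image_eqI[of _ _ "(take 1 w, drop 1 w)"]) auto
      qed
    qed
    moreover have "finite ((\<lambda>(u, v). u @ v) ` (?S \<times> ?T \<union> ?T \<times> ?S))"
      using Suc.IH[OF a] \<mu>_linear_finite[OF r] by simp
    ultimately have "finite {w. (if length w = Suc n then \<mu> (comm F a r) w else 0) \<noteq> 0}"
      by (rule finite_subset)
    then show ?thesis using c(1) comm_R[OF aR r] by simp
  qed
  ultimately have "commutator_subgroup F (\<Gamma> n) R \<subseteq> ?H" by (rule commutator_subgroup_least)
  then have "x \<in> ?H" using Suc.prems Suc.hyps \<Gamma>_Suc by blast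
  then have "finite {w. (if length w = Suc n then \<mu> x w else 0) \<noteq> 0}" by blast
  moreover have "{w. (if length w = Suc n then \<mu> x w else 0) \<noteq> 0} = {w. length w = Suc n \<and> \<mu> x w \<noteq> 0}"
    by auto
  ultimately show ?case by (simp only:)
qed

definition leading_form :: "nat \<Rightarrow> 'a \<Rightarrow> 'z list \<Rightarrow>\<^sub>0 int" where
  "leading_form n x = Abs_poly_mapping (\<lambda>w. if length w = n then \<mu> x w else 0)"

lemma lookup_leading_form:
  assumes "0 < n" "x \<in> \<Gamma> n"
  shows "lookup (leading_form n x) w = (if length w = n then \<mu> x w else 0)"
proof -
  have "{w. (if length w = n then \<mu> x w else 0) \<noteq> 0} = {w. length w = n \<and> \<mu> x w \<noteq> 0}" by auto
  then have "finite {w. (if length w = n then \<mu> x w else 0) \<noteq> 0}"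
    using \<Gamma>_finite_leading[OF assms] by simp
  then show ?thesis by (simp add: leading_form_def)
qed

lemma leading_form_additive:
  assumes n: "0 < n" shows "additive_on F (\<Gamma> n) (leading_form n)"
  unfolding additive_on_def
proof (intro ballI poly_mapping_eqI)
  fix x y w assume xy: "x \<in> \<Gamma> n" "y \<in> \<Gamma> n"
  then have "x \<otimes> y \<in> \<Gamma> n" by (rule subgroup.m_closed[OF \<Gamma>_subgroup])
  then show "lookup (leading_form n (x \<otimes> y)) w = lookup (leading_form n x + leading_form n y) w"
    using xy \<mu>_mult_low[OF \<Gamma>_in_R[OF xy(1)] \<Gamma>_in_R[OF xy(2)] vanishes_\<Gamma>[OF n xy(1)] vanishes_\<Gamma>[OF n xy(2)], of w] n
    by (auto simp: lookup_leading_form[OF n] lookup_add)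
qed

end

section \<open>Free abelian quotients from retractions\<close>

context group begin

lemma set_mult_memI: "x \<in> A \<Longrightarrow> y \<in> B \<Longrightarrow> x \<otimes> y \<in> A <#> B"
  by (auto simp: set_mult_def)

lemma normal_set_mult:
  assumes A: "A \<lhd> G" and B: "B \<lhd> G"
  shows "A <#> B \<lhd> G"
proof -
  note A' = normal_imp_subgroup[OF A] and B' = normal_imp_subgroup[OF B]
  note AG = normal_in_carrier[OF A] and BG = normal_in_carrier[OF B]
  have "subgroup (A <#> B) G"
  proof (rule subgroupI)
    show "A <#> B \<subseteq> carrier G" using AG BG by (auto simp: set_mult_def)
    show "A <#> B \<noteq> {}" using subgroup.one_closed[OF A'] subgroup.one_closed[OF B'] by (auto simp: set_mult_def)
    fix x assume "x \<in> A <#> B"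
    then obtain a b where ab: "a \<in> A" "b \<in> B" "x = a \<otimes> b" by (auto simp: set_mult_def)
    have "inv x = (inv b \<otimes> inv a \<otimes> inv (inv b)) \<otimes> inv b"
      using ab AG BG by (simp add: expand_comm)
    moreover have "inv b \<otimes> inv a \<otimes> inv (inv b) \<in> A"
      by (rule normal.inv_op_closed2[OF A]) (use ab BG subgroup.m_inv_closed[OF A'] in auto)
    ultimately show "inv x \<in> A <#> B"
      using set_mult_memI[OF _ subgroup.m_inv_closed[OF B' ab(2)]] by simp
  next
    fix x y assume "x \<in> A <#> B" "y \<in> A <#> B"
    then obtain a b c d where ab: "a \<in> A" "b \<in> B" "x = a \<otimes> b" "c \<in> A" "d \<in> B" "y = c \<otimes> d"
      by (auto simp: set_mult_def)
    have "x \<otimes> y = (a \<otimes> (b \<otimes> c \<otimes> inv b)) \<otimes> (b \<otimes> d)"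
      using ab AG BG by (simp add: expand_comm)
    moreover have "a \<otimes> (b \<otimes> c \<otimes> inv b) \<in> A" "b \<otimes> d \<in> B"
      using ab subgroup.m_closed[OF A'] subgroup.m_closed[OF B'] normal.inv_op_closed2[OF A BG] by auto
    ultimately show "x \<otimes> y \<in> A <#> B" using set_mult_memI by simp
  qed
  moreover have "g \<otimes> x \<otimes> inv g \<in> A <#> B" if g: "g \<in> carrier G" and x: "x \<in> A <#> B" for g x
  proof -
    obtain a b where ab: "a \<in> A" "b \<in> B" "x = a \<otimes> b" using x by (auto simp: set_mult_def)
    have "g \<otimes> x \<otimes> inv g = (g \<otimes> a \<otimes> inv g) \<otimes> (g \<otimes> b \<otimes> inv g)"
      using ab AG BG g by (simp add: expand_comm)
    then show ?thesis
      using set_mult_memI[OF normal.inv_op_closed2[OF A g ab(1)] normal.inv_op_closed2[OF B g ab(2)]] by simp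
  qed
  ultimately show ?thesis by (simp add: normal_inv_iff)
qed

lemma set_mult_superset:
  assumes A: "A \<lhd> G" and B: "B \<lhd> G"
  shows "A \<subseteq> A <#> B" "B \<subseteq> A <#> B"
proof -
  show "A \<subseteq> A <#> B"
  proof
    fix a assume a: "a \<in> A"
    show "a \<in> A <#> B"
      using set_mult_memI[OF a subgroup.one_closed[OF normal_imp_subgroup[OF B]]] normal_in_carrier[OF A a] by simp
  qed
  show "B \<subseteq> A <#> B"
  proof
    fix b assume b: "b \<in> B"
    show "b \<in> A <#> B"
      using set_mult_memI[OF subgroup.one_closed[OF normal_imp_subgroup[OF A]] b] normal_in_carrier[OF B b] by simp
  qed
qed

lemma set_mult_least:
  assumes "subgroup H G" "A \<subseteq> H" "B \<subseteq> H"
  shows "A <#> B \<subseteq> H"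
  using assms subgroup.m_closed[OF assms(1)] by (auto simp: set_mult_def)

end

context lower_central_series begin

definition words :: "nat \<Rightarrow> 'a list set" where
  "words n = {w. set w \<subseteq> R \<and> length w = n}"

definition evaluation_at :: "'a set \<Rightarrow> nat \<Rightarrow> (('a list \<Rightarrow>\<^sub>0 int) \<Rightarrow> 'a set) \<Rightarrow> bool" where
  "evaluation_at D n h \<longleftrightarrow>
     h \<in> hom (free_Abelian_group (words n)) (F\<lparr>carrier := \<Gamma> n\<rparr> Mod D) \<and> (\<forall>w\<in>words n. h (frag_of w) = D #> L w)"

text \<open>
  Formal combinations of words that become trivial in \<open>\<gamma>\<^sub>n(R)/D\<close> when every word is evaluated as an
  iterated commutator.
\<close>
definition relators :: "'a set \<Rightarrow> nat \<Rightarrow> ('a list \<Rightarrow>\<^sub>0 int) set" where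
  "relators D n = {v. keys v \<subseteq> words n \<and> (\<forall>h. evaluation_at D n h \<longrightarrow> h v = D)}"

end

text \<open>
  The position of \<open>D\<close> between \<open>\<gamma>\<^sub>n\<^sub>+\<^sub>1(R)\<close> and \<open>\<gamma>\<^sub>n(R)\<close> ensures that \<open>\<gamma>\<^sub>n(R)/D\<close> is abelian and words can be evaluated linearly in it.
\<close>
locale central_quotient = lower_central_series F R for F :: "('a, 'm) monoid_scheme" (structure) and R +
  fixes D :: "'a set" and n :: nat
  assumes D_normal: "D \<lhd> F" and D_le: "D \<subseteq> \<Gamma> n" and D_ge: "\<Gamma> (Suc n) \<subseteq> D" and n_pos: "0 < n"
begin

lemma L_words: "w \<in> words n \<Longrightarrow> L w \<in> \<Gamma> n"
  using L_in_\<Gamma>[of w n] n_pos by (auto simp: words_def)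

lemma D_normal': "D \<lhd> F\<lparr>carrier := \<Gamma> n\<rparr>"
  by (rule normal_restrict_supergroup[OF \<Gamma>_subgroup D_normal D_le])

lemma coset_mult: "x \<in> \<Gamma> n \<Longrightarrow> y \<in> \<Gamma> n \<Longrightarrow> (D #> x) <#> (D #> y) = D #> (x \<otimes> y)"
  by (rule normal.rcos_sum[OF D_normal]) (simp_all add: \<Gamma>_carrier)

lemma quotient_comm_group: "comm_group (F\<lparr>carrier := \<Gamma> n\<rparr> Mod D)"
proof (rule group.group_comm_groupI)
  show "group (F\<lparr>carrier := \<Gamma> n\<rparr> Mod D)" by (rule normal.factorgroup_is_group[OF D_normal'])
  fix p q assume "p \<in> carrier (F\<lparr>carrier := \<Gamma> n\<rparr> Mod D)" "q \<in> carrier (F\<lparr>carrier := \<Gamma> n\<rparr> Mod D)"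
  then obtain x y where xy: "x \<in> \<Gamma> n" "y \<in> \<Gamma> n" "p = D #> x" "q = D #> y"
    by (auto simp: carrier_FactGroup)
  have G: "x \<in> carrier F" "y \<in> carrier F" using xy \<Gamma>_carrier by auto
  have "comm F x y \<in> \<Gamma> (Suc n)" using \<Gamma>_le[OF comm_\<Gamma>[OF xy(1,2)], of "Suc n"] n_pos by simp
  then have c: "comm F x y \<in> D" using D_ge by blast
  have "x \<otimes> y = comm F x y \<otimes> (y \<otimes> x)" using G by (simp add: expand_comm)
  then have "D #> (x \<otimes> y) = D #> (y \<otimes> x)" using coset_absorb[OF D_normal c, of "y \<otimes> x"] G by simp
  then show "p \<otimes>\<^bsub>F\<lparr>carrier := \<Gamma> n\<rparr> Mod D\<^esub> q = q \<otimes>\<^bsub>F\<lparr>carrier := \<Gamma> n\<rparr> Mod D\<^esub> p"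
    using coset_mult[OF xy(1,2)] coset_mult[OF xy(2,1)] by (simp add: xy(3,4))
qed

lemma quotient_inv: "x \<in> \<Gamma> n \<Longrightarrow> inv\<^bsub>F\<lparr>carrier := \<Gamma> n\<rparr> Mod D\<^esub> (D #> x) = D #> inv x"
proof -
  assume x: "x \<in> \<Gamma> n"
  have ix: "inv x \<in> \<Gamma> n" by (rule subgroup.m_inv_closed[OF \<Gamma>_subgroup x])
  have "D #> inv x \<otimes> x = D"
    using coset_join2[OF one_closed normal_imp_subgroup[OF D_normal]] x \<Gamma>_carrier[OF x]
      subgroup.one_closed[OF normal_imp_subgroup[OF D_normal]] by simp
  then show ?thesis
    by (intro group.inv_equality[OF comm_group.axioms(2)[OF quotient_comm_group]])
      (use x ix coset_mult[OF ix x] in \<open>auto simp: carrier_FactGroup\<close>)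
qed

lemma evaluation_add:
  assumes h: "evaluation_at D n h" and "keys u \<subseteq> words n" "keys v \<subseteq> words n"
    and "h u = D #> a" "h v = D #> b" "a \<in> \<Gamma> n" "b \<in> \<Gamma> n"
  shows "h (u + v) = D #> (a \<otimes> b)"
proof -
  have "h (u \<otimes>\<^bsub>free_Abelian_group (words n)\<^esub> v) = h u \<otimes>\<^bsub>F\<lparr>carrier := \<Gamma> n\<rparr> Mod D\<^esub> h v"
    by (rule hom_mult) (use h assms in \<open>auto simp: evaluation_at_def\<close>)
  then show ?thesis using assms coset_mult by simp
qed

lemma evaluation_diff:
  assumes h: "evaluation_at D n h" and u: "keys u \<subseteq> words n" and v: "keys v \<subseteq> words n"
    and ab: "h u = D #> a" "h v = D #> b" "a \<in> \<Gamma> n" "b \<in> \<Gamma> n"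
  shows "h (u - v) = D #> (a \<otimes> inv b)"
proof -
  interpret h: group_hom "free_Abelian_group (words n)" "F\<lparr>carrier := \<Gamma> n\<rparr> Mod D" h
    using h comm_group.axioms(2)[OF quotient_comm_group]
    by (simp add: group_hom_def group_hom_axioms_def evaluation_at_def)
  have "h (- v) = D #> inv b"
    using h.hom_inv[of v] v ab quotient_inv by simp
  then have "h (u + - v) = D #> (a \<otimes> inv b)"
    using ab subgroup.m_inv_closed[OF \<Gamma>_subgroup] by (intro evaluation_add[OF h u]) (use v in simp_all)
  then show ?thesis by simp
qed

lemma coset_D: "a \<in> D \<Longrightarrow> D #> a = D"
  using coset_eq_self_iff[OF D_normal] normal_in_carrier[OF D_normal] by blast

sublocale relators: relation_module "relators D n"
proof
  have one: "\<one> \<in> \<Gamma> n" "\<one> \<in> D"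
    using subgroup.one_closed[OF \<Gamma>_subgroup] subgroup.one_closed[OF normal_imp_subgroup[OF D_normal]] by auto
  have h0: "h 0 = D" if "evaluation_at D n h" for h
    using hom_one[of h "free_Abelian_group (words n)" "F\<lparr>carrier := \<Gamma> n\<rparr> Mod D"] that
      comm_group.axioms(2)[OF quotient_comm_group] by (simp add: evaluation_at_def)
  then show "0 \<in> relators D n" by (simp add: relators_def)
  fix u v assume uv: "u \<in> relators D n" "v \<in> relators D n"
  have "h (u - v) = D" if h: "evaluation_at D n h" for h
    using evaluation_diff[OF h, of u v \<one> \<one>] uv h one coset_D[OF one(2)] by (simp add: relators_def)
  then show "u - v \<in> relators D n"
    using uv keys_diff[of u v] by (auto simp: relators_def)
qed

lemma keys_word: "w \<in> words n \<Longrightarrow> keys (frag_of w) \<subseteq> words n"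
  by (simp add: keys_frag_of)

lemma keys_add_words:
  "keys u \<subseteq> words n \<Longrightarrow> keys v \<subseteq> words n \<Longrightarrow>
    keys (u + v :: 'a list \<Rightarrow>\<^sub>0 int) \<subseteq> words n"
  using keys_add[of u v] by (meson Un_least subset_trans)

lemma relatorsI:
  "keys v \<subseteq> words n \<Longrightarrow> (\<And>h. evaluation_at D n h \<Longrightarrow> h v = D) \<Longrightarrow> v \<in> relators D n"
  by (simp add: relators_def)

lemma relator_word: "w \<in> words n \<Longrightarrow> L w \<in> D \<Longrightarrow> frag_of w \<in> relators D n"
  using keys_word coset_D by (simp add: relators_def evaluation_at_def)

lemma relator_add2:
  assumes "u \<in> words n" "v \<in> words n" "L u \<otimes> L v \<in> D"
  shows "frag_of u + frag_of v \<in> relators D n"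
proof -
  have "h (frag_of u + frag_of v) = D" if h: "evaluation_at D n h" for h
    using evaluation_add[OF h keys_word[OF assms(1)] keys_word[OF assms(2)], of "L u" "L v"] assms h L_words coset_D
    by (simp add: evaluation_at_def)
  then show ?thesis
    by (rule relatorsI[OF keys_add_words[OF keys_word[OF assms(1)] keys_word[OF assms(2)]]])
qed

lemma relator_add3:
  assumes "u \<in> words n" "v \<in> words n" "t \<in> words n" "L u \<otimes> L v \<otimes> L t \<in> D"
  shows "frag_of u + frag_of v + frag_of t \<in> relators D n"
proof -
  have k: "keys (frag_of u + frag_of v) \<subseteq> words n"
    by (rule keys_add_words[OF keys_word[OF assms(1)] keys_word[OF assms(2)]])
  have "h (frag_of u + frag_of v + frag_of t) = D" if h: "evaluation_at D n h" for h
  proof -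
    have w: "h (frag_of w) = D #> L w" if "w \<in> words n" for w using h that by (simp add: evaluation_at_def)
    have uv: "h (frag_of u + frag_of v) = D #> (L u \<otimes> L v)"
      by (rule evaluation_add[OF h]) (use assms keys_word L_words w in auto)
    have "h (frag_of u + frag_of v + frag_of t) = D #> (L u \<otimes> L v \<otimes> L t)"
      by (rule evaluation_add[OF h k keys_word[OF assms(3)] uv w[OF assms(3)]])
        (use assms L_words subgroup.m_closed[OF \<Gamma>_subgroup] in auto)
    then show ?thesis using coset_D[OF assms(4)] by simp
  qed
  then show ?thesis
    by (rule relatorsI[OF keys_add_words[OF k keys_word[OF assms(3)]]])
qed

lemma keys_diff_words: "u \<in> words n \<Longrightarrow> v \<in> words n \<Longrightarrow> keys (frag_of u - frag_of v) \<subseteq> words n"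
  using keys_diff[of "frag_of u" "frag_of v"] by (auto simp: keys_frag_of)

lemma evaluation_diff_words:
  assumes h: "evaluation_at D n h" and "u \<in> words n" "v \<in> words n"
  shows "h (frag_of u - frag_of v) = D #> (L u \<otimes> inv L v)"
  by (rule evaluation_diff[OF h]) (use assms keys_word L_words in \<open>auto simp: evaluation_at_def\<close>)

lemma relator_diff:
  assumes "u \<in> words n" "v \<in> words n" "L u \<otimes> inv L v \<in> D"
  shows "frag_of u - frag_of v \<in> relators D n"
  using keys_diff_words[OF assms(1,2)] evaluation_diff_words[OF _ assms(1,2)] coset_D[OF assms(3)]
  by (simp add: relators_def)

lemma relator_diff_add_diff:
  assumes "u \<in> words n" "v \<in> words n" "s \<in> words n" "t \<in> words n"
    and D: "L u \<otimes> inv L v \<otimes> (L s \<otimes> inv L t) \<in> D"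
  shows "frag_of u - frag_of v + frag_of s - frag_of t \<in> relators D n"
proof -
  have eq: "frag_of u - frag_of v + frag_of s - frag_of t = (frag_of u - frag_of v) + (frag_of s - frag_of t)"
    by simp
  have \<Gamma>: "L a \<otimes> inv L b \<in> \<Gamma> n" if "a \<in> words n" "b \<in> words n" for a b
    using that L_words subgroup.m_closed[OF \<Gamma>_subgroup] subgroup.m_inv_closed[OF \<Gamma>_subgroup] by simp
  have "h ((frag_of u - frag_of v) + (frag_of s - frag_of t)) = D" if h: "evaluation_at D n h" for h
    using evaluation_add[OF h keys_diff_words[OF assms(1,2)] keys_diff_words[OF assms(3,4)]
        evaluation_diff_words[OF h assms(1,2)] evaluation_diff_words[OF h assms(3,4)]]
      \<Gamma> assms(1-4) coset_D[OF D] by simp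
  then show ?thesis
    unfolding eq
    by (rule relatorsI[OF keys_add_words[OF keys_diff_words[OF assms(1,2)] keys_diff_words[OF assms(3,4)]]])
qed

end

text \<open>
  The letters are the elements of a basis \<open>Z\<close> of \<open>R\<close> modulo \<open>R'\<close>, and the linear parts of elements of
  \<open>S\<close> involve only letters from \<open>S\<close>.
\<close>
locale adapted_magnus_representation =
  magnus_representation F R \<mu> for F :: "('a, 'm) monoid_scheme" (structure) and R
    and \<mu> :: "'a \<Rightarrow> 'a list \<Rightarrow> int" +
  fixes Z S :: "'a set"
  assumes Z_R: "Z \<subseteq> R" and S_R: "S \<subseteq> R" and S_normal: "S \<lhd> F" and derived_S: "derived F R \<subseteq> S"
    and Z_generates: "subgroup M F \<Longrightarrow> Z \<subseteq> M \<Longrightarrow> derived F R \<subseteq> M \<Longrightarrow> R \<subseteq> M"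
    and \<mu>_basis: "z \<in> Z \<Longrightarrow> \<mu> z [y] = (if y = z then 1 else 0)"
    and \<mu>_S: "s \<in> S \<Longrightarrow> \<mu> s [y] \<noteq> 0 \<Longrightarrow> y \<in> S"
begin

lemma leading_form_iterated_comm:
  assumes "w \<noteq> []" "set w \<subseteq> Z"
  shows "leading_form (length w) (L w) = lie_polynomial w"
  using assms
proof (induction w rule: rev_induct)
  case (snoc y w)
  show ?case
  proof (cases "w = []")
    case True
    have y: "y \<in> Z" "y \<in> \<Gamma> 1" using snoc.prems Z_R by auto
    show ?thesis
    proof (rule poly_mapping_eqI)
      fix u
      show "lookup (leading_form (length (w @ [y])) (L (w @ [y]))) u =
          lookup (lie_polynomial (w @ [y])) u"
        using True lookup_leading_form[OF zero_less_one y(2), of u] \<mu>_basis[OF y(1)]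
        by (auto simp: iterated_comm_def lie_polynomial_def length_Suc_conv split: if_splits)
    qed
  next
    case False
    let ?n = "length w"
    have n: "0 < ?n" using False by simp
    have yR: "y \<in> R" "y \<in> Z" and wZ: "set w \<subseteq> Z" and wR: "set w \<subseteq> R" using snoc.prems Z_R by auto
    have Lw: "L w \<in> \<Gamma> ?n" using iterated_comm_in_\<Gamma>[OF wR False] .
    have Lwy: "comm F (L w) y \<in> \<Gamma> (Suc ?n)" by (rule comm_\<Gamma>_R[OF Lw yR(1)])
    have v1: "vanishes_below 1 (\<mu> y)" by (auto simp: vanishes_below_def)
    show ?thesis
    proof (rule poly_mapping_eqI)
      fix u
      show "lookup (leading_form (length (w @ [y])) (L (w @ [y]))) u =
          lookup (lie_polynomial (w @ [y])) u"
      proof (cases "length u = Suc ?n")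
        case True
        then have u: "u \<noteq> []" by auto
        have parts: "take ?n u = butlast u" "drop ?n u = [last u]" "take 1 u = [hd u]" "drop 1 u = tl u"
        proof -
          show "take ?n u = butlast u" using True by (simp add: butlast_conv_take)
          have "u = butlast u @ [last u]" using u by simp
          then show "drop ?n u = [last u]" using True
            by (metis append_eq_conv_conj diff_Suc_1 length_butlast)
          show "take 1 u = [hd u]" using u by (cases u) auto
          show "drop 1 u = tl u" by (cases u) auto
        qed
        have IH: "lookup (lie_polynomial w) v = \<mu> (L w) v" if "length v = ?n" for v
          using snoc.IH[OF False wZ] lookup_leading_form[OF n Lw, of v] that by simp
        have "\<mu> (comm F (L w) y) u = \<mu> (L w) (butlast u) * \<mu> y [last u] - \<mu> y [hd u] * \<mu> (L w) (tl u)"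
          using \<mu>_comm(2)[OF \<Gamma>_in_R[OF Lw] vanishes_\<Gamma>[OF n Lw] yR(1) v1 n zero_less_one, of u] True
          unfolding parts by simp
        then show ?thesis
          using True lookup_leading_form[OF _ Lwy, of u] IH[of "butlast u"] IH[of "tl u"] \<mu>_basis[OF yR(2)]
          by (simp add: iterated_comm_snoc[OF False] lookup_lie_polynomial_snoc[OF False u])
      next
        case ne: False
        then have "u \<notin> keys (lie_polynomial (w @ [y]))"
          using keys_lie_polynomial[of "w @ [y]" u] by auto
        then show ?thesis
          using ne lookup_leading_form[OF _ Lwy, of u] by (simp add: iterated_comm_snoc[OF False] in_keys_iff)
      qed
    qed
  qed
qed simp

text \<open>
  Let \<open>h\<close> evaluate combinations of words in \<open>\<gamma>\<^sub>n(R)/D\<close>. The hypothesis \<open>retract\<close> says that applying the leading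
  form, \<open>\<psi>\<close> and \<open>h\<close> in succession agrees with the projection to \<open>\<gamma>\<^sub>n(R)/D\<close> on iterated commutators of
  basis elements, hence on all of \<open>\<gamma>\<^sub>n(R)\<close>. So an element of \<open>\<gamma>\<^sub>n(R)\<close> lies in \<open>D\<close> as soon as its leading form
  has zero coefficient at every word that \<open>\<psi>\<close> does not annihilate, and by the hypothesis \<open>vanish\<close> this describes \<open>D\<close>.
\<close>
proposition quotient_free_abelian_by_retraction:
  assumes D: "central_quotient F R D n"
    and vanish: "D \<subseteq> leading_in n (\<lambda>w. \<psi> w = 0)"
    and keys: "\<And>w. keys (\<psi> w) \<subseteq> words n"
    and retract: "\<And>w. set w \<subseteq> Z \<Longrightarrow> length w = n \<Longrightarrow>
      frag_extend \<psi> (lie_polynomial w) - frag_of w \<in> relators D n"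
  shows "is_free_abelian_group (F\<lparr>carrier := \<Gamma> n\<rparr> Mod D)"
proof -
  interpret D: central_quotient F R D n by (rule D)
  note n = D.n_pos
  obtain h where "h \<in> hom (free_Abelian_group (words n)) (F\<lparr>carrier := \<Gamma> n\<rparr> Mod D)"
    and "\<And>w. w \<in> words n \<Longrightarrow> h (frag_of w) = D #> L w"
  proof (rule comm_group.free_Abelian_group_universal[OF D.quotient_comm_group])
    show "(\<lambda>w. D #> L w) ` words n \<subseteq> carrier (F\<lparr>carrier := \<Gamma> n\<rparr> Mod D)"
      using D.L_words by (auto simp: carrier_FactGroup)
  qed blast
  then have h: "evaluation_at D n h" by (simp add: evaluation_at_def)
  let ?\<phi> = "leading_form n" and ?\<Psi> = "frag_extend \<psi>"
  have add: "additive_on F (\<Gamma> n) ?\<phi>" by (rule leading_form_additive[OF n])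
  have kk: "keys (?\<Psi> v) \<subseteq> words n" for v
    using keys_frag_extend[of \<psi> v] keys by blast
  have h0: "h 0 = D"
    using D.relators.zero_mem h by (simp add: relators_def)
  let ?M = "{x \<in> \<Gamma> n. h (?\<Psi> (?\<phi> x)) = D #> x}"
  have DG: "D \<subseteq> carrier F" using normal_in_carrier[OF D.D_normal] by blast
  have "\<Gamma> n \<subseteq> ?M"
  proof (rule \<Gamma>_generated_by_iterated_comms[OF Z_R Z_generates])
    show "subgroup ?M F"
    proof (rule subgroupI)
      have "\<one> \<in> ?M"
        using additive_on_one[OF add \<Gamma>_subgroup] h0 subgroup.one_closed[OF \<Gamma>_subgroup] DG by simp
      then show "?M \<noteq> {}" by blast
      fix x assume x: "x \<in> ?M"
      have "h (0 - ?\<Psi> (?\<phi> x)) = D #> (\<one> \<otimes> inv x)"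
        using x h0 DG subgroup.one_closed[OF \<Gamma>_subgroup] by (intro D.evaluation_diff[OF h _ kk]) auto
      then show "inv x \<in> ?M"
        using x additive_on_inv[OF add \<Gamma>_subgroup, of x] subgroup.m_inv_closed[OF \<Gamma>_subgroup] \<Gamma>_carrier[of x n]
        by (simp add: frag_extend_minus)
    next
      fix x y assume xy: "x \<in> ?M" "y \<in> ?M"
      then have "h (?\<Psi> (?\<phi> x) + ?\<Psi> (?\<phi> y)) = D #> (x \<otimes> y)"
        by (intro D.evaluation_add[OF h kk kk]) auto
      then show "x \<otimes> y \<in> ?M"
        using xy additive_on_mult[OF add, of x y] subgroup.m_closed[OF \<Gamma>_subgroup]
        by (simp add: frag_extend_add)
    qed (use \<Gamma>_carrier in auto)
    show "\<Gamma> (Suc n) \<subseteq> ?M"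
    proof
      fix x assume x: "x \<in> \<Gamma> (Suc n)"
      have xn: "x \<in> \<Gamma> n" using \<Gamma>_Suc_subset x by blast
      have "?\<phi> x = 0"
      proof (rule poly_mapping_eqI)
        fix w
        show "lookup (?\<phi> x) w = lookup 0 w"
          using lookup_leading_form[OF n xn, of w] vanishes_belowD[OF vanishes_\<Gamma>[OF _ x], of w] n by auto
      qed
      then show "x \<in> ?M" using xn h0 D.coset_D[of x] D.D_ge x by auto
    qed
    show "L w \<in> ?M" if w: "set w \<subseteq> Z" "length w = n" for w
    proof -
      have ww: "w \<in> words n" using w Z_R by (auto simp: words_def)
      have Lw: "L w \<in> \<Gamma> n" by (rule D.L_words[OF ww])
      have phi: "?\<phi> (L w) = lie_polynomial w"
        using leading_form_iterated_comm[of w] w n by auto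
      let ?d = "?\<Psi> (lie_polynomial w) - frag_of w"
      have d: "keys ?d \<subseteq> words n" "h ?d = D #> \<one>"
        using retract[OF w] h DG by (simp_all add: relators_def)
      have "h (?d + frag_of w) = D #> (\<one> \<otimes> L w)"
        using h ww Lw subgroup.one_closed[OF \<Gamma>_subgroup] D.keys_word
        by (intro D.evaluation_add[OF h d(1) _ d(2)]) (auto simp: evaluation_at_def)
      then show ?thesis using phi Lw \<Gamma>_carrier[OF Lw] by simp
    qed
  qed (use n in auto)
  then have ev: "h (?\<Psi> (?\<phi> x)) = D #> x" if "x \<in> \<Gamma> n" for x using that by blast
  let ?pr = "\<lambda>w. if \<psi> w = 0 then 0 else frag_of w"
  let ?\<phi>' = "\<lambda>x. frag_extend ?pr (?\<phi> x)"
  have "D = {x \<in> \<Gamma> n. ?\<phi>' x = 0}"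
  proof (intro equalityI subsetI)
    fix x assume x: "x \<in> D"
    then have xn: "x \<in> \<Gamma> n" using D.D_le by blast
    have "?pr w = 0" if "w \<in> keys (?\<phi> x)" for w
    proof -
      have "length w = n \<and> \<mu> x w \<noteq> 0"
        using that lookup_leading_form[OF n xn, of w] by (auto simp: in_keys_iff split: if_splits)
      then show ?thesis using x vanish by (auto simp: leading_in_def)
    qed
    then have "?\<phi>' x = 0" by (rule frag_extend_eq_0)
    then show "x \<in> {x \<in> \<Gamma> n. ?\<phi>' x = 0}" using xn by simp
  next
    fix x assume "x \<in> {x \<in> \<Gamma> n. ?\<phi>' x = 0}"
    then have x: "x \<in> \<Gamma> n" "?\<phi>' x = 0" by auto
    have "?\<Psi> (frag_extend ?pr v) = ?\<Psi> v" for v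
    proof -
      have "keys v \<subseteq> UNIV" by simp
      then show ?thesis
        by (induction v rule: frag_induction) (auto simp: frag_extend_diff)
    qed
    from this[of "?\<phi> x"] have "?\<Psi> (?\<phi> x) = 0" using x by simp
    then have "D #> x = D" using ev[OF x(1)] h0 by simp
    then show "x \<in> D" using coset_eq_self_iff[OF D.D_normal \<Gamma>_carrier[OF x(1)]] by simp
  qed
  moreover have "additive_on F (\<Gamma> n) ?\<phi>'"
    using add by (simp add: additive_on_def frag_extend_add)
  ultimately show ?thesis
    by (rule free_abelian_quotient[OF \<Gamma>_subgroup, rotated])
qed

end

section \<open>The quotients of degree two, three and four\<close>

context adapted_magnus_representation begin

abbreviation C where "C \<equiv> commutator_subgroup F"

lemma C_normal: "A \<lhd> F \<Longrightarrow> B \<lhd> F \<Longrightarrow> C A B \<lhd> F"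
  by (rule commutator_subgroup_normal)

lemma C_into_\<Gamma>:
  assumes "A \<subseteq> \<Gamma> i" "B \<subseteq> \<Gamma> j"
  shows "C A B \<subseteq> \<Gamma> (i + j)"
  by (rule commutator_subgroup_least[OF \<Gamma>_subgroup]) (use assms comm_\<Gamma> in blast)

definition S_letters :: "'a list \<Rightarrow> nat" where
  "S_letters w = length (filter (\<lambda>x. x \<in> S) w)"

lemma S_letters_split: "S_letters (take m w) + S_letters (drop m w) = S_letters w"
  unfolding S_letters_def by (metis append_take_drop_id filter_append length_append)

lemma R_leading: "R \<subseteq> leading_in 1 (\<lambda>w. 0 \<le> S_letters w)"
  by (auto simp: leading_in_def vanishes_below_def)

lemma S_leading: "S \<subseteq> leading_in 1 (\<lambda>w. 1 \<le> S_letters w)"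
proof
  fix s assume s: "s \<in> S"
  have "1 \<le> S_letters w" if "length w = 1" "\<mu> s w \<noteq> 0" for w
    using that \<mu>_S[OF s] by (auto simp: S_letters_def length_Suc_conv)
  then show "s \<in> leading_in 1 (\<lambda>w. 1 \<le> S_letters w)"
    using s S_R by (auto simp: leading_in_def vanishes_below_def)
qed

lemma S_letters_commutator:
  assumes "A \<subseteq> leading_in m (\<lambda>w. i \<le> S_letters w)" "B \<subseteq> leading_in n (\<lambda>w. j \<le> S_letters w)" "0 < m" "0 < n"
  shows "C A B \<subseteq> leading_in (m + n) (\<lambda>w. i + j \<le> S_letters w)"
proof (rule subset_trans[OF leading_in_commutator[OF assms] leading_in_mono])
  fix w assume "i \<le> S_letters (take m w) \<and> j \<le> S_letters (drop m w) \<or>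
      j \<le> S_letters (take n w) \<and> i \<le> S_letters (drop n w)"
  then show "i + j \<le> S_letters w"
    using S_letters_split[of m w] S_letters_split[of n w] by linarith
qed

lemma CRS_leading: "C R S \<subseteq> leading_in 2 (\<lambda>w. 1 \<le> S_letters w)"
  using S_letters_commutator[OF R_leading S_leading] by (simp add: numeral_2_eq_2)

lemma CRSS_leading: "C (C R S) S \<subseteq> leading_in 3 (\<lambda>w. 2 \<le> S_letters w)"
  using S_letters_commutator[OF CRS_leading S_leading] by (simp add: eval_nat_numeral)

lemma CRSSS_leading: "C (C (C R S) S) S \<subseteq> leading_in 4 (\<lambda>w. 3 \<le> S_letters w)"
  using S_letters_commutator[OF CRSS_leading S_leading] by (simp add: eval_nat_numeral)

text \<open>
  Each half of the word comes from a factor \<open>[R, S]\<close> and thus contains a letter from \<open>S\<close>; this excludes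
  the words \<open>a a' b b'\<close> on which \<open>retract4\<close> relies.
\<close>
lemma CRS_CRS_leading:
  "C (C R S) (C R S) \<subseteq> leading_in 4 (\<lambda>w. 1 \<le> S_letters (take 2 w) \<and> 1 \<le> S_letters (drop 2 w))"
  using leading_in_commutator[OF CRS_leading CRS_leading] by simp

lemma \<Gamma>_deeper: "0 < n \<Longrightarrow> \<Gamma> (Suc n) \<subseteq> leading_in n P"
proof
  fix x assume n: "0 < n" and x: "x \<in> \<Gamma> (Suc n)"
  show "x \<in> leading_in n P"
    by (rule leading_in_deeper[OF vanishes_\<Gamma>[OF _ x] \<Gamma>_in_R[OF x] n]) simp_all
qed

lemma CRS_subset: "C R S \<subseteq> \<Gamma> 2" "C (C R S) S \<subseteq> \<Gamma> 3" "C (C (C R S) S) S \<subseteq> \<Gamma> 4" "C (C R S) (C R S) \<subseteq> \<Gamma> 4"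
proof -
  have S: "S \<subseteq> \<Gamma> 1" and R: "R \<subseteq> \<Gamma> 1" using S_R by auto
  show 2: "C R S \<subseteq> \<Gamma> 2" using C_into_\<Gamma>[OF R S] by (simp add: eval_nat_numeral)
  show 3: "C (C R S) S \<subseteq> \<Gamma> 3" using C_into_\<Gamma>[OF 2 S] by (simp add: eval_nat_numeral)
  show "C (C (C R S) S) S \<subseteq> \<Gamma> 4" using C_into_\<Gamma>[OF 3 S] by (simp add: eval_nat_numeral)
  show "C (C R S) (C R S) \<subseteq> \<Gamma> 4" using C_into_\<Gamma>[OF 2 2] by simp
qed

lemma keys_retract:
  "keys (retract2 A Z w) \<subseteq> words 2" "keys (retract3 A Z w) \<subseteq> words 3"
proof -
  show "keys (retract2 A Z w) \<subseteq> words 2"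
    using Z_R by (auto simp: retract2_def words_def keys_frag_of)
  show "keys (retract3 A Z w) \<subseteq> words 3"
    using Z_R by (auto simp: retract3_def words_def keys_frag_of)
qed

lemma keys_retract4: "keys (retract4 A Z w) \<subseteq> words 4"
proof (cases "length w = 4 \<and> set w \<subseteq> Z")
  case True
  then obtain p q r s where w: "w = [p, q, r, s]"
    by (auto simp: eval_nat_numeral length_Suc_conv)
  then have Z: "p \<in> Z" "q \<in> Z" "r \<in> Z" "s \<in> Z" using True by auto
  then have "p \<in> R" "q \<in> R" "r \<in> R" "s \<in> R" using Z_R by auto
  then show ?thesis
    unfolding w retract4_eq[OF Z refl] by (auto simp: words_def keys_frag_of)
next
  case False
  then show ?thesis by (auto simp: retract4_def)
qed

lemma L_simps: "L [x, y] = comm F x y" "L [x, y, z] = comm F (comm F x y) z"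
  "L [x, y, z, w] = comm F (comm F (comm F x y) z) w"
  by (simp_all add: iterated_comm_def)

lemma words_intros:
  "x \<in> Z \<Longrightarrow> y \<in> Z \<Longrightarrow> [x, y] \<in> words 2"
  "x \<in> Z \<Longrightarrow> y \<in> Z \<Longrightarrow> z \<in> Z \<Longrightarrow> [x, y, z] \<in> words 3"
  "x \<in> Z \<Longrightarrow> y \<in> Z \<Longrightarrow> z \<in> Z \<Longrightarrow> w \<in> Z \<Longrightarrow> [x, y, z, w] \<in> words 4"
  using Z_R by (auto simp: words_def)

lemma Z_carrier: "z \<in> Z \<Longrightarrow> z \<in> carrier F"
  using Z_R R_carrier by blast

lemma ZR: "z \<in> Z \<Longrightarrow> z \<in> R"
  using Z_R by blast

lemma central_quotientI:
  "D \<lhd> F \<Longrightarrow> D \<subseteq> \<Gamma> n \<Longrightarrow> \<Gamma> (Suc n) \<subseteq> D \<Longrightarrow> 0 < n \<Longrightarrow> central_quotient F R D n"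
  by (intro central_quotient.intro central_quotient_axioms.intro lower_central_series_axioms)

text \<open>
  The denominator contains \<open>\<gamma>\<^sub>3(R)\<close> because \<open>R' \<subseteq> S\<close>. A bracket of two letters is trivial as soon as one
  of them is from \<open>S\<close>, so the words without letters from \<open>S\<close> detect the quotient.
\<close>
theorem degree_two: "is_free_abelian_group (F\<lparr>carrier := \<Gamma> 2\<rparr> Mod C R S)"
proof -
  let ?D = "C R S" and ?A = "\<lambda>x. x \<in> S"
  have DN: "?D \<lhd> F" by (rule C_normal[OF R_normal S_normal])
  have one: "\<one> \<in> ?D" by (rule subgroup.one_closed[OF normal_imp_subgroup[OF DN]])
  have "\<Gamma> (Suc 2) \<subseteq> ?D"
  proof -
    have "comm F a b \<in> ?D" if "a \<in> \<Gamma> 2" "b \<in> R" for a b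
    proof -
      have a: "a \<in> S" using that derived_S by (auto simp: lower_central_2)
      have "inv comm F b a \<in> ?D"
        by (rule subgroup.m_inv_closed[OF normal_imp_subgroup[OF DN] comm_in_commutator_subgroup[OF that(2) a]])
      then show ?thesis using \<Gamma>_carrier[OF that(1)] R_carrier[OF that(2)] by (simp add: inv_comm)
    qed
    then show ?thesis
      using commutator_subgroup_least[OF normal_imp_subgroup[OF DN], of "\<Gamma> 2" R] \<Gamma>_Suc[of 2] by simp
  qed
  then have D: "central_quotient F R ?D 2"
    by (intro central_quotientI DN CRS_subset(1)) simp_all
  interpret D: central_quotient F R ?D 2 by (rule D)
  interpret rel: lie_relations2 "relators ?D 2" Z ?A
  proof
    fix x y assume xy: "x \<in> Z" "y \<in> Z"
    show "frag_of [x, x] \<in> relators ?D 2"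
      using xy one by (intro D.relator_word words_intros) (simp_all add: L_simps Z_carrier)
    have "comm F x y \<otimes> comm F y x = \<one>" using xy by (simp add: Z_carrier flip: inv_comm[of x y])
    then show "frag_of [x, y] + frag_of [y, x] \<in> relators ?D 2"
      using xy one by (intro D.relator_add2 words_intros) (simp_all add: L_simps)
  next
    fix x a assume "x \<in> Z" "a \<in> Z" "a \<in> S"
    then show "frag_of [x, a] \<in> relators ?D 2"
      by (intro D.relator_word words_intros) (simp_all add: L_simps ZR comm_in_commutator_subgroup)
  qed
  show ?thesis
  proof (rule quotient_free_abelian_by_retraction[OF D, where \<psi> = "retract2 ?A Z"])
    have z: "retract2 ?A Z w = 0" if "1 \<le> S_letters w" for w
    proof -
      have "filter (\<lambda>x. x \<in> S) w \<noteq> []" using that by (auto simp: S_letters_def)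
      then show ?thesis by (auto simp: retract2_def filter_empty_conv)
    qed
    show "?D \<subseteq> leading_in 2 (\<lambda>w. retract2 ?A Z w = 0)"
      by (rule subset_trans[OF CRS_leading leading_in_mono]) (rule z)
    show "keys (retract2 ?A Z w) \<subseteq> words 2" for w by (rule keys_retract)
    fix w assume "set w \<subseteq> Z" "length w = 2"
    then obtain x y where "w = [x, y]" "x \<in> Z" "y \<in> Z"
      by (auto simp: eval_nat_numeral length_Suc_conv)
    then show "frag_extend (retract2 ?A Z) (lie_polynomial w) - frag_of w \<in> relators ?D 2"
      using rel.retract2 by simp
  qed
qed

text \<open>
  The brackets \<open>[x, a, b]\<close> with \<open>a\<close> and \<open>b\<close> from \<open>S\<close> lie in the denominator and span all Lie polynomials of
  degree three with at least two letters from \<open>S\<close>; the remaining words detect the quotient.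
\<close>
theorem degree_three: "is_free_abelian_group (F\<lparr>carrier := \<Gamma> 3\<rparr> Mod (\<Gamma> 4 <#> C (C R S) S))"
proof -
  let ?D = "\<Gamma> 4 <#> C (C R S) S" and ?A = "\<lambda>x. x \<in> S"
  have MN: "C (C R S) S \<lhd> F" by (intro C_normal R_normal S_normal)
  have DN: "?D \<lhd> F" by (rule normal_set_mult[OF \<Gamma>_normal MN])
  have one: "\<one> \<in> ?D" by (rule subgroup.one_closed[OF normal_imp_subgroup[OF DN]])
  note sup = set_mult_superset[OF \<Gamma>_normal[of 4] MN]
  have D: "central_quotient F R ?D 3"
  proof (rule central_quotientI[OF DN])
    show "?D \<subseteq> \<Gamma> 3" by (intro set_mult_least \<Gamma>_subgroup \<Gamma>_antimono CRS_subset) simp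
    show "\<Gamma> (Suc 3) \<subseteq> ?D" using sup(1) by simp
  qed simp_all
  interpret D: central_quotient F R ?D 3 by (rule D)
  interpret rel: lie_relations3 "relators ?D 3" Z ?A
  proof
    fix x y z assume xyz: "x \<in> Z" "y \<in> Z" "z \<in> Z"
    show "frag_of [x, x, y] \<in> relators ?D 3"
      using xyz one by (intro D.relator_word words_intros) (simp_all add: L_simps Z_carrier)
    have "L [x, y, z] \<otimes> L [y, x, z] \<in> ?D" by (rule subsetD[OF sup(1) L3_swap]) (use xyz ZR in auto)
    then show "frag_of [x, y, z] + frag_of [y, x, z] \<in> relators ?D 3"
      using xyz by (intro D.relator_add2 words_intros)
    have "L [x, y, z] \<otimes> L [y, z, x] \<otimes> L [z, x, y] \<in> ?D" by (rule subsetD[OF sup(1) L3_jacobi]) (use xyz ZR in auto)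
    then show "frag_of [x, y, z] + frag_of [y, z, x] + frag_of [z, x, y] \<in> relators ?D 3"
      using xyz by (intro D.relator_add3 words_intros)
  next
    fix x a b assume *: "x \<in> Z" "a \<in> Z" "b \<in> Z" "a \<in> S" "b \<in> S"
    then have "L [x, a, b] \<in> C (C R S) S" by (simp add: L_simps ZR comm_in_commutator_subgroup)
    then show "frag_of [x, a, b] \<in> relators ?D 3"
      using * sup by (intro D.relator_word words_intros) auto
  qed
  show ?thesis
  proof (rule quotient_free_abelian_by_retraction[OF D, where \<psi> = "retract3 ?A Z"])
    have z: "retract3 ?A Z w = 0" if "2 \<le> S_letters w" for w
    proof (rule ccontr)
      assume "retract3 ?A Z w \<noteq> 0"
      then have w: "length w = 3" "\<forall>x\<in>set (tl w). x \<notin> S" by (auto simp: retract3_def split: if_splits)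
      then have "S_letters w \<le> 1" by (cases w) (auto simp: S_letters_def filter_empty_conv)
      then show False using that by simp
    qed
    have "C (C R S) S \<subseteq> leading_in 3 (\<lambda>w. retract3 ?A Z w = 0)"
      by (rule subset_trans[OF CRSS_leading leading_in_mono]) (rule z)
    moreover have "\<Gamma> 4 \<subseteq> leading_in 3 (\<lambda>w. retract3 ?A Z w = 0)"
      using \<Gamma>_deeper[of 3] by simp
    ultimately show "?D \<subseteq> leading_in 3 (\<lambda>w. retract3 ?A Z w = 0)"
      by (intro set_mult_least leading_in_subgroup) auto
    show "keys (retract3 ?A Z w) \<subseteq> words 3" for w by (rule keys_retract)
    fix w assume "set w \<subseteq> Z" "length w = 3"
    then obtain x y z where "w = [x, y, z]" "x \<in> Z" "y \<in> Z" "z \<in> Z"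
      by (auto simp: eval_nat_numeral length_Suc_conv)
    then show "frag_extend (retract3 ?A Z) (lie_polynomial w) - frag_of w \<in> relators ?D 3"
      using rel.retract3 by simp
  qed
qed

text \<open>
  Besides the words with at least three letters from \<open>S\<close>, the denominator contains the brackets
  \<open>[[x, a], [y, b]]\<close> with \<open>a\<close> and \<open>b\<close> from \<open>S\<close>; by \<open>L4_last_two\<close> they identify \<open>[x, a, y, b]\<close> with
  \<open>[x, a, b, y]\<close>.
\<close>
theorem degree_four:
  "is_free_abelian_group (F\<lparr>carrier := \<Gamma> 4\<rparr> Mod
     (\<Gamma> 5 <#> C (C (C R S) S) S <#> C (C R S) (C R S)))"
proof -
  let ?M1 = "C (C (C R S) S) S" and ?M2 = "C (C R S) (C R S)"
  let ?D = "\<Gamma> 5 <#> ?M1 <#> ?M2" and ?A = "\<lambda>x. x \<in> S"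
  have M1: "?M1 \<lhd> F" and M2: "?M2 \<lhd> F" by (intro C_normal R_normal S_normal)+
  have N: "\<Gamma> 5 <#> ?M1 \<lhd> F" by (rule normal_set_mult[OF \<Gamma>_normal M1])
  have DN: "?D \<lhd> F" by (rule normal_set_mult[OF N M2])
  have one: "\<one> \<in> ?D" by (rule subgroup.one_closed[OF normal_imp_subgroup[OF DN]])
  have sup: "\<Gamma> 5 \<subseteq> ?D" "?M1 \<subseteq> ?D" "?M2 \<subseteq> ?D"
    using set_mult_superset[OF \<Gamma>_normal[of 5] M1] set_mult_superset[OF N M2] by auto
  have D: "central_quotient F R ?D 4"
  proof (rule central_quotientI[OF DN])
    show "?D \<subseteq> \<Gamma> 4" by (intro set_mult_least \<Gamma>_subgroup \<Gamma>_antimono CRS_subset) simp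
    show "\<Gamma> (Suc 4) \<subseteq> ?D" using sup(1) by simp
  qed simp_all
  interpret D: central_quotient F R ?D 4 by (rule D)
  have LG: "L [x, y, z, w] \<in> carrier F" if "x \<in> Z" "y \<in> Z" "z \<in> Z" "w \<in> Z" for x y z w
    using that by (simp add: L_simps Z_carrier)
  have last_two: "?D #> (L [x, y, z, w] \<otimes> inv L [x, y, w, z]) = ?D #> comm F (comm F x y) (comm F z w)"
    if xyzw: "x \<in> Z" "y \<in> Z" "z \<in> Z" "w \<in> Z" for x y z w
  proof -
    have "L [x, y, z, w] \<otimes> inv L [x, y, w, z] \<otimes> inv comm F (comm F x y) (comm F z w) \<in> ?D"
      by (rule subsetD[OF sup(1) L4_last_two]) (use xyzw ZR in auto)
    then show ?thesis
      using coset_eq_iff[OF DN] xyzw LG by (simp add: Z_carrier)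
  qed
  interpret rel: lie_relations4 "relators ?D 4" Z ?A
  proof
    fix x y z w assume xyzw: "x \<in> Z" "y \<in> Z" "z \<in> Z" "w \<in> Z"
    show "frag_of [x, x, z, w] \<in> relators ?D 4"
      using xyzw one by (intro D.relator_word words_intros) (simp_all add: L_simps Z_carrier)
    have "L [x, y, z, w] \<otimes> L [y, x, z, w] \<in> ?D" by (rule subsetD[OF sup(1) L4_swap]) (use xyzw ZR in auto)
    then show "frag_of [x, y, z, w] + frag_of [y, x, z, w] \<in> relators ?D 4"
      using xyzw by (intro D.relator_add2 words_intros)
    have "L [x, y, z, w] \<otimes> L [y, z, x, w] \<otimes> L [z, x, y, w] \<in> ?D"
      by (rule subsetD[OF sup(1) L4_jacobi]) (use xyzw ZR in auto)
    then show "frag_of [x, y, z, w] + frag_of [y, z, x, w] + frag_of [z, x, y, w] \<in> relators ?D 4"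
      using xyzw by (intro D.relator_add3 words_intros)
    let ?t = "comm F (comm F x y) (comm F z w)"
    have t: "comm F (comm F z w) (comm F x y) = inv ?t" using xyzw by (simp add: inv_comm Z_carrier)
    have "?D #> (L [x, y, z, w] \<otimes> inv L [x, y, w, z] \<otimes> (L [z, w, x, y] \<otimes> inv L [z, w, y, x])) = ?D #> (?t \<otimes> inv ?t)"
      using last_two[OF xyzw] last_two[OF xyzw(3,4,1,2)] xyzw LG unfolding t
      by (intro coset_mult_cong[OF DN]) (simp_all add: Z_carrier)
    also have "\<dots> = ?D" using xyzw D.coset_D[OF one] by (simp add: Z_carrier)
    finally have "L [x, y, z, w] \<otimes> inv L [x, y, w, z] \<otimes> (L [z, w, x, y] \<otimes> inv L [z, w, y, x]) \<in> ?D"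
      using coset_eq_self_iff[OF DN] xyzw LG by simp
    then show "frag_of [x, y, z, w] - frag_of [x, y, w, z] + frag_of [z, w, x, y] - frag_of [z, w, y, x] \<in> relators ?D 4"
      using xyzw by (intro D.relator_diff_add_diff words_intros)
    have "?D #> (L [x, y, x, y] \<otimes> inv L [x, y, y, x]) = ?D"
      using last_two[OF xyzw(1,2,1,2)] xyzw D.coset_D[OF one] by (simp add: Z_carrier)
    then have "L [x, y, x, y] \<otimes> inv L [x, y, y, x] \<in> ?D"
      using coset_eq_self_iff[OF DN] xyzw LG by simp
    then show "frag_of [x, y, x, y] - frag_of [x, y, y, x] \<in> relators ?D 4"
      using xyzw by (intro D.relator_diff words_intros)
  next
    fix x a b c assume *: "x \<in> Z" "a \<in> Z" "b \<in> Z" "c \<in> Z" "a \<in> S" "b \<in> S" "c \<in> S"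
    then have "L [x, a, b, c] \<in> ?M1" by (simp add: L_simps ZR comm_in_commutator_subgroup)
    then show "frag_of [x, a, b, c] \<in> relators ?D 4"
      using * sup by (intro D.relator_word words_intros) auto
  next
    fix x a y b assume *: "x \<in> Z" "a \<in> Z" "y \<in> Z" "b \<in> Z" "a \<in> S" "b \<in> S"
    then have "comm F (comm F x a) (comm F y b) \<in> ?M2" by (simp add: ZR comm_in_commutator_subgroup)
    then have "?D #> (L [x, a, y, b] \<otimes> inv L [x, a, b, y]) = ?D"
      using last_two[OF *(1-4)] D.coset_D sup(3) by auto
    then have "L [x, a, y, b] \<otimes> inv L [x, a, b, y] \<in> ?D"
      using coset_eq_self_iff[OF DN] * LG by simp
    then show "frag_of [x, a, y, b] - frag_of [x, a, b, y] \<in> relators ?D 4"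
      using * by (intro D.relator_diff words_intros)
  qed
  let ?P = "\<lambda>w. retract4 ?A Z w = 0"
  have nz: "\<exists>p q r s. w = [p, q, r, s] \<and> r \<notin> S \<and> s \<notin> S" if "\<not> ?P w" for w
  proof -
    have "length w = 4" using that by (auto simp: retract4_def split: if_splits)
    then obtain p q r s where w: "w = [p, q, r, s]" by (auto simp: eval_nat_numeral length_Suc_conv)
    then show ?thesis using that by (auto simp: retract4_def Let_def split: if_splits)
  qed
  show ?thesis
  proof (rule quotient_free_abelian_by_retraction[OF D, where \<psi> = "retract4 ?A Z"])
    have z1: "?P w" if "3 \<le> S_letters w" for w
    proof (rule ccontr)
      assume "\<not> ?P w"
      then obtain p q r s where "w = [p, q, r, s]" "r \<notin> S" "s \<notin> S" using nz by blast
      then show False using that by (auto simp: S_letters_def split: if_splits)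
    qed
    have 1: "?M1 \<subseteq> leading_in 4 ?P"
      by (rule subset_trans[OF CRSSS_leading leading_in_mono]) (rule z1)
    have z2: "?P w" if "1 \<le> S_letters (take 2 w) \<and> 1 \<le> S_letters (drop 2 w)" for w
    proof (rule ccontr)
      assume "\<not> ?P w"
      then obtain p q r s where "w = [p, q, r, s]" "r \<notin> S" "s \<notin> S" using nz by blast
      then show False using that by (auto simp: S_letters_def split: if_splits)
    qed
    have 2: "?M2 \<subseteq> leading_in 4 ?P"
      by (rule subset_trans[OF CRS_CRS_leading leading_in_mono]) (rule z2)
    have 5: "\<Gamma> 5 \<subseteq> leading_in 4 ?P" using \<Gamma>_deeper[of 4] by simp
    show "?D \<subseteq> leading_in 4 ?P"
      using 1 2 5 by (intro set_mult_least leading_in_subgroup) auto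
    show "keys (retract4 ?A Z w) \<subseteq> words 4" for w by (rule keys_retract4)
    fix w assume "set w \<subseteq> Z" "length w = 4"
    then obtain x y z t where "w = [x, y, z, t]" "x \<in> Z" "y \<in> Z" "z \<in> Z" "t \<in> Z"
      by (auto simp: eval_nat_numeral length_Suc_conv)
    then show "frag_extend (retract4 ?A Z) (lie_polynomial w) - frag_of w \<in> relators ?D 4"
      using rel.retract4 by simp
  qed
qed

end

text \<open>
  The homomorphisms \<open>c\<close> with kernel \<open>R'\<close> and \<open>b\<close> with kernel \<open>F'\<close> are combined into \<open>d = (c, b)\<close> on \<open>R\<close>,
  with values in a free abelian group on a disjoint sum. The elements of \<open>S\<close> are those whose second
  component is 0, so a basis adapted to the first summand is adapted to \<open>S\<close>.
\<close>
lemma exists_adapted_magnus_representation: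
  fixes F :: "('a, 'm) monoid_scheme" (structure) and R :: "'a set"
  assumes F: "is_free_group F" and R: "R \<lhd> F"
  defines "S \<equiv> R \<inter> derived F (carrier F)"
  obtains \<mu> Z where "adapted_magnus_representation F R \<mu> Z S"
proof -
  interpret group F using F by (simp add: is_free_group_def)
  have Rs: "subgroup R F" by (rule normal_imp_subgroup[OF R])
  have RF: "R \<subseteq> carrier F" by (rule subgroup.subset[OF Rs])
  obtain c :: "'a \<Rightarrow> 'a \<Rightarrow>\<^sub>0 int" where c: "additive_on F R c"
    and c0: "\<And>r. r \<in> R \<Longrightarrow> c r = 0 \<longleftrightarrow> r \<in> derived F R"
    using abelianization_embeds_in_free_abelian[OF F Rs] by blast
  obtain b :: "'a \<Rightarrow> 'a \<Rightarrow>\<^sub>0 int" where b: "additive_on F (carrier F) b"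
    and b0: "\<And>r. r \<in> carrier F \<Longrightarrow> b r = 0 \<longleftrightarrow> r \<in> derived F (carrier F)"
    using abelianization_embeds_in_free_abelian[OF F subgroup_self] by blast
  have der: "derived F R \<subseteq> S"
    unfolding S_def
    by (intro Int_greatest derived_incl[OF subset_refl Rs] mono_derived) (use RF in auto)
  let ?i = "frag_extend (\<lambda>u. frag_of (Inl u :: 'a + 'a))" and ?j = "frag_extend (\<lambda>u. frag_of (Inr u :: 'a + 'a))"
  define d where "d r = ?i (c r) + ?j (b r)" for r
  have lookup_d: "lookup (d r) (Inl u) = lookup (c r) u"
    "lookup (d r) (Inr u) = lookup (b r) u" for r u
    by (simp_all add: d_def lookup_add lookup_frag_extend_inj lookup_frag_extend_outside image_iff)
  have d: "additive_on F R d"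
    using c b RF unfolding additive_on_def d_def by (auto simp: frag_extend_add subset_iff)
  have d0: "d r = 0 \<longleftrightarrow> r \<in> derived F R" if r: "r \<in> R" for r
  proof
    assume "d r = 0"
    then have "c r = 0" using lookup_d(1)[of r] by (intro poly_mapping_eqI) simp
    then show "r \<in> derived F R" using c0[OF r] by simp
  next
    assume "r \<in> derived F R"
    then have "c r = 0" "b r = 0" using c0[OF r] b0[of r] r RF der by (auto simp: S_def)
    then show "d r = 0" by (simp add: d_def)
  qed
  have dS: "keys (d r) \<subseteq> range Inl \<longleftrightarrow> r \<in> S" if r: "r \<in> R" for r
  proof -
    have "keys (d r) \<subseteq> range Inl \<longleftrightarrow> (\<forall>u. lookup (d r) (Inr u) = 0)"
    proof
      assume "keys (d r) \<subseteq> range Inl"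
      then show "\<forall>u. lookup (d r) (Inr u) = 0" by (auto simp: in_keys_iff subset_iff image_iff)
    next
      assume *: "\<forall>u. lookup (d r) (Inr u) = 0"
      show "keys (d r) \<subseteq> range Inl"
      proof
        fix u assume "u \<in> keys (d r)"
        then show "u \<in> range Inl" using * by (cases u) (auto simp: in_keys_iff)
      qed
    qed
    also have "\<dots> \<longleftrightarrow> b r = 0" by (auto simp: lookup_d intro!: poly_mapping_eqI)
    also have "\<dots> \<longleftrightarrow> r \<in> S" using b0[of r] r RF by (auto simp: S_def)
    finally show ?thesis .
  qed
  show ?thesis
  proof (rule adapted_basis[OF Rs d, of "range Inl"])
    fix Z l
    assume Z: "Z \<subseteq> R" and l: "additive_on F R l"
      and lZ: "\<And>x. x \<in> R \<Longrightarrow> keys (l x) \<subseteq> Z"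
      and lz: "\<And>z. z \<in> Z \<Longrightarrow> l z = frag_of z"
      and l0: "\<And>x. x \<in> R \<Longrightarrow> l x = 0 \<longleftrightarrow> d x = 0"
      and lS: "\<And>x. x \<in> R \<Longrightarrow> keys (d x) \<subseteq> range Inl \<Longrightarrow>
        keys (l x) \<subseteq> {z \<in> Z. keys (d z) \<subseteq> range Inl}"
    obtain \<mu> where \<mu>: "\<And>r s. r \<in> R \<Longrightarrow> s \<in> R \<Longrightarrow> \<mu> (r \<otimes> s) = convolution (\<mu> r) (\<mu> s)"
      "\<And>r. r \<in> R \<Longrightarrow> \<mu> r [] = 1"
      "\<And>r z. r \<in> R \<Longrightarrow> \<mu> r [z] = lookup (l r) z"
      using exists_magnus_representation[OF F Rs l] by blast
    have "adapted_magnus_representation F R \<mu> Z S"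
    proof (intro adapted_magnus_representation.intro magnus_representation.intro lower_central_series.intro
        lower_central_series_axioms.intro magnus_representation_axioms.intro
        adapted_magnus_representation_axioms.intro)
      show "group F" by (rule is_group)
      show "R \<lhd> F" by (rule R)
      show "Z \<subseteq> R" by (rule Z)
      show "S \<subseteq> R" by (auto simp: S_def)
      show "S \<lhd> F" unfolding S_def by (rule normal_subgroup_intersect[OF R derived_self_is_normal])
      show "derived F R \<subseteq> S" by (rule der)
      show "\<mu> (r \<otimes> s) = convolution (\<mu> r) (\<mu> s)" if "r \<in> R" "s \<in> R" for r s by (rule \<mu>(1)[OF that])
      show "\<mu> r [] = 1" if "r \<in> R" for r by (rule \<mu>(2)[OF that])
      show "finite {z. \<mu> r [z] \<noteq> 0}" if "r \<in> R" for r
        using \<mu>(3)[OF that] finite_lookup[of "l r"] by simp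
      show "\<mu> z [y] = (if y = z then 1 else 0)" if "z \<in> Z" for z y
        using that Z \<mu>(3)[of z y] lz[OF that] by auto
      show "y \<in> S" if "s \<in> S" "\<mu> s [y] \<noteq> 0" for s y
      proof -
        have sR: "s \<in> R" using that by (simp add: S_def)
        then have "y \<in> keys (l s)" using that \<mu>(3)[OF sR] by (simp add: in_keys_iff)
        then have "y \<in> Z" "keys (d y) \<subseteq> range Inl" using lS[OF sR] dS[OF sR] that(1) by auto
        then show ?thesis using dS[of y] Z by auto
      qed
      show "R \<subseteq> M" if M: "subgroup M F" "Z \<subseteq> M" "derived F R \<subseteq> M" for M
      proof
        fix r assume r: "r \<in> R"
        have "\<exists>m. m \<in> M \<and> m \<in> R \<and> l m = v" if "keys v \<subseteq> Z" for v
          using that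
        proof (induction v rule: frag_induction)
          case zero
          then show ?case
            using additive_on_one[OF l Rs] subgroup.one_closed[OF M(1)] subgroup.one_closed[OF Rs] by blast
        next
          case (one z)
          then show ?case using lz[OF one] Z M(2) by blast
        next
          case (diff u v)
          then obtain m m' where m: "m \<in> M" "m \<in> R" "l m = u" "m' \<in> M" "m' \<in> R" "l m' = v" by blast
          have "m \<otimes> inv m' \<in> M" "m \<otimes> inv m' \<in> R"
            using m subgroup.m_closed[OF M(1)] subgroup.m_inv_closed[OF M(1)]
              subgroup.m_closed[OF Rs] subgroup.m_inv_closed[OF Rs] by auto
          then show ?case using additive_on_diff[OF l Rs m(2,5)] m(3,6) by blast
        qed
        from this[OF lZ[OF r]] obtain m where m: "m \<in> M" "m \<in> R" "l m = l r" by blast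
        have rm: "r \<otimes> inv m \<in> R" using r m subgroup.m_closed[OF Rs] subgroup.m_inv_closed[OF Rs] by blast
        have "l (r \<otimes> inv m) = 0" using additive_on_diff[OF l Rs r m(2)] m(3) by simp
        then have "r \<otimes> inv m \<in> M" using l0[OF rm] d0[OF rm] M(3) by blast
        then have "r \<otimes> inv m \<otimes> m \<in> M" using m(1) subgroup.m_closed[OF M(1)] by blast
        moreover have "r \<otimes> inv m \<otimes> m = r" using r m(2) RF by (simp add: m_assoc subset_iff)
        ultimately show "r \<in> M" by simp
      qed
    qed
    then show ?thesis by (rule that)
  qed
qed

theorem theoremA:
  fixes F :: "('a, 'm) monoid_scheme" and R :: "'a set"
  assumes "is_free_group F" and "R \<lhd> F"
  shows "let C = commutator_subgroup F;
             \<gamma> = lower_central F R;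
             S = R \<inter> derived F (carrier F)
         in is_free_abelian_group (F\<lparr>carrier := derived F R\<rparr> Mod C R S) \<and>
            is_free_abelian_group
              (F\<lparr>carrier := \<gamma> 3\<rparr> Mod (\<gamma> 4 <#>\<^bsub>F\<^esub> C (C R S) S)) \<and>
            is_free_abelian_group
              (F\<lparr>carrier := \<gamma> 4\<rparr> Mod
                 (\<gamma> 5 <#>\<^bsub>F\<^esub> C (C (C R S) S) S <#>\<^bsub>F\<^esub> C (C R S) (C R S)))"
proof -
  obtain \<mu> Z where "adapted_magnus_representation F R \<mu> Z (R \<inter> derived F (carrier F))"
    using exists_adapted_magnus_representation[OF assms] by blast
  then interpret adapted_magnus_representation F R \<mu> Z "R \<inter> derived F (carrier F)" .
  show ?thesis
    using degree_two degree_three degree_four by (simp add: Let_def lower_central_2)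
qed

end
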